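(* Let $\mathsf{dist}$ denote the number of equivalence classes of the equidistribution relation $\sim$ on the set of all mesh patterns of length $2$, i.e. on the set of all pairs $(\pi,R)$ with $\pi\in\mathfrak S_2$ and $R\subseteq\{0,1,2\}\times\{0,1,2\}$. Then $105\le \mathsf{dist}\le 106$.
   Context: $\mathfrak S_n$ is the set of permutations of $[n]=\{1,\dots,n\}$, written in one-line notation $\sigma=\sigma_1\cdots\sigma_n$. A mesh pattern of length $2$ is a pair $p=(\pi,R)$ with $\pi\in\mathfrak S_2$ and $R\subseteq\{0,1,2\}\times\{0,1,2\}$ (the set of shaded cells, each cell being named by its bottom-left corner (column, row)). An occurrence of $p$ in $\sigma\in\mathfrak S_n$ is a pair of positions $i_1<i_2$ such that $\sigma_{i_1}\sigma_{i_2}$ is order-isomorphic to $\pi$ and, with $i_0=0$, $i_3=n+1$, $v_0=0$, $v_1<v_2$ the two values $\sigma_{i_1},\sigma_{i_2}$ in increasing order, and $v_3=n+1$, for every $(x,y)\in R$ there is no index $\ell$ with $i_x<\ell<i_{x+1}$ and $v_y<\sigma_\ell<v_{y+1}$. Let $p(\sigma)$ be the number of occurrences of $p$ in $\sigma$, and let $s_{n,k}(p)$ be the number of $\sigma\in\mathfrak S_n$ with $p(\sigma)=k$. Two patterns are equidistributed, $p_1\sim p_2$, if $s_{n,k}(p_1)=s_{n,k}(p_2)$ for all $n,k\ge 0$. *)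

theory Defs
  imports "HOL-Combinatorics.Permutations"
begin

text \<open>A permutation of $\{1,\dots,n\}$ is a function \<open>\<sigma>\<close> with \<open>\<sigma> permutes {1..n}\<close>;
  its one-line notation is $\sigma(1)\cdots\sigma(n)$. A mesh pattern is a pair \<open>(\<pi>, R)\<close>;
  a shaded cell is named by its bottom-left corner \<open>(column, row)\<close>.\<close>

type_synonym mesh_pattern = "(nat \<Rightarrow> nat) \<times> (nat \<times> nat) set"

definition mesh_patterns2 :: "mesh_pattern set" where
  "mesh_patterns2 = {\<pi>. \<pi> permutes {1..2}} \<times> Pow ({0, 1, 2} \<times> {0, 1, 2})"

text \<open>The lists \<open>is\<close> and \<open>vs\<close> below are the grid lines $i_0,i_1,i_2,i_3$ and $v_0,v_1,v_2,v_3$.\<close>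

definition mesh_occurrence :: "nat \<Rightarrow> (nat \<Rightarrow> nat) \<Rightarrow> mesh_pattern \<Rightarrow> nat \<times> nat \<Rightarrow> bool" where
  "mesh_occurrence n \<sigma> p = (\<lambda>(i1, i2).
     1 \<le> i1 \<and> i1 < i2 \<and> i2 \<le> n \<and>
     (\<sigma> i1 < \<sigma> i2 \<longleftrightarrow> fst p 1 < fst p 2) \<and>
     (let is = [0, i1, i2, n + 1];
          vs = [0, min (\<sigma> i1) (\<sigma> i2), max (\<sigma> i1) (\<sigma> i2), n + 1]
      in \<forall>(x, y) \<in> snd p. \<not> (\<exists>l\<in>{1..n}.
           is ! x < l \<and> l < is ! (x + 1) \<and> vs ! y < \<sigma> l \<and> \<sigma> l < vs ! (y + 1))))"

definition mesh_count :: "nat \<Rightarrow> (nat \<Rightarrow> nat) \<Rightarrow> mesh_pattern \<Rightarrow> nat" where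
  "mesh_count n \<sigma> p = card {o2. mesh_occurrence n \<sigma> p o2}"

definition mesh_distribution :: "nat \<Rightarrow> nat \<Rightarrow> mesh_pattern \<Rightarrow> nat" where
  "mesh_distribution n k p = card {\<sigma>. \<sigma> permutes {1..n} \<and> mesh_count n \<sigma> p = k}"

definition equidistribution :: "(mesh_pattern \<times> mesh_pattern) set" where
  "equidistribution = {(p, q). p \<in> mesh_patterns2 \<and> q \<in> mesh_patterns2 \<and>
     (\<forall>n k. mesh_distribution n k p = mesh_distribution n k q)}"

lemma finite_mesh_patterns2: "finite mesh_patterns2"
  unfolding mesh_patterns2_def by (intro finite_cartesian_product finite_permutations) auto

lemma equiv_equidistribution: "equiv mesh_patterns2 equidistribution"
  by (auto simp: equidistribution_def intro!: equivI refl_onI symI transI)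

definition dist_classes :: nat where
  "dist_classes = card (mesh_patterns2 // equidistribution)"

end

theory Submission
  imports Defs "HOL-Combinatorics.Multiset_Permutations"
begin

text \<open>Reversing permutations reduces everything to the $2^9$ shadings of the pattern 12. The upper bound
  connects shadings by rotation and transposition, by reflecting all entries after (or all values above) the first
  entry when column 0 is fully shaded, and by a swap of rows 1 and 2 when $(0,0)$ and $(1,0)$
  are shaded, so that the first entry of an occurrence is the minimum of the prefix ending with the
  second one. The row swaps, and most of the remaining sporadic coincidences, are obtained
  by coupling two generating trees of permutations: at each node the children are matched so that
  occurrences are created and destroyed simultaneously. The pattern with shaded corners
  is treated by moving whole blocks of positions, which shows that equally many permutations
  have at least $k$ occurrences. The lower bound compares the distributions for $n \le 6$. One
  pair of classes agrees for these $n$ and is left undecided.\<close>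

section \<open>Occurrences in one-line notation\<close>

text \<open>Column 2 is what shapes the couplings. When prefixes are standardised, a later entry may
  fall into a shaded cell of column 2 and destroy an occurrence. The invariant must then carry a
  matching of slots under which the slots that destroy corresponding occurrences correspond. If
  column 2 is arbitrary, prefixes keep their final values instead: the values still to come are
  known as a set, so an occurrence is decided as soon as its second entry is placed, and nothing is
  destroyed. The matching at a node may depend on the pair of nodes reached so far, so no closed
  formula for the resulting bijection of permutations is needed. For the corner pattern, exchanging
  the outer blocks preserves one chosen occurrence but not the number of occurrences. Permutations
  are therefore marked with an occurrence of prescribed rank, and the rank has to be readable from
  the part that is not moved. For the lower bound any differing coefficient is enough, so
  distributions may be compared through truncated tables.\<close>

definition mcell :: "nat \<Rightarrow> nat \<Rightarrow> nat \<Rightarrow> nat" where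
  "mcell a b x = (if x < a then 0 else if x < b then 1 else 2)"

text \<open>\<open>mcell\<close> puts the lower grid line into cell 1 and the upper one into cell 2.
  For a permutation this is harmless, since \<open>i\<close> and \<open>j\<close> are skipped and no
  other entry shares their values. Positions count from 0, values from 1.\<close>

definition occs :: "(nat \<times> nat) set \<Rightarrow> nat list \<Rightarrow> (nat \<times> nat) set" where
  "occs R xs = {(i, j). i < j \<and> j < length xs \<and> xs ! i < xs ! j \<and>
     (\<forall>l<length xs. l \<noteq> i \<longrightarrow> l \<noteq> j \<longrightarrow> (mcell i j l, mcell (xs ! i) (xs ! j) (xs ! l)) \<notin> R)}"

definition perms :: "nat \<Rightarrow> nat list set" where
  "perms n = permutations_of_set {1..n}"

definition equid :: "(nat \<times> nat) set \<Rightarrow> (nat \<times> nat) set \<Rightarrow> bool" where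
  "equid R S \<longleftrightarrow> (\<forall>n k. card {xs \<in> perms n. card (occs R xs) = k} = card {xs \<in> perms n. card (occs S xs) = k})"

lemma equid_refl: "equid R R" and equid_sym: "equid R S \<Longrightarrow> equid S R"
  and equid_trans: "equid R S \<Longrightarrow> equid S T \<Longrightarrow> equid R T"
  by (auto simp: equid_def)

lemma finite_occs [simp]: "finite (occs R xs)"
  by (rule finite_subset[of _ "{..<length xs} \<times> {..<length xs}"]) (auto simp: occs_def)

lemma perms_iff: "xs \<in> perms n \<longleftrightarrow> distinct xs \<and> set xs = {1..n}"
  unfolding perms_def permutations_of_set_def by blast

lemma perms_D:
  assumes "xs \<in> perms n"
  shows "distinct xs" "set xs = {1..n}" "length xs = n"
    and "\<And>i. i < n \<Longrightarrow> 0 < xs ! i \<and> xs ! i \<le> n"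
    and "\<And>i j. i < n \<Longrightarrow> j < n \<Longrightarrow> xs ! i = xs ! j \<longleftrightarrow> i = j"
proof -
  show d: "distinct xs" and s: "set xs = {1..n}"
    using assms by (auto simp: perms_iff)
  show l: "length xs = n" using distinct_card[OF d] s by simp
  show "0 < xs ! i \<and> xs ! i \<le> n" if "i < n" for i
    using nth_mem[of i xs] s l that by simp
  show "xs ! i = xs ! j \<longleftrightarrow> i = j" if "i < n" "j < n" for i j
    using nth_eq_iff_index_eq[OF d] l that by simp
qed

lemma perms_ex:
  assumes "xs \<in> perms n" "1 \<le> v" "v \<le> n"
  shows "\<exists>l<n. xs ! l = v"
  using perms_D[OF assms(1)] assms(2,3) by (metis atLeastAtMost_iff in_set_conv_nth)

section \<open>Equidistribution from bijections of permutations\<close>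

lemma equid_bij:
  assumes "\<And>n. \<exists>F. bij_betw F (perms n) (perms n) \<and>
    (\<forall>xs\<in>perms n. card (occs S (F xs)) = card (occs R xs))"
  shows "equid R S"
  unfolding equid_def
proof (intro allI)
  fix n k
  obtain F where F: "bij_betw F (perms n) (perms n)"
    "\<And>xs. xs \<in> perms n \<Longrightarrow> card (occs S (F xs)) = card (occs R xs)" using assms by blast
  have "bij_betw F {xs \<in> perms n. card (occs R xs) = k} {xs \<in> perms n. card (occs S xs) = k}"
    unfolding bij_betw_def
  proof
    show "inj_on F {xs \<in> perms n. card (occs R xs) = k}"
      using F(1) by (auto simp: bij_betw_def inj_on_def)
    show "F ` {xs \<in> perms n. card (occs R xs) = k} = {xs \<in> perms n. card (occs S xs) = k}"
    proof safe
      fix ys assume ys: "ys \<in> perms n"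
      obtain xs where "xs \<in> perms n" "ys = F xs" using F(1) ys by (auto simp: bij_betw_def)
      then show "ys \<in> F ` {xs \<in> perms n. card (occs R xs) = card (occs S ys)}" using F(2) by auto
    qed (use F in \<open>auto simp: bij_betw_def\<close>)
  qed
  then show "card {xs \<in> perms n. card (occs R xs) = k} = card {xs \<in> perms n. card (occs S xs) = k}"
    by (rule bij_betw_same_card)
qed

lemma equid_invol:
  assumes "\<And>n xs. xs \<in> perms n \<Longrightarrow> F xs \<in> perms n"
    and "\<And>n xs. xs \<in> perms n \<Longrightarrow> F (F xs) = xs"
    and "\<And>n xs. xs \<in> perms n \<Longrightarrow> card (occs S (F xs)) = card (occs R xs)"
  shows "equid R S"
proof (rule equid_bij)
  fix n
  have "bij_betw F (perms n) (perms n)"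
    by (rule bij_betw_byWitness[where f' = F]) (use assms in auto)
  with assms(3) show "\<exists>F. bij_betw F (perms n) (perms n) \<and>
    (\<forall>xs\<in>perms n. card (occs S (F xs)) = card (occs R xs))" by blast
qed

text \<open>\<open>F\<close> is extended level by level: an edge \<open>(s, x)\<close> goes to
  \<open>(F s, \<theta> s x)\<close>, where the matching of labels is chosen for the pair
  \<open>s\<close>, \<open>F s\<close>. \<open>Sim\<close> records what must be known about the pair
  in order to choose the next matching, and at the last level it yields the equality of
  counts.\<close>

lemma coupled_trees:
  fixes A :: "nat \<Rightarrow> 'a set" and c :: "nat \<Rightarrow> 'a \<Rightarrow> 'b \<Rightarrow> 'a"
  assumes root: "\<exists>F. bij_betw F (A m) (A m) \<and> (\<forall>s\<in>A m. Sim m s (F s))"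
    and children: "\<And>r. m \<le> r \<Longrightarrow> r < n \<Longrightarrow> bij_betw (\<lambda>(s, x). c r s x) (SIGMA s:A r. X r s) (A (Suc r))"
    and step: "\<And>r s s'. m \<le> r \<Longrightarrow> r < n \<Longrightarrow> s \<in> A r \<Longrightarrow> s' \<in> A r \<Longrightarrow> Sim r s s' \<Longrightarrow>
      \<exists>\<theta>. bij_betw \<theta> (X r s) (X r s') \<and> (\<forall>x\<in>X r s. Sim (Suc r) (c r s x) (c r s' (\<theta> x)))"
    and "m \<le> n"
  shows "\<exists>F. bij_betw F (A n) (A n) \<and> (\<forall>s\<in>A n. Sim n s (F s))"
proof -
  have "r \<le> n \<longrightarrow> (\<exists>F. bij_betw F (A r) (A r) \<and> (\<forall>s\<in>A r. Sim r s (F s)))" if "m \<le> r" for r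
    using that
  proof (induction r rule: dec_induct)
    case base
    then show ?case using root by simp
  next
    case (step r)
    show ?case
    proof
      assume r: "Suc r \<le> n"
      then obtain F where F: "bij_betw F (A r) (A r)" and S: "\<And>s. s \<in> A r \<Longrightarrow> Sim r s (F s)"
        using step.IH by auto
      have FA: "F s \<in> A r" if "s \<in> A r" for s using F that by (auto simp: bij_betw_def)
      have "\<forall>s\<in>A r. \<exists>\<theta>. bij_betw \<theta> (X r s) (X r (F s)) \<and>
          (\<forall>x\<in>X r s. Sim (Suc r) (c r s x) (c r (F s) (\<theta> x)))"
        using assms(3)[OF step.hyps(1) _ _ FA S] r by simp
      then obtain \<theta> where \<theta>: "\<And>s. s \<in> A r \<Longrightarrow> bij_betw (\<theta> s) (X r s) (X r (F s))"
        "\<And>s x. s \<in> A r \<Longrightarrow> x \<in> X r s \<Longrightarrow> Sim (Suc r) (c r s x) (c r (F s) (\<theta> s x))"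
        using bchoice[of "A r" "\<lambda>s \<theta>. bij_betw \<theta> (X r s) (X r (F s)) \<and>
          (\<forall>x\<in>X r s. Sim (Suc r) (c r s x) (c r (F s) (\<theta> x)))"] by blast
      let ?S = "SIGMA s:A r. X r s" and ?c = "\<lambda>(s, x). c r s x"
      let ?g = "\<lambda>(s, x). (F s, \<theta> s x)"
      have g: "bij_betw ?g ?S ?S"
        unfolding bij_betw_def
      proof
        show "inj_on ?g ?S"
        proof (rule inj_onI)
          fix p q assume "p \<in> ?S" "q \<in> ?S" "?g p = ?g q"
          moreover obtain s x t y where "p = (s, x)" "q = (t, y)" by (cases p; cases q) auto
          ultimately have h: "s \<in> A r" "t \<in> A r" "x \<in> X r s" "y \<in> X r t" "F s = F t" "\<theta> s x = \<theta> t y"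
            "p = (s, x)" "q = (t, y)" by auto
          then have "s = t" using F by (auto simp: bij_betw_def inj_on_def)
          with h \<theta>(1)[of s] show "p = q" by (auto simp: bij_betw_def inj_on_def)
        qed
        show "?g ` ?S = ?S"
        proof (intro equalityI subsetI)
          fix q assume "q \<in> ?S"
          then obtain t y where q: "q = (t, y)" "t \<in> A r" "y \<in> X r t" by auto
          obtain s where s: "s \<in> A r" "F s = t" using bij_betw_imp_surj_on[OF F] q(2) by (metis imageE)
          obtain x where "x \<in> X r s" "\<theta> s x = y"
            using bij_betw_imp_surj_on[OF \<theta>(1)[OF s(1)]] q s by (metis imageE)
          with s q show "q \<in> ?g ` ?S" by force
        qed (use FA \<theta>(1) in \<open>auto simp: bij_betw_def\<close>)
      qed
      have c: "bij_betw ?c ?S (A (Suc r))" using assms(2)[OF step.hyps(1)] r by simp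
      \<comment> \<open>A node of the next level is the end of a unique edge; \<open>G\<close> moves
        that edge by \<open>?g\<close> and takes its new end.\<close>
      define G where "G = ?c \<circ> ?g \<circ> the_inv_into ?S ?c"
      have "bij_betw G (A (Suc r)) (A (Suc r))"
        unfolding G_def using bij_betw_trans[OF bij_betw_the_inv_into[OF c] bij_betw_trans[OF g c]]
        by (simp add: comp_assoc)
      moreover have "Sim (Suc r) u (G u)" if "u \<in> A (Suc r)" for u
      proof -
        obtain p where p: "p \<in> ?S" "u = ?c p"
          using bij_betw_imp_surj_on[OF c] \<open>u \<in> A (Suc r)\<close> by (metis imageE)
        have "the_inv_into ?S ?c u = p" using the_inv_into_f_f[OF bij_betw_imp_inj_on[OF c] p(1)] p(2) by simp
        then show ?thesis using p \<theta>(2) by (auto simp: G_def)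
      qed
      ultimately show "\<exists>F. bij_betw F (A (Suc r)) (A (Suc r)) \<and> (\<forall>s\<in>A (Suc r). Sim (Suc r) s (F s))"
        by blast
    qed
  qed
  then show ?thesis using \<open>m \<le> n\<close> by blast
qed

section \<open>Symmetries\<close>

lemma mcell_le: "mcell a b x \<le> 2" by (simp add: mcell_def)

lemma mcell_reverse:
  assumes "a < b" "b \<le> N" "x \<le> N" "x \<noteq> a" "x \<noteq> b"
  shows "mcell (N - b) (N - a) (N - x) = 2 - mcell a b x"
  using assms by (auto simp: mcell_def)

text \<open>It suffices to inject the occurrences in \<open>xs\<close> into those in
  \<open>F xs\<close>. As \<open>F\<close> is an involution and \<open>P\<close> is symmetric, the
  same injection applied to \<open>F xs\<close> gives the opposite inequality of the two
  counts.\<close>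

lemma equid_involI:
  assumes "P R S" "\<And>R S. P R S \<Longrightarrow> P S R"
    and "\<And>n xs. xs \<in> perms n \<Longrightarrow> F xs \<in> perms n"
    and "\<And>n xs. xs \<in> perms n \<Longrightarrow> F (F xs) = xs"
    and "\<And>n xs R S. xs \<in> perms n \<Longrightarrow> P R S \<Longrightarrow> inj_on (g xs) (occs R xs)"
    and "\<And>n xs R S i j. xs \<in> perms n \<Longrightarrow> P R S \<Longrightarrow> (i, j) \<in> occs R xs \<Longrightarrow> g xs (i, j) \<in> occs S (F xs)"
  shows "equid R S"
proof (rule equid_invol[where F = F])
  fix n xs assume xs: "xs \<in> perms n"
  have le: "card (occs R xs) \<le> card (occs S (F xs))" if "P R S" "xs \<in> perms n" for R S xs
    by (rule card_inj_on_le[of "g xs"]) (use assms(5,6) that in auto)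
  from le[OF assms(1) xs] le[OF assms(2)[OF assms(1)] assms(3)[OF xs]]
  show "card (occs S (F xs)) = card (occs R xs)" using assms(4)[OF xs] by simp
qed (use assms in auto)

section \<open>Half-turn: the reverse-complement\<close>

definition rc_list :: "nat list \<Rightarrow> nat list" where
  "rc_list xs = map (\<lambda>l. Suc (length xs) - xs ! (length xs - Suc l)) [0..<length xs]"

lemma perms_nthI:
  assumes "length ys = n" "\<And>l. l < n \<Longrightarrow> 0 < ys ! l \<and> ys ! l \<le> n"
    "\<And>l m. l < m \<Longrightarrow> m < n \<Longrightarrow> ys ! l \<noteq> ys ! m"
  shows "ys \<in> perms n"
proof -
  have d: "distinct ys" using assms by (auto simp: distinct_conv_nth) (metis linorder_neqE_nat)
  have "set ys \<subseteq> {1..n}" using assms(1,2) by (auto simp: in_set_conv_nth Suc_le_eq)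
  moreover have "card (set ys) = n" using distinct_card[OF d] assms(1) by simp
  ultimately have "set ys = {1..n}" by (simp add: card_subset_eq)
  with d show ?thesis by (simp add: perms_iff)
qed

text \<open>Position l goes to n - 1 - l and value v to n + 1 - v, so the entries of an occurrence
  change places and both coordinates of every cell turn into 2 minus themselves.\<close>

lemma equid_rc:
  assumes "\<And>x y. x \<le> 2 \<Longrightarrow> y \<le> 2 \<Longrightarrow> (x, y) \<in> S \<longleftrightarrow> (2 - x, 2 - y) \<in> R"
  shows "equid R S"
proof (rule equid_involI[where F = rc_list and
      P = "\<lambda>R S. \<forall>x\<le>2. \<forall>y\<le>2. (x, y) \<in> S \<longleftrightarrow> (2 - x, 2 - y) \<in> R" and
      g = "\<lambda>xs (i, j). (length xs - Suc j, length xs - Suc i)"])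
  fix n xs assume xs: "xs \<in> perms n"
  note p = perms_D[OF xs]
  show "rc_list xs \<in> perms n"
  proof (rule perms_nthI)
    fix l assume "l < n"
    then show "0 < rc_list xs ! l \<and> rc_list xs ! l \<le> n"
      using p(3) p(4)[of "n - Suc l"] by (auto simp: rc_list_def)
  next
    fix l m assume "l < m" "m < n"
    then show "rc_list xs ! l \<noteq> rc_list xs ! m"
      using p(3) p(4)[of "n - Suc l"] p(4)[of "n - Suc m"] p(5)[of "n - Suc l" "n - Suc m"]
      by (simp add: rc_list_def) linarith
  qed (simp add: rc_list_def p)
  show "rc_list (rc_list xs) = xs"
  proof (rule nth_equalityI)
    fix l assume "l < length (rc_list (rc_list xs))"
    then have l: "l < n" using p by (simp add: rc_list_def)
    then show "rc_list (rc_list xs) ! l = xs ! l"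
      using p(3) p(4)[of l] by (simp add: rc_list_def)
  qed (simp add: rc_list_def)
  fix R S :: "(nat \<times> nat) set" assume P: "\<forall>x\<le>2. \<forall>y\<le>2. (x, y) \<in> S \<longleftrightarrow> (2 - x, 2 - y) \<in> R"
  show "inj_on (\<lambda>(i, j). (length xs - Suc j, length xs - Suc i)) (occs R xs)"
    by (auto simp: inj_on_def occs_def)
  fix i j assume ij: "(i, j) \<in> occs R xs"
  have nth: "rc_list xs ! l = Suc n - xs ! (n - Suc l)" if "l < n" for l
    using that p by (simp add: rc_list_def)
  have len: "length (rc_list xs) = n" using p by (simp add: rc_list_def)
  have h: "i < j" "j < n" "xs ! i < xs ! j" using ij p by (auto simp: occs_def)
  have "(n - Suc j, n - Suc i) \<in> occs S (rc_list xs)"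
    unfolding occs_def len
  proof (clarify, intro conjI allI impI)
    show "n - Suc j < n - Suc i" "n - Suc i < n" using h by auto
    show "rc_list xs ! (n - Suc j) < rc_list xs ! (n - Suc i)"
      using h p(4)[of i] p(4)[of j] by (simp add: nth)
    fix l assume l: "l < n" "l \<noteq> n - Suc j" "l \<noteq> n - Suc i"
    let ?m = "n - Suc l"
    have m: "?m < n" "?m \<noteq> i" "?m \<noteq> j" using l h by auto
    then have "(mcell i j ?m, mcell (xs ! i) (xs ! j) (xs ! ?m)) \<notin> R"
      using ij p by (auto simp: occs_def)
    moreover have "mcell (n - Suc j) (n - Suc i) l = 2 - mcell i j ?m"
      using l h by (auto simp: mcell_def)
    moreover have "mcell (rc_list xs ! (n - Suc j)) (rc_list xs ! (n - Suc i)) (rc_list xs ! l)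
       = 2 - mcell (xs ! i) (xs ! j) (xs ! ?m)"
      using mcell_reverse[of "xs ! i" "xs ! j" "Suc n" "xs ! ?m"] l h m p(4)[of i] p(4)[of j]
        p(4)[of ?m] p(5)[of ?m i] p(5)[of ?m j] by (simp add: nth)
    ultimately show "(mcell (n - Suc j) (n - Suc i) l, mcell (rc_list xs ! (n - Suc j))
        (rc_list xs ! (n - Suc i)) (rc_list xs ! l)) \<notin> S"
      using P by (simp add: mcell_le)
  qed
  then show "(\<lambda>(i, j). (length xs - Suc j, length xs - Suc i)) (i, j) \<in> occs S (rc_list xs)"
    using p by simp
next
  fix R S :: "(nat \<times> nat) set" assume P: "\<forall>x\<le>2. \<forall>y\<le>2. (x, y) \<in> S \<longleftrightarrow> (2 - x, 2 - y) \<in> R"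
  then show "\<forall>x\<le>2. \<forall>y\<le>2. (x, y) \<in> R \<longleftrightarrow> (2 - x, 2 - y) \<in> S" by simp
qed (use assms in simp)

section \<open>Transposition: the inverse permutation\<close>

definition index :: "nat list \<Rightarrow> nat \<Rightarrow> nat" where
  "index xs v = (THE l. l < length xs \<and> xs ! l = v)"

definition inverse_list :: "nat list \<Rightarrow> nat list" where
  "inverse_list xs = map (\<lambda>v. Suc (index xs (Suc v))) [0..<length xs]"

lemma index_perms:
  assumes "xs \<in> perms n"
  shows "l < n \<Longrightarrow> index xs (xs ! l) = l" "v < n \<Longrightarrow> index xs (Suc v) < n \<and> xs ! index xs (Suc v) = Suc v"
proof -
  note p = perms_D[OF assms]
  show "index xs (xs ! l) = l" if "l < n" for l
    unfolding index_def using that p by (auto intro!: the_equality)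
  moreover assume "v < n"
  ultimately show "index xs (Suc v) < n \<and> xs ! index xs (Suc v) = Suc v"
    using perms_ex[OF assms, of "Suc v"] by force
qed

lemma inverse_list_nth:
  assumes "xs \<in> perms n"
  shows "length (inverse_list xs) = n" "l < n \<Longrightarrow> inverse_list xs ! (xs ! l - 1) = Suc l"
    "v < n \<Longrightarrow> inverse_list xs ! v = Suc (index xs (Suc v))"
proof -
  note p = perms_D[OF assms]
  show "length (inverse_list xs) = n" by (simp add: inverse_list_def p)
  show "l < n \<Longrightarrow> inverse_list xs ! (xs ! l - 1) = Suc l"
    using p(3) p(4)[of l] index_perms(1)[OF assms, of l] by (simp add: inverse_list_def less_eq_Suc_le)
  show "v < n \<Longrightarrow> inverse_list xs ! v = Suc (index xs (Suc v))"
    using p(3) by (simp add: inverse_list_def)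
qed

lemma inverse_list_perms:
  assumes xs: "xs \<in> perms n" shows "inverse_list xs \<in> perms n"
proof (rule perms_nthI)
  fix l m assume "l < m" "m < n"
  then show "inverse_list xs ! l \<noteq> inverse_list xs ! m"
    using inverse_list_nth(3)[OF xs] index_perms(2)[OF xs] by (metis Suc_inject less_trans nat_neq_iff)
qed (use inverse_list_nth[OF xs] index_perms(2)[OF xs] in \<open>auto simp: Suc_le_eq\<close>)

lemma inverse_list_inverse:
  assumes xs: "xs \<in> perms n" shows "inverse_list (inverse_list xs) = xs"
proof (rule nth_equalityI)
  note y = inverse_list_perms[OF xs]
  show len: "length (inverse_list (inverse_list xs)) = length xs"
    using inverse_list_nth(1)[OF y] perms_D(3)[OF xs] by simp
  fix l assume "l < length (inverse_list (inverse_list xs))"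
  then have l: "l < n" using inverse_list_nth(1)[OF y] by simp
  have "inverse_list (inverse_list xs) ! (inverse_list xs ! (xs ! l - 1) - 1) = Suc (xs ! l - 1)"
    by (rule inverse_list_nth(2)[OF y]) (use perms_D(4)[OF xs l] in auto)
  then show "inverse_list (inverse_list xs) ! l = xs ! l"
    using inverse_list_nth(2)[OF xs l] perms_D(4)[OF xs l] by simp
qed

text \<open>Passing to the inverse permutation exchanges positions and values. Both increase along
  an ascent, so the order of its two entries is kept; the shifts by 1 reconcile positions from 0
  with values from 1.\<close>

lemma equid_transpose:
  assumes "\<And>x y. x \<le> 2 \<Longrightarrow> y \<le> 2 \<Longrightarrow> (x, y) \<in> S \<longleftrightarrow> (y, x) \<in> R"
  shows "equid R S"
proof (rule equid_involI[where F = inverse_list and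
      P = "\<lambda>R S. \<forall>x\<le>2. \<forall>y\<le>2. (x, y) \<in> S \<longleftrightarrow> (y, x) \<in> R" and
      g = "\<lambda>xs (i, j). (xs ! i - 1, xs ! j - 1)"])
  fix n xs assume xs: "xs \<in> perms n"
  note p = perms_D[OF xs]
  show "inverse_list xs \<in> perms n" "inverse_list (inverse_list xs) = xs"
    by (fact inverse_list_perms[OF xs] inverse_list_inverse[OF xs])+
  fix R S :: "(nat \<times> nat) set" assume P: "\<forall>x\<le>2. \<forall>y\<le>2. (x, y) \<in> S \<longleftrightarrow> (y, x) \<in> R"
  show "inj_on (\<lambda>(i, j). (xs ! i - 1, xs ! j - 1)) (occs R xs)"
  proof (rule inj_onI, clarify)
    fix i j i' j' assume a: "(i, j) \<in> occs R xs" "(i', j') \<in> occs R xs"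
      "xs ! i - 1 = xs ! i' - 1" "xs ! j - 1 = xs ! j' - 1"
    then have "i < n" "j < n" "i' < n" "j' < n" using p by (auto simp: occs_def)
    then show "i = i' \<and> j = j'" using a(3,4) p(4)[of i] p(4)[of j] p(4)[of i'] p(4)[of j'] p(5)
      by (metis Suc_diff_1 less_le_trans less_one)
  qed
  fix i j assume ij: "(i, j) \<in> occs R xs"
  have h: "i < j" "j < n" "xs ! i < xs ! j" using ij p by (auto simp: occs_def)
  note len = inverse_list_nth(1)[OF xs] and nth = inverse_list_nth(2)[OF xs]
  have "(xs ! i - 1, xs ! j - 1) \<in> occs S (inverse_list xs)"
    unfolding occs_def len
  proof (clarify, intro conjI allI impI)
    show "xs ! i - 1 < xs ! j - 1" "xs ! j - 1 < n" using h p(4)[of i] p(4)[of j] by auto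
    show "inverse_list xs ! (xs ! i - 1) < inverse_list xs ! (xs ! j - 1)"
      using h nth[of i] nth[of j] by simp
    fix v assume v: "v < n" "v \<noteq> xs ! i - 1" "v \<noteq> xs ! j - 1"
    define l where "l = index xs (Suc v)"
    have l: "l < n" "xs ! l = Suc v" using index_perms(2)[OF xs v(1)] by (auto simp: l_def)
    then have l': "l \<noteq> i" "l \<noteq> j" using v by auto
    have "(mcell i j l, mcell (xs ! i) (xs ! j) (xs ! l)) \<notin> R"
      using ij p l l' by (auto simp: occs_def)
    moreover have "mcell (xs ! i - 1) (xs ! j - 1) v = mcell (xs ! i) (xs ! j) (xs ! l)"
      using l h p(4)[of i] p(4)[of j] by (auto simp: mcell_def)
    moreover have "mcell (inverse_list xs ! (xs ! i - 1)) (inverse_list xs ! (xs ! j - 1)) (inverse_list xs ! v)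
       = mcell i j l"
      using nth[of i] nth[of j] nth[of l] h l by (auto simp: mcell_def)
    ultimately show "(mcell (xs ! i - 1) (xs ! j - 1) v, mcell (inverse_list xs ! (xs ! i - 1))
        (inverse_list xs ! (xs ! j - 1)) (inverse_list xs ! v)) \<notin> S"
      using P by (simp add: mcell_le)
  qed
  then show "(\<lambda>(i, j). (xs ! i - 1, xs ! j - 1)) (i, j) \<in> occs S (inverse_list xs)" by simp
qed (use assms in auto)

section \<open>Reflections when column 0 is fully shaded\<close>

definition swap12 :: "nat \<Rightarrow> nat" where "swap12 x = (if x = 1 then 2 else if x = 2 then 1 else x)"

lemma mcell_reflect_above:
  assumes "a < b" "b \<le> n" "x \<le> n" "x \<noteq> a" "x \<noteq> b"
  shows "mcell a (Suc (n + a) - b) (if a < x then Suc (n + a) - x else x) = swap12 (mcell a b x)"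
  using assms by (auto simp: mcell_def swap12_def)

lemma swap12_swap12 [simp]: "swap12 (swap12 x) = x" and swap12_le [simp]: "swap12 x \<le> 2 \<longleftrightarrow> x \<le> 2"
  by (auto simp: swap12_def)

text \<open>Position 0, if different from \<open>i\<close>, would lie in column 0, all of whose
  cells are shaded.\<close>

lemma occs_first:
  assumes "{(0, 0), (0, 1), (0, 2)} \<subseteq> R" "(i, j) \<in> occs R xs"
  shows "i = 0"
proof (rule ccontr)
  assume "i \<noteq> 0"
  then have "(mcell i j 0, mcell (xs ! i) (xs ! j) (xs ! 0)) \<notin> R"
    using assms(2) unfolding occs_def
    by (metis (mono_tags, lifting) case_prodD gr_implies_not0 less_trans mem_Collect_eq neq0_conv)
  moreover have "mcell i j 0 = 0" using \<open>i \<noteq> 0\<close> by (simp add: mcell_def)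
  moreover have "mcell (xs ! i) (xs ! j) (xs ! 0) \<in> {0, 1, 2}" by (simp add: mcell_def)
  ultimately show False using assms(1) by auto
qed

text \<open>The first entry of an occurrence is the first entry of the permutation. Reversing
  everything after it keeps all values and exchanges the stretch before the second entry with the
  one behind it.\<close>

lemma equid_first_cols:
  assumes "{(0, 0), (0, 1), (0, 2)} \<subseteq> R" "{(0, 0), (0, 1), (0, 2)} \<subseteq> S"
    and "\<And>x y. x \<le> 2 \<Longrightarrow> y \<le> 2 \<Longrightarrow> (x, y) \<in> S \<longleftrightarrow> (swap12 x, y) \<in> R"
  shows "equid R S"
proof (rule equid_involI[where
      F = "\<lambda>xs. map (\<lambda>l. xs ! (if l = 0 then 0 else length xs - l)) [0..<length xs]" and
      P = "\<lambda>R S. {(0, 0), (0, 1), (0, 2)} \<subseteq> R \<and> {(0, 0), (0, 1), (0, 2)} \<subseteq> S \<and>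
        (\<forall>x\<le>2. \<forall>y\<le>2. (x, y) \<in> S \<longleftrightarrow> (swap12 x, y) \<in> R)" and
      g = "\<lambda>xs (i, j). (i, length xs - j)"])
  let ?F = "\<lambda>xs :: nat list. map (\<lambda>l. xs ! (if l = 0 then 0 else length xs - l)) [0..<length xs]"
  fix n xs assume xs: "xs \<in> perms n"
  note p = perms_D[OF xs]
  show "?F xs \<in> perms n"
    by (rule perms_nthI) (auto simp: p)
  show "?F (?F xs) = xs" by (rule nth_equalityI) (auto simp: p)
  fix R S :: "(nat \<times> nat) set" assume P: "{(0, 0), (0, 1), (0, 2)} \<subseteq> R \<and> {(0, 0), (0, 1), (0, 2)} \<subseteq> S \<and>
        (\<forall>x\<le>2. \<forall>y\<le>2. (x, y) \<in> S \<longleftrightarrow> (swap12 x, y) \<in> R)"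
  show "inj_on (\<lambda>(i, j). (i, length xs - j)) (occs R xs)"
    by (auto simp: inj_on_def occs_def)
  fix i j assume ij: "(i, j) \<in> occs R xs"
  then have i: "i = 0" using occs_first[of R i j xs] P by simp
  have h: "0 < j" "j < n" "xs ! 0 < xs ! j" using ij i p by (auto simp: occs_def)
  define ys where "ys = ?F xs"
  have len: "length ys = n" and nth: "\<And>l. l < n \<Longrightarrow> ys ! l = xs ! (if l = 0 then 0 else n - l)"
    by (simp_all add: ys_def p(3))
  have nj: "ys ! 0 = xs ! 0" "ys ! (n - j) = xs ! j" using h by (simp_all add: nth)
  have "(0, n - j) \<in> occs S ys"
    unfolding occs_def mem_Collect_eq case_prod_conv len nj
  proof (intro conjI allI impI)
    fix l assume l: "l < n" "l \<noteq> 0" "l \<noteq> n - j"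
    then have l': "n - l < n" "n - l \<noteq> 0" "n - l \<noteq> j" using h by linarith+
    then have "(mcell 0 j (n - l), mcell (xs ! 0) (xs ! j) (xs ! (n - l))) \<notin> R"
      using ij i p(3) by (auto simp: occs_def)
    moreover have "mcell 0 (n - j) l = swap12 (mcell 0 j (n - l))"
      using l l' h by (auto simp: mcell_def swap12_def)
    moreover have "ys ! l = xs ! (n - l)" using l by (simp add: nth)
    ultimately show "(mcell 0 (n - j) l, mcell (xs ! 0) (xs ! j) (ys ! l)) \<notin> S"
      using P by (simp add: mcell_le)
  qed (use h in simp_all)
  then have "(0, n - j) \<in> occs S (?F xs)" by (simp only: ys_def)
  then show "(\<lambda>(i, j). (i, length xs - j)) (i, j) \<in> occs S (?F xs)" using i p by simp
next
  fix R S :: "(nat \<times> nat) set" assume P: "{(0, 0), (0, 1), (0, 2)} \<subseteq> R \<and> {(0, 0), (0, 1), (0, 2)} \<subseteq> S \<and>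
        (\<forall>x\<le>2. \<forall>y\<le>2. (x, y) \<in> S \<longleftrightarrow> (swap12 x, y) \<in> R)"
  show "{(0, 0), (0, 1), (0, 2)} \<subseteq> S \<and> {(0, 0), (0, 1), (0, 2)} \<subseteq> R \<and>
        (\<forall>x\<le>2. \<forall>y\<le>2. (x, y) \<in> R \<longleftrightarrow> (swap12 x, y) \<in> S)"
    using P by simp
qed (use assms in \<open>auto simp: inj_on_def\<close>)

text \<open>Here the values above the first entry are reflected among themselves and the smaller
  ones stay, which exchanges rows 1 and 2 and fixes row 0. The computation for a cell is
  \<open>mcell_reflect_above\<close>.\<close>

lemma equid_first_rows:
  assumes "{(0, 0), (0, 1), (0, 2)} \<subseteq> R" "{(0, 0), (0, 1), (0, 2)} \<subseteq> S"
    and "\<And>x y. x \<le> 2 \<Longrightarrow> y \<le> 2 \<Longrightarrow> (x, y) \<in> S \<longleftrightarrow> (x, swap12 y) \<in> R"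
  shows "equid R S"
proof (rule equid_involI[where
      F = "\<lambda>xs. map (\<lambda>v. if xs ! 0 < v then Suc (length xs + xs ! 0) - v else v) xs" and
      P = "\<lambda>R S. {(0, 0), (0, 1), (0, 2)} \<subseteq> R \<and> {(0, 0), (0, 1), (0, 2)} \<subseteq> S \<and>
        (\<forall>x\<le>2. \<forall>y\<le>2. (x, y) \<in> S \<longleftrightarrow> (x, swap12 y) \<in> R)" and
      g = "\<lambda>xs (i, j). (i, j)"])
  let ?f = "\<lambda>xs v. if xs ! 0 < v then Suc (length xs + xs ! 0) - v else v"
  fix n xs assume xs: "xs \<in> perms n"
  note p = perms_D[OF xs]
  show "map (?f xs) xs \<in> perms n"
  proof (rule perms_nthI)
    fix l assume "l < n"
    then show "0 < map (?f xs) xs ! l \<and> map (?f xs) xs ! l \<le> n" using p(3) p(4)[of l] by auto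
  next
    fix l m assume "l < m" "m < n"
    then show "map (?f xs) xs ! l \<noteq> map (?f xs) xs ! m"
      using p(3) p(4)[of l] p(4)[of m] p(5)[of l m] by auto
  qed (simp add: p)
  show "map (?f (map (?f xs) xs)) (map (?f xs) xs) = xs"
  proof (rule nth_equalityI)
    fix l assume "l < length (map (?f (map (?f xs) xs)) (map (?f xs) xs))"
    then have "l < n" "0 < n" using p by auto
    then show "map (?f (map (?f xs) xs)) (map (?f xs) xs) ! l = xs ! l"
      using p(3) p(4)[of l] by auto
  qed simp
  fix R S :: "(nat \<times> nat) set" assume P: "{(0, 0), (0, 1), (0, 2)} \<subseteq> R \<and> {(0, 0), (0, 1), (0, 2)} \<subseteq> S \<and>
        (\<forall>x\<le>2. \<forall>y\<le>2. (x, y) \<in> S \<longleftrightarrow> (x, swap12 y) \<in> R)"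
  fix i j assume ij: "(i, j) \<in> occs R xs"
  then have i: "i = 0" using occs_first[of R i j xs] P by simp
  have h: "0 < j" "j < n" "xs ! 0 < xs ! j" using ij i p by (auto simp: occs_def)
  define ys where "ys = map (?f xs) xs"
  have len: "length ys = n" and nth: "\<And>l. l < n \<Longrightarrow> ys ! l = ?f xs (xs ! l)"
    by (simp_all add: ys_def p(3))
  have nj: "ys ! 0 = xs ! 0" "ys ! j = Suc (n + xs ! 0) - xs ! j" using h p(3) by (simp_all add: nth)
  have "(0, j) \<in> occs S ys"
    unfolding occs_def mem_Collect_eq case_prod_conv len nj
  proof (intro conjI allI impI)
    fix l assume l: "l < n" "l \<noteq> 0" "l \<noteq> j"
    then have "(mcell 0 j l, mcell (xs ! 0) (xs ! j) (xs ! l)) \<notin> R"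
      using ij i p(3) by (auto simp: occs_def)
    moreover have "mcell (xs ! 0) (Suc (n + xs ! 0) - xs ! j) (ys ! l) = swap12 (mcell (xs ! 0) (xs ! j) (xs ! l))"
      using mcell_reflect_above[of "xs ! 0" "xs ! j" n "xs ! l"] l h p(4)[of j] p(4)[of l]
        p(5)[of l 0] p(5)[of l j] by (simp add: nth p(3) split: if_splits)
    ultimately show "(mcell 0 j l, mcell (xs ! 0) (Suc (n + xs ! 0) - xs ! j) (ys ! l)) \<notin> S"
      using P by (simp add: mcell_le)
  next
    show "xs ! 0 < Suc (n + xs ! 0) - xs ! j" using p(4)[of j] h by linarith
  qed (use h in simp_all)
  then have "(0, j) \<in> occs S (map (?f xs) xs)" by (simp only: ys_def)
  then show "(\<lambda>(i, j). (i, j)) (i, j) \<in> occs S (map (?f xs) xs)" using i by simp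
next
  fix R S :: "(nat \<times> nat) set" assume P: "{(0, 0), (0, 1), (0, 2)} \<subseteq> R \<and> {(0, 0), (0, 1), (0, 2)} \<subseteq> S \<and>
        (\<forall>x\<le>2. \<forall>y\<le>2. (x, y) \<in> S \<longleftrightarrow> (x, swap12 y) \<in> R)"
  show "{(0, 0), (0, 1), (0, 2)} \<subseteq> S \<and> {(0, 0), (0, 1), (0, 2)} \<subseteq> R \<and>
        (\<forall>x\<le>2. \<forall>y\<le>2. (x, y) \<in> R \<longleftrightarrow> (x, swap12 y) \<in> S)"
    using P by simp
qed (use assms in \<open>auto simp: inj_on_def\<close>)

section \<open>Appending a last entry\<close>

text \<open>Appending the relative value \<open>x\<close> means entering slot \<open>x\<close>, just above the \<open>x - 1\<close> smaller values.
  Old values are renumbered by \<open>lift x\<close>; \<open>unlift x\<close> sends a slot of the longer permutation to the old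
  slot it is part of.\<close>

definition lift :: "nat \<Rightarrow> nat \<Rightarrow> nat" where
  "lift x v = (if v < x then v else Suc v)"

definition unlift :: "nat \<Rightarrow> nat \<Rightarrow> nat" where
  "unlift x y = (if y \<le> x then y else y - 1)"

definition child :: "nat \<Rightarrow> nat list \<Rightarrow> nat list" where
  "child x xs = map (lift x) xs @ [x]"

lemma lift_less_iff [simp]: "lift x v < lift x w \<longleftrightarrow> v < w"
  and lift_eq_iff [simp]: "lift x v = lift x w \<longleftrightarrow> v = w"
  and lift_neq [simp]: "lift x v \<noteq> x" "x \<noteq> lift x v"
  and lift_less [simp]: "lift x v < x \<longleftrightarrow> v < x"
  and less_lift [simp]: "x < lift x v \<longleftrightarrow> x \<le> v"
  by (auto simp: lift_def)

lemma lift_less_unlift: "lift x v < y \<longleftrightarrow> v < unlift x y"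
  and le_lift_unlift: "y \<le> lift x v \<longleftrightarrow> unlift x y \<le> v"
  by (auto simp: lift_def unlift_def)

lemma length_child [simp]: "length (child x xs) = Suc (length xs)"
  by (simp add: child_def)

lemma child_nth:
  "l < length xs \<Longrightarrow> child x xs ! l = lift x (xs ! l)" "l = length xs \<Longrightarrow> child x xs ! l = x"
  by (simp_all add: child_def nth_append)

lemma child_perms:
  assumes "xs \<in> perms n" "1 \<le> x" "x \<le> Suc n"
  shows "child x xs \<in> perms (Suc n)"
proof -
  note p = perms_D[OF assms(1)]
  show ?thesis
  proof (rule perms_nthI)
    fix l assume "l < Suc n"
    then show "0 < child x xs ! l \<and> child x xs ! l \<le> Suc n"
      using assms p(4)[of l] p(3) by (cases "l = n") (auto simp: child_nth lift_def)
  next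
    fix l m assume "l < m" "m < Suc n"
    then show "child x xs ! l \<noteq> child x xs ! m"
      using p(3) p(5)[of l m] by (cases "m = n") (auto simp: child_nth)
  qed (simp add: p)
qed

lemma bij_betw_child:
  "bij_betw (\<lambda>(xs, x). child x xs) (SIGMA xs:perms n. {1..Suc n}) (perms (Suc n))"
proof (rule bij_betw_byWitness[where
      f' = "\<lambda>zs. (map (\<lambda>v. if v < last zs then v else v - 1) (butlast zs), last zs)"])
  show "\<forall>a\<in>SIGMA xs:perms n. {1..Suc n}.
    (\<lambda>zs. (map (\<lambda>v. if v < last zs then v else v - 1) (butlast zs), last zs))
      (case a of (xs, x) \<Rightarrow> child x xs) = a"
    by (auto simp: child_def lift_def intro!: map_idI)
  show "(\<lambda>(xs, x). child x xs) ` (SIGMA xs:perms n. {1..Suc n}) \<subseteq> perms (Suc n)"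
    using child_perms by auto
  have "child (last zs) (map (\<lambda>v. if v < last zs then v else v - 1) (butlast zs)) = zs \<and>
     map (\<lambda>v. if v < last zs then v else v - 1) (butlast zs) \<in> perms n \<and> last zs \<in> {1..Suc n}"
    if zs: "zs \<in> perms (Suc n)" for zs
  proof -
    note p = perms_D[OF zs]
    obtain ys x where z: "zs = ys @ [x]" using p(3) by (cases zs rule: rev_cases) auto
    have y: "distinct ys" "x \<notin> set ys" "set ys = {1..Suc n} - {x}" "length ys = n"
      and x: "x \<in> {1..Suc n}"
      using p(1,2,3) by (auto simp: z)
    let ?f = "\<lambda>v. if v < x then v else v - 1"
    have 1: "child x (map ?f ys) = zs"
      using y(2) by (auto simp: z child_def lift_def intro!: map_idI) (metis not_less_eq Suc_pred not_gr0 linorder_neqE_nat)+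
    have "map ?f ys \<in> perms n"
    proof (rule perms_nthI)
      fix l assume "l < n"
      then have "ys ! l \<in> {1..Suc n} - {x}" using y(3,4) nth_mem[of l ys] by simp
      then show "0 < map ?f ys ! l \<and> map ?f ys ! l \<le> n" using x y(4) \<open>l < n\<close> by auto
    next
      fix l m assume lm: "l < m" "m < n"
      have "ys ! l \<noteq> x" "ys ! m \<noteq> x" "ys ! l \<noteq> ys ! m"
        using y(2,4) lm nth_mem[of l ys] nth_mem[of m ys] nth_eq_iff_index_eq[OF y(1)] by auto
      then show "map ?f ys ! l \<noteq> map ?f ys ! m" using lm y(4) by auto
    qed (simp add: y)
    with 1 x show ?thesis by (simp add: z)
  qed
  then show "\<forall>a'\<in>perms (Suc n). (case (map (\<lambda>v. if v < last a' then v else v - 1) (butlast a'), last a')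
      of (xs, x) \<Rightarrow> child x xs) = a'"
    "(\<lambda>zs. (map (\<lambda>v. if v < last zs then v else v - 1) (butlast zs), last zs)) ` perms (Suc n)
      \<subseteq> (SIGMA xs:perms n. {1..Suc n})"
    by auto
qed

lemma perms_0: "perms 0 = {[]}" and perms_1: "perms (Suc 0) = {[Suc 0]}"
proof -
  show "perms 0 = {[]}" by (auto simp: perms_iff)
  show "perms (Suc 0) = {[Suc 0]}"
  proof -
    have "xs = [Suc 0]" if "xs \<in> perms (Suc 0)" for xs
      using perms_D(3)[OF that] perms_D(4)[OF that, of 0] by (cases xs) auto
    moreover have "[Suc 0] \<in> perms (Suc 0)" by (simp add: perms_iff)
    ultimately show ?thesis by blast
  qed
qed

text \<open>The tree is rooted at the permutation of length 1 and not at the empty one, so that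
  invariants may speak of the minimum of a prefix; length 0 is trivial.\<close>

lemma equid_by_tree:
  assumes "Sim [Suc 0] [Suc 0]"
    and "\<And>n xs xs'. 0 < n \<Longrightarrow> xs \<in> perms n \<Longrightarrow> xs' \<in> perms n \<Longrightarrow> Sim xs xs' \<Longrightarrow>
      \<exists>\<theta>. bij_betw \<theta> {1..Suc n} {1..Suc n} \<and> (\<forall>x\<in>{1..Suc n}. Sim (child x xs) (child (\<theta> x) xs'))"
    and "\<And>xs xs'. Sim xs xs' \<Longrightarrow> card (occs S xs') = card (occs R xs)"
  shows "equid R S"
proof (rule equid_bij)
  fix n
  show "\<exists>F. bij_betw F (perms n) (perms n) \<and> (\<forall>xs\<in>perms n. card (occs S (F xs)) = card (occs R xs))"
  proof (cases n)
    case 0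
    then show ?thesis by (intro exI[of _ id]) (auto simp: perms_0 occs_def)
  next
    case (Suc m)
    have "\<exists>F. bij_betw F (perms n) (perms n) \<and> (\<forall>xs\<in>perms n. Sim xs (F xs))"
    proof (rule coupled_trees[where Sim = "\<lambda>_. Sim" and m = "Suc 0" and c = "\<lambda>_ xs x. child x xs"
          and X = "\<lambda>r _. {1..Suc r}"])
      show "\<exists>F. bij_betw F (perms (Suc 0)) (perms (Suc 0)) \<and> (\<forall>s\<in>perms (Suc 0). Sim s (F s))"
        using assms(1) by (intro exI[of _ id]) (auto simp: perms_1)
    qed (use assms(2) bij_betw_child Suc in auto)
    then show ?thesis using assms(3) by blast
  qed
qed

text \<open>The first entries of the occurrences that end with the appended entry. Their column 2 is
  empty, and an old value lies below the new entry exactly if it is less than the slot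
  \<open>x\<close>.\<close>

definition news :: "(nat \<times> nat) set \<Rightarrow> nat list \<Rightarrow> nat \<Rightarrow> nat set" where
  "news R xs x = {i. i < length xs \<and> xs ! i < x \<and> (\<forall>l<length xs. l \<noteq> i \<longrightarrow>
     (if l < i then 0 else 1, if xs ! l < xs ! i then 0 else if xs ! l < x then 1 else 2) \<notin> R)}"

lemma finite_news [simp]: "finite (news R xs x)"
  by (rule finite_subset[of _ "{..<length xs}"]) (auto simp: news_def)

lemma mcell_lift [simp]:
  "mcell (lift x a) (lift x b) (lift x c) = mcell a b c"
  "mcell (lift x a) (lift x b) x = (if x \<le> a then 0 else if x \<le> b then 1 else 2)"
  "mcell (lift x a) x (lift x c) = (if c < a then 0 else if c < x then 1 else 2)"
  by (simp_all add: mcell_def)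

lemma occs_child_old:
  assumes "i < j" "j < length xs"
  shows "(i, j) \<in> occs R (child x xs) \<longleftrightarrow>
    (i, j) \<in> occs R xs \<and> (2, if x \<le> xs ! i then 0 else if x \<le> xs ! j then 1 else 2) \<notin> R"
proof -
  let ?n = "length xs"
  have "(\<forall>l<Suc ?n. l \<noteq> i \<longrightarrow> l \<noteq> j \<longrightarrow> P l) \<longleftrightarrow> P ?n \<and> (\<forall>l<?n. l \<noteq> i \<longrightarrow> l \<noteq> j \<longrightarrow> P l)" for P
    unfolding less_Suc_eq using assms by auto
  moreover have "mcell i j ?n = 2" using assms by (simp add: mcell_def)
  ultimately show ?thesis using assms by (auto simp: occs_def child_nth)
qed

lemma occs_child_new: "(i, length xs) \<in> occs R (child x xs) \<longleftrightarrow> i \<in> news R xs x"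
proof -
  let ?n = "length xs"
  have "(\<forall>l<Suc ?n. l \<noteq> i \<longrightarrow> l \<noteq> ?n \<longrightarrow> P l) \<longleftrightarrow> (\<forall>l<?n. l \<noteq> i \<longrightarrow> P l)" for P
    by (metis less_Suc_eq nat_neq_iff)
  moreover have "mcell i ?n l = (if l < i then 0 else 1)" if "l < ?n" for l
    using that by (simp add: mcell_def)
  ultimately show ?thesis
    by (cases "i < ?n") (simp_all add: occs_def news_def child_nth)
qed

lemma occs_child:
  "occs R (child x xs) = {(i, j) \<in> occs R xs. (2, if x \<le> xs ! i then 0 else if x \<le> xs ! j then 1 else 2) \<notin> R}
     \<union> (\<lambda>i. (i, length xs)) ` news R xs x" (is "_ = ?A \<union> ?B")
proof (rule set_eqI, clarify)
  fix i j
  let ?n = "length xs"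
  have o: "(i, j) \<in> occs R xs \<Longrightarrow> i < j \<and> j < ?n" by (simp add: occs_def)
  have c: "(i, j) \<in> occs R (child x xs) \<Longrightarrow> i < j \<and> j < Suc ?n" by (simp add: occs_def)
  have B: "(i, j) \<in> ?B \<longleftrightarrow> j = ?n \<and> i \<in> news R xs x" by auto
  show "(i, j) \<in> occs R (child x xs) \<longleftrightarrow> (i, j) \<in> ?A \<union> ?B"
  proof (cases "j = ?n")
    case True
    then show ?thesis using o B occs_child_new[of i xs R x] by auto
  next
    case False
    then show ?thesis using o c B occs_child_old[of i j xs R x] by auto
  qed
qed

lemma card_occs_child:
  "card (occs R (child x xs)) =
     card {(i, j) \<in> occs R xs. (2, if x \<le> xs ! i then 0 else if x \<le> xs ! j then 1 else 2) \<notin> R} + card (news R xs x)"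
  unfolding occs_child
proof (subst card_Un_disjoint)
  show "finite {(i, j) \<in> occs R xs. (2, if x \<le> xs ! i then 0 else if x \<le> xs ! j then 1 else 2) \<notin> R}"
    by (rule finite_subset[OF _ finite_occs[of R xs]]) auto
qed (auto simp: occs_def card_image inj_on_def)

section \<open>Matchings of slots and their refinement\<close>

lemma bij_betw_inj_intervalI:
  fixes \<theta> :: "nat \<Rightarrow> nat"
  assumes "\<And>y. 1 \<le> y \<Longrightarrow> y \<le> N \<Longrightarrow> 1 \<le> \<theta> y \<and> \<theta> y \<le> N"
    and "\<And>y z. 1 \<le> y \<Longrightarrow> y \<le> N \<Longrightarrow> 1 \<le> z \<Longrightarrow> z \<le> N \<Longrightarrow> \<theta> y = \<theta> z \<Longrightarrow> y = z"
  shows "bij_betw \<theta> {1..N} {1..N}"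
proof -
  have "inj_on \<theta> {1..N}" using assms(2) by (auto simp: inj_on_def)
  moreover have "\<theta> ` {1..N} \<subseteq> {1..N}" using assms(1) by auto
  ultimately show ?thesis by (simp add: bij_betw_def endo_inj_surj)
qed

text \<open>The new entries split slot \<open>x\<close> and its partner \<open>x'\<close> into a
  lower and an upper half. The halves are matched crosswise, as an order-reversing matching
  requires; all other slots follow \<theta>.\<close>

definition split_slots :: "nat \<Rightarrow> nat \<Rightarrow> (nat \<Rightarrow> nat) \<Rightarrow> nat \<Rightarrow> nat" where
  "split_slots x x' \<theta> y = (if y = x then Suc x' else if y = Suc x then x' else lift x' (\<theta> (unlift x y)))"

text \<open>The new matching refines the old one. Comparisons of old values with a slot of the child
  depend only on its \<open>unlift\<close>, so conditions on the parents pass to the children by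
  this equation.\<close>

lemma unlift_split_slots:
  assumes "bij_betw \<theta> {1..N} {1..N}" "x \<in> {1..N}" "1 \<le> y" "y \<le> Suc N"
  shows "unlift (\<theta> x) (split_slots x (\<theta> x) \<theta> y) = \<theta> (unlift x y)"
proof -
  have "unlift x y \<in> {1..N}" using assms by (auto simp: unlift_def)
  moreover have "unlift x y \<noteq> x" if "y \<noteq> x" "y \<noteq> Suc x" using that assms by (auto simp: unlift_def split: if_splits)
  ultimately have "\<theta> (unlift x y) \<noteq> \<theta> x" if "y \<noteq> x" "y \<noteq> Suc x"
    using that inj_onD[OF bij_betw_imp_inj_on[OF assms(1)], of "unlift x y" x] assms(2) by blast
  then show ?thesis
    by (cases "y = x"; cases "y = Suc x") (simp_all add: split_slots_def unlift_def lift_def)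
qed

lemma bij_betw_split_slots:
  assumes "bij_betw \<theta> {1..N} {1..N}" "x \<in> {1..N}"
  shows "bij_betw (split_slots x (\<theta> x) \<theta>) {1..Suc N} {1..Suc N}"
proof (rule bij_betw_inj_intervalI)
  let ?t = "split_slots x (\<theta> x) \<theta>"
  have m: "unlift x y \<in> {1..N}" if "1 \<le> y" "y \<le> Suc N" for y using that assms by (auto simp: unlift_def)
  have t: "\<theta> y \<in> {1..N}" if "y \<in> {1..N}" for y using bij_betwE[OF assms(1)] that by blast
  fix y assume y: "1 \<le> y" "y \<le> Suc N"
  show "1 \<le> ?t y \<and> ?t y \<le> Suc N"
    using t[OF m[OF y]] t[OF assms(2)] by (auto simp: split_slots_def lift_def)
  fix z assume z: "1 \<le> z" "z \<le> Suc N" "?t y = ?t z"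
  then have "\<theta> (unlift x y) = \<theta> (unlift x z)"
    using unlift_split_slots[OF assms y] unlift_split_slots[OF assms z(1,2)] by simp
  then have "unlift x y = unlift x z"
    using inj_onD[OF bij_betw_imp_inj_on[OF assms(1)] _ m[OF y] m[OF z(1,2)]] by blast
  then have "y = z \<or> {y, z} = {x, Suc x}"
    by (cases "y \<le> x"; cases "z \<le> x") (auto simp: unlift_def)
  then show "y = z" using z(3) by (auto simp: split_slots_def doubleton_eq_iff)
qed

section \<open>Swapping the upper rows, one slot at a time\<close>

lemma occs_singleton: "occs R [v] = {}"
proof -
  have "(i, j) \<notin> occs R [v]" for i j by (simp add: occs_def)
  then show ?thesis by auto
qed

text \<open>For any candidate other than the minimum, the minimum lies in its cell (0,0) or (1,0),
  and both are shaded. So a slot creates at most one occurrence, and the remaining cells need to be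
  checked for \<open>i\<close> alone.\<close>

lemma news_argmin:
  assumes xs: "xs \<in> perms n" "i < n" "xs ! i = 1" "(0, 0) \<in> T" "(1, 0) \<in> T"
  shows "news T xs x = (if 1 < x \<and> (\<forall>l<i. (0, if xs ! l < x then 1 else 2) \<notin> T) \<and>
      (\<forall>l<n. i < l \<longrightarrow> (1, if xs ! l < x then 1 else 2) \<notin> T) then {i} else {})"
proof -
  note p = perms_D[OF xs(1)]
  have eq: "k = i" if "k \<in> news T xs x" for k
  proof (rule ccontr)
    assume "k \<noteq> i"
    moreover have "k < n" using that p by (simp add: news_def)
    ultimately have "xs ! i < xs ! k" using p(4)[of k] p(5)[of i k] xs(2,3) by auto
    moreover have "(if i < k then 0 else 1, if xs ! i < xs ! k then 0 else if xs ! i < x then 1 else 2) \<notin> T"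
      using that xs(2) p(3) \<open>k \<noteq> i\<close> unfolding news_def by blast
    ultimately show False using xs(4,5) by (simp split: if_splits)
  qed
  have "xs ! l \<noteq> 0" if "l < n" for l using p(4)[OF that] by simp
  then have iff: "i \<in> news T xs x \<longleftrightarrow> 1 < x \<and> (\<forall>l<i. (0, if xs ! l < x then 1 else 2) \<notin> T) \<and>
      (\<forall>l<n. i < l \<longrightarrow> (1, if xs ! l < x then 1 else 2) \<notin> T)"
    using xs(2,3) p(3) by (simp add: news_def) (smt (verit, best) less_trans nat_neq_iff not_less_iff_gr_or_eq)
  have "news T xs x \<subseteq> {i}" using eq by blast
  then have "news T xs x = (if i \<in> news T xs x then {i} else {})" by (metis empty_iff subset_singletonD singletonI)
  then show ?thesis unfolding iff .
qed

text \<open>A creating slot lies below all entries left of the minimum for \<open>R\<close>, and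
  above all of them for \<open>S\<close>. An old occurrence is destroyed only from above its second
  entry for \<open>R\<close>, only from between its two values for \<open>S\<close>, and only if
  (2,2) belongs to \<open>R\<close>. The cells (1,1), (1,2), (2,2) remain free.\<close>

locale row_swap =
  fixes R S :: "(nat \<times> nat) set"
  assumes R: "(0, 0) \<in> R" "(1, 0) \<in> R" "(0, 1) \<in> R" "(0, 2) \<notin> R" "(2, 0) \<notin> R" "(2, 1) \<notin> R"
    and S: "\<And>x y. x \<le> 2 \<Longrightarrow> y \<le> 2 \<Longrightarrow> (x, y) \<in> S \<longleftrightarrow> (x, swap12 y) \<in> R"
begin

lemma S_iff: "(0, 0) \<in> S" "(Suc 0, 0) \<in> S" "(0, 2) \<in> S" "(0, Suc 0) \<notin> S" "(2, 0) \<notin> S" "(2, 2) \<notin> S"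
  "(Suc 0, Suc 0) \<in> S \<longleftrightarrow> (Suc 0, 2) \<in> R" "(Suc 0, 2) \<in> S \<longleftrightarrow> (Suc 0, Suc 0) \<in> R"
  "(2, Suc 0) \<in> S \<longleftrightarrow> (2, 2) \<in> R"
  using R S[of 0 0] S[of 1 0] S[of 0 2] S[of 0 1] S[of 2 0] S[of 2 2] S[of 1 1] S[of 1 2] S[of 2 1]
  by (simp_all add: swap12_def)

lemma R_iff: "(0, 0) \<in> R" "(Suc 0, 0) \<in> R" "(0, Suc 0) \<in> R" "(0, 2) \<notin> R" "(2, 0) \<notin> R" "(2, Suc 0) \<notin> R"
  using R by simp_all

abbreviation low :: "nat \<Rightarrow> nat list \<Rightarrow> nat \<Rightarrow> bool" where
  "low i xs x \<equiv> \<forall>l<i. x \<le> xs ! l"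

abbreviation high :: "nat \<Rightarrow> nat list \<Rightarrow> nat \<Rightarrow> bool" where
  "high i xs x \<equiv> \<forall>l<i. xs ! l < x"

lemma news_R:
  assumes "xs \<in> perms n" "i < n" "xs ! i = 1"
  shows "news R xs x = (if 1 < x \<and> low i xs x \<and> ((1, 1) \<in> R \<longrightarrow> (\<forall>l<n. i < l \<longrightarrow> x \<le> xs ! l)) \<and>
    ((1, 2) \<in> R \<longrightarrow> (\<forall>l<n. i < l \<longrightarrow> xs ! l < x)) then {i} else {})"
  unfolding news_argmin[OF assms R(1,2)]
  by (rule if_cong) (auto simp: R_iff not_less[symmetric])

lemma news_S:
  assumes "xs \<in> perms n" "i < n" "xs ! i = 1"
  shows "news S xs x = (if 1 < x \<and> high i xs x \<and> ((1, 1) \<in> R \<longrightarrow> (\<forall>l<n. i < l \<longrightarrow> xs ! l < x)) \<and>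
    ((1, 2) \<in> R \<longrightarrow> (\<forall>l<n. i < l \<longrightarrow> x \<le> xs ! l)) then {i} else {})"
  unfolding news_argmin[OF assms, of S, unfolded One_nat_def, OF S_iff(1,2)]
  by (rule if_cong) (auto simp: S_iff not_less[symmetric])

text \<open>The bijection \<open>\<theta>\<close> between slots respects the slots that destroy a given occurrence, and it reverses the
  order of those that can create one: above the minimum and, for \<open>R\<close>, below all entries left of it,
  for \<open>S\<close>, above all of them.\<close>

definition Sim :: "nat list \<Rightarrow> nat list \<Rightarrow> bool" where
  "Sim xs xs' \<longleftrightarrow> occs R xs = occs S xs' \<and> length xs' = length xs \<and>
    (\<exists>\<theta> i. bij_betw \<theta> {1..Suc (length xs)} {1..Suc (length xs)} \<and> \<theta> 1 = 1 \<and>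
      i < length xs \<and> xs ! i = 1 \<and> xs' ! i = 1 \<and>
      (\<forall>a j. (a, j) \<in> occs R xs \<longrightarrow> (\<forall>y\<in>{1..Suc (length xs)}.
        xs ! j < y \<longleftrightarrow> xs' ! a < \<theta> y \<and> \<theta> y \<le> xs' ! j)) \<and>
      (\<forall>y\<in>{2..Suc (length xs)}. low i xs y \<longleftrightarrow> high i xs' (\<theta> y)) \<and>
      (\<forall>y\<in>{2..Suc (length xs)}. low i xs y \<longrightarrow>
        (\<forall>z\<in>{2..Suc (length xs)}. y < z \<longleftrightarrow> \<theta> z < \<theta> y) \<and>
        (\<forall>l<length xs. i < l \<longrightarrow> (y \<le> xs ! l \<longleftrightarrow> xs' ! l < \<theta> y))))"

text \<open>The matching of the parents also decides which children are paired. As long as the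
  minimum stays, the matching of the children is its refinement by \<open>split_slots\<close>. A new
  minimum makes the order conditions refer to other slots, so a new matching is built that inherits
  only the conditions on destroying slots.\<close>

lemma Sim_step:
  assumes n: "0 < n" and xs: "xs \<in> perms n" and xs': "xs' \<in> perms n" and sim: "Sim xs xs'"
  shows "\<exists>\<theta>. bij_betw \<theta> {1..Suc n} {1..Suc n} \<and> (\<forall>x\<in>{1..Suc n}. Sim (child x xs) (child (\<theta> x) xs'))"
proof -
  note p = perms_D[OF xs] and p' = perms_D[OF xs']
  let ?N = "Suc n"
  obtain \<theta> i where \<theta>: "bij_betw \<theta> {1..?N} {1..?N}" and \<theta>1: "\<theta> 1 = 1"
    and i: "i < n" "xs ! i = 1" "xs' ! i = 1"
    and K: "\<And>a j y. (a, j) \<in> occs R xs \<Longrightarrow> 1 \<le> y \<Longrightarrow> y \<le> ?N \<Longrightarrow> xs ! j < y \<longleftrightarrow> xs' ! a < \<theta> y \<and> \<theta> y \<le> xs' ! j"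
    and C: "\<And>y. 2 \<le> y \<Longrightarrow> y \<le> ?N \<Longrightarrow> low i xs y \<longleftrightarrow> high i xs' (\<theta> y)"
    and O: "\<And>y z. 2 \<le> y \<Longrightarrow> y \<le> ?N \<Longrightarrow> low i xs y \<Longrightarrow> 2 \<le> z \<Longrightarrow> z \<le> ?N \<Longrightarrow> y < z \<longleftrightarrow> \<theta> z < \<theta> y"
    and B: "\<And>y l. 2 \<le> y \<Longrightarrow> y \<le> ?N \<Longrightarrow> low i xs y \<Longrightarrow> l < n \<Longrightarrow> i < l \<Longrightarrow> y \<le> xs ! l \<longleftrightarrow> xs' ! l < \<theta> y"
    using sim p(3) unfolding Sim_def by auto
  have M: "occs R xs = occs S xs'" using sim by (simp add: Sim_def)
  have mem: "1 \<le> \<theta> y \<and> \<theta> y \<le> ?N" if "1 \<le> y" "y \<le> ?N" for y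
    using bij_betwE[OF \<theta>] that by auto
  have inj: "y = z" if "\<theta> y = \<theta> z" "1 \<le> y" "y \<le> ?N" "1 \<le> z" "z \<le> ?N" for y z
    using inj_onD[OF bij_betw_imp_inj_on[OF \<theta>] that(1)] that by auto
  have two: "2 \<le> \<theta> y" if "2 \<le> y" "y \<le> ?N" for y
    using mem[of y] inj[of y 1] \<theta>1 that by (cases "\<theta> y = 1") auto
  have news: "news R xs x = news S xs' (\<theta> x)" if x: "x \<in> {1..?N}" for x
  proof (cases "x = 1")
    case True
    then show ?thesis using \<theta>1 by (simp add: news_R[OF xs i(1,2)] news_S[OF xs' i(1,3)])
  next
    case False
    then have x2: "2 \<le> x" "x \<le> ?N" using x by auto
    show ?thesis
    proof (cases "low i xs x")
      case low: True
      have B': "xs ! l < x \<longleftrightarrow> \<theta> x \<le> xs' ! l" "x \<le> xs ! l \<longleftrightarrow> xs' ! l < \<theta> x" if "l < n" "i < l" for l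
        using B[OF x2 low that] by auto
      show ?thesis
        unfolding news_R[OF xs i(1,2)] news_S[OF xs' i(1,3)]
        by (rule if_cong) (use B' C[OF x2] low x2 two[OF x2] in auto)
    next
      case False
      then show ?thesis using C[OF x2]
        unfolding news_R[OF xs i(1,2)] news_S[OF xs' i(1,3)] by simp
    qed
  qed
  have occ: "occs R (child x xs) = occs S (child (\<theta> x) xs')" if x: "x \<in> {1..?N}" for x
  proof -
    have "(2, if x \<le> xs ! a then 0 else if x \<le> xs ! j then 1 else 2) \<notin> R \<longleftrightarrow>
        (2, if \<theta> x \<le> xs' ! a then 0 else if \<theta> x \<le> xs' ! j then 1 else 2) \<notin> S"
      if aj: "(a, j) \<in> occs R xs" for a j
    proof -
      have "(a, j) \<in> occs S xs'" using aj M by simp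
      with aj have "xs ! a < xs ! j" "xs' ! a < xs' ! j" by (simp_all add: occs_def)
      moreover have "xs ! j < x \<longleftrightarrow> xs' ! a < \<theta> x \<and> \<theta> x \<le> xs' ! j" using K[OF aj] x by simp
      ultimately show ?thesis using R_iff(5,6) S_iff(5,6,9)
        by (cases "x \<le> xs ! a"; cases "x \<le> xs ! j"; cases "\<theta> x \<le> xs' ! a"; cases "\<theta> x \<le> xs' ! j") simp_all
    qed
    then have "{(a, j) \<in> occs R xs. (2, if x \<le> xs ! a then 0 else if x \<le> xs ! j then 1 else 2) \<notin> R} =
        {(a, j) \<in> occs S xs'. (2, if \<theta> x \<le> xs' ! a then 0 else if \<theta> x \<le> xs' ! j then 1 else 2) \<notin> S}"
      unfolding M[symmetric] by (intro Collect_cong) (simp add: case_prod_unfold cong: conj_cong)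
    then show ?thesis unfolding occs_child news[OF x] p(3) p'(3) by simp
  qed
  have "Sim (child x xs) (child (\<theta> x) xs')" if x: "x \<in> {1..?N}" for x
  proof -
    define x' where "x' = \<theta> x"
    define ys ys' where "ys = child x xs" and "ys' = child x' xs'"
    have x': "x' \<in> {1..?N}" using mem x by (auto simp: x'_def)
    have len: "length ys = ?N" "length ys' = ?N" by (simp_all add: ys_def ys'_def p(3) p'(3))
    have nth: "ys ! l = lift x (xs ! l)" "ys' ! l = lift x' (xs' ! l)" if "l < n" for l
      using that by (simp_all add: ys_def ys'_def child_nth p(3) p'(3))
    have nthn: "ys ! n = x" "ys' ! n = x'"
      by (simp_all add: ys_def ys'_def child_nth p(3) p'(3))
    have oc: "occs R ys = occs S ys'" using occ[OF x] by (simp add: ys_def ys'_def x'_def)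
    have ocD: "(a, j) \<in> occs R xs \<and> j < n \<or> j = n \<and> a \<in> news R xs x"
      if "(a, j) \<in> occs R ys" for a j
      using that unfolding ys_def occs_child by (auto simp: p(3) occs_def)
    define t where "t = split_slots x x' \<theta>"
    have t: "bij_betw t {1..Suc ?N} {1..Suc ?N}" unfolding t_def x'_def by (rule bij_betw_split_slots[OF \<theta> x])
    have un: "unlift x' (t y) = \<theta> (unlift x y)" if "1 \<le> y" "y \<le> Suc ?N" for y
      unfolding t_def x'_def by (rule unlift_split_slots[OF \<theta> x that])
    have uy: "1 \<le> unlift x y \<and> unlift x y \<le> ?N" if "1 \<le> y" "y \<le> Suc ?N" for y
      using that x by (auto simp: unlift_def)
    have tx: "t x = Suc x'" "t (Suc x) = x'" by (simp_all add: t_def split_slots_def)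
    have "Sim ys ys'"
    proof (cases "x = 1")
      case False
      then have x2: "2 \<le> x" "x \<le> ?N" using x by auto
      have x'2: "2 \<le> x'" using two[OF x2] by (simp add: x'_def)
      have uy2: "2 \<le> unlift x y \<and> unlift x y \<le> ?N" if "2 \<le> y" "y \<le> Suc ?N" for y
        using that x2 by (auto simp: unlift_def)
      have low_iff: "low i ys y \<longleftrightarrow> low i xs (unlift x y)" and high_iff: "high i ys' y \<longleftrightarrow> high i xs' (unlift x' y)" for y
        using i(1) by (simp_all add: nth le_lift_unlift lift_less_unlift)
      have tcmp: "x \<le> y \<Longrightarrow> y \<noteq> x \<Longrightarrow> y \<noteq> Suc x \<Longrightarrow> x < unlift x y"
        "y \<le> x \<Longrightarrow> y \<noteq> x \<Longrightarrow> unlift x y < x" for y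
        by (auto simp: unlift_def)
      have t_gt: "x' < t y \<longleftrightarrow> x' < \<theta> (unlift x y)" "t y < x' \<longleftrightarrow> \<theta> (unlift x y) < x'"
        if "1 \<le> y" "y \<le> Suc ?N" "y \<noteq> x" "y \<noteq> Suc x" for y
      proof -
        have "unlift x y \<noteq> x" using that by (auto simp: unlift_def split: if_splits)
        then have "\<theta> (unlift x y) \<noteq> x'" using inj[of "unlift x y" x] uy[OF that(1,2)] x by (auto simp: x'_def)
        then show "x' < t y \<longleftrightarrow> x' < \<theta> (unlift x y)" "t y < x' \<longleftrightarrow> \<theta> (unlift x y) < x'"
          using that by (auto simp: t_def split_slots_def lift_def)
      qed
      \<comment> \<open>The new entry meets the slots of the child in reversed order too: for other
        slots by the old reversal at \<open>x\<close>, for the two halves of \<open>x\<close> by the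
        crossing.\<close>
      have new_slot: "y \<le> x \<longleftrightarrow> x' < t y" if y: "2 \<le> y" "y \<le> Suc ?N" and lw: "low i xs (unlift x y)" for y
      proof (cases "y = x \<or> y = Suc x")
        case True
        then show ?thesis using tx by auto
      next
        case False
        have "unlift x y < x \<longleftrightarrow> x' < \<theta> (unlift x y)"
          using O[of "unlift x y" x] uy2[OF y] x2 lw by (simp add: x'_def)
        moreover have "y \<le> x \<longleftrightarrow> unlift x y < x" using False by (auto simp: unlift_def)
        ultimately show ?thesis using t_gt(1)[of y] y False by simp
      qed
      have t1: "t 1 = 1" using False x2 x'2 \<theta>1 by (auto simp: t_def split_slots_def unlift_def lift_def)
      show ?thesis
        unfolding Sim_def len
      proof (intro conjI exI[of _ t] exI[of _ i] oc refl t t1 allI impI ballI)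
        show "i < ?N" using i by simp
        show "ys ! i = 1" "ys' ! i = 1" using i x2 x'2 by (auto simp: nth lift_def)
        fix a j y assume aj: "(a, j) \<in> occs R ys" and y: "y \<in> {1..Suc ?N}"
        show "ys ! j < y \<longleftrightarrow> ys' ! a < t y \<and> t y \<le> ys' ! j"
        proof (cases "j = n")
          case False
          then have aj': "(a, j) \<in> occs R xs" "j < n" using ocD[OF aj] by auto
          then have "a < n" by (auto simp: occs_def)
          then show ?thesis using aj' K[OF aj'(1), of "unlift x y"] uy[of y] un[of y] y
            by (simp add: nth lift_less_unlift le_lift_unlift)
        next
          case True
          then have nw: "a \<in> news R xs x" using ocD[OF aj] by auto
          then have a: "a = i" and lw: "low i xs x"
            unfolding news_R[OF xs i(1,2)] by (auto split: if_splits)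
          \<comment> \<open>The new occurrence starts at the minimum, so of the two bounds on
            \<open>t y\<close> the lower one excludes slot 1 only.\<close>
          have ys'a: "ys' ! a = 1" using i x'2 by (simp add: a nth lift_def)
          show ?thesis
          proof (cases "y = 1")
            case True
            then show ?thesis using t1 x2 \<open>j = n\<close> ys'a by (simp add: nthn)
          next
            case False
            then have y2: "2 \<le> y" "y \<le> Suc ?N" using y by auto
            have ty: "2 \<le> t y" using bij_betwE[OF t] y inj_onD[OF bij_betw_imp_inj_on[OF t], of y 1] t1 False by force
            have "x < y \<longleftrightarrow> t y \<le> x'"
            proof (cases "y = x \<or> y = Suc x")
              case True
              then show ?thesis using tx by auto
            next
              case False
              have "x < unlift x y \<longleftrightarrow> \<theta> (unlift x y) < x'"
                using O[OF x2 lw, of "unlift x y"] uy2[OF y2] by (simp add: x'_def)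
              moreover have "x < y \<longleftrightarrow> x < unlift x y" using False by (auto simp: unlift_def)
              moreover have "t y \<noteq> x'" using inj_onD[OF bij_betw_imp_inj_on[OF t], of y "Suc x"] tx(2) False y x by auto
              ultimately show ?thesis using t_gt(2)[of y] y2 False by auto
            qed
            then show ?thesis using \<open>j = n\<close> ys'a ty by (simp add: nthn)
          qed
        qed
      next
        fix y assume y: "y \<in> {2..Suc ?N}"
        then show "low i ys y \<longleftrightarrow> high i ys' (t y)"
          unfolding low_iff high_iff using C[of "unlift x y"] uy2[of y] un[of y] by simp
        assume "low i ys y"
        then have lw: "low i xs (unlift x y)" unfolding low_iff .
        {
          fix z assume z: "z \<in> {2..Suc ?N}"
          show "y < z \<longleftrightarrow> t z < t y"
          proof (cases "unlift x y = unlift x z")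
            case True
            then have "y = z \<or> y = x \<and> z = Suc x \<or> y = Suc x \<and> z = x"
              by (auto simp: unlift_def split: if_splits)
            then show ?thesis using tx by auto
          next
            case False
            have "unlift x y < unlift x z \<longleftrightarrow> \<theta> (unlift x z) < \<theta> (unlift x y)"
              using O[of "unlift x y" "unlift x z"] uy2 y z lw by auto
            moreover have "y < z \<longleftrightarrow> unlift x y < unlift x z" using False by (auto simp: unlift_def split: if_splits)
            moreover have "unlift x' (t z) \<noteq> unlift x' (t y)" using un y z inj[of "unlift x y" "unlift x z"] uy False by auto
            then have "t z < t y \<longleftrightarrow> unlift x' (t z) < unlift x' (t y)" by (auto simp: unlift_def split: if_splits)
            ultimately show ?thesis using un y z by auto
          qed
        }
        fix l assume l: "l < ?N" "i < l"
        show "y \<le> ys ! l \<longleftrightarrow> ys' ! l < t y"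
        proof (cases "l = n")
          case True
          then show ?thesis using new_slot[OF _ _ lw] y by (simp add: nthn)
        next
          case False
          then show ?thesis using l B[OF _ _ lw, of l] uy2[of y] un[of y] y
            by (simp add: nth le_lift_unlift lift_less_unlift)
        qed
      qed
    next
      \<comment> \<open>Now every old entry is left of the minimum. Hence slot 2 is the only
        candidate for creating on the side of \<open>R\<close>, and the top slot on the side of
        \<open>S\<close>.\<close>
      case x1: True
      then have x'1: "x' = 1" using \<theta>1 by (simp add: x'_def)
      have nth1: "ys ! l = Suc (xs ! l)" "ys' ! l = Suc (xs' ! l)" if "l < n" for l
        using that p(4)[OF that] p'(4)[OF that] by (simp_all add: nth x1 x'1 lift_def)
      \<comment> \<open>Slot 2 must go to the top. The slot whose shifted partner was the top
        receives slot 2 in exchange. This is compatible with destruction, because neither slot 2 nor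
        the top slot lies between the values of an old occurrence on the side of
        \<open>S\<close>.\<close>
      define u where "u y = (if y = 1 then 1 else if y = 2 then Suc ?N
        else if \<theta> (y - 1) = ?N then 2 else Suc (\<theta> (y - 1)))" for y
      have u: "bij_betw u {1..Suc ?N} {1..Suc ?N}"
      proof (rule bij_betw_inj_intervalI)
        fix y assume y: "1 \<le> y" "y \<le> Suc ?N"
        then show "1 \<le> u y \<and> u y \<le> Suc ?N"
          using mem[of "y - 1"] by (auto simp: u_def)
        fix z assume z: "1 \<le> z" "z \<le> Suc ?N" "u y = u z"
        have c: "u w = 1 \<and> w = 1 \<or> u w = Suc ?N \<and> w = 2 \<or>
            3 \<le> w \<and> (\<theta> (w - 1) = ?N \<and> u w = 2 \<or> \<theta> (w - 1) < ?N \<and> u w = Suc (\<theta> (w - 1)) \<and> 3 \<le> u w)"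
          if "1 \<le> w" "w \<le> Suc ?N" for w
        proof -
          have "3 \<le> w" if "w \<noteq> 1" "w \<noteq> 2" using that \<open>1 \<le> w\<close> by simp
          moreover have "2 \<le> \<theta> (w - 1) \<and> \<theta> (w - 1) \<le> ?N" if "3 \<le> w"
            using two[of "w - 1"] mem[of "w - 1"] that \<open>w \<le> Suc ?N\<close> by auto
          ultimately show ?thesis unfolding u_def by auto
        qed
        have "y = z" if "3 \<le> y" "3 \<le> z" "\<theta> (y - 1) = \<theta> (z - 1)"
        proof -
          have "y - 1 = z - 1" by (rule inj[OF that(3)]) (use that y z in auto)
          with that show ?thesis by simp
        qed
        then show "y = z" using c[OF y] c[OF z(1,2)] z(3) n by auto
      qed
      show ?thesis
        unfolding Sim_def len
      proof (intro conjI exI[of _ u] exI[of _ n] oc refl u allI impI ballI)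
        show "u 1 = 1" "n < ?N" "ys ! n = 1" "ys' ! n = 1" by (simp_all add: u_def nthn x1 x'1)
        fix a j y assume aj: "(a, j) \<in> occs R ys" and y: "y \<in> {1..Suc ?N}"
        have aj': "(a, j) \<in> occs R xs" "j < n"
          using ocD[OF aj] unfolding news_R[OF xs i(1,2)] x1 by auto
        then have an: "a < n" by (auto simp: occs_def)
        consider "y = 1" | "y = 2" | "3 \<le> y" using y by fastforce
        then show "ys ! j < y \<longleftrightarrow> ys' ! a < u y \<and> u y \<le> ys' ! j"
        proof cases
          case 1
          then show ?thesis using aj'(2) an by (simp add: nth1 u_def)
        next
          case 2
          then show ?thesis using aj'(2) an p(4)[of j] p'(4)[of j] by (simp add: nth1 u_def)
        next
          case 3
          then obtain w where w: "y = Suc w" "2 \<le> w" "w \<le> ?N" using y by (cases y) auto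
          then show ?thesis using K[OF aj'(1), of w] aj'(2) an p'(4)[of a] p'(4)[of j]
            by (auto simp: nth1 u_def)
        qed
      next
        have low2: "low n ys y \<longleftrightarrow> y = 2" if "y \<in> {2..Suc ?N}" for y
        proof
          assume "low n ys y"
          then have "y \<le> ys ! i" using i by blast
          then show "y = 2" using that i by (simp add: nth1)
        qed (use p(4) in \<open>auto simp: nth1 Suc_le_eq\<close>)
        obtain m where m: "m < n" "xs' ! m = n" using perms_ex[OF xs', of n] n by auto
        have high2: "high n ys' (u y) \<longleftrightarrow> y = 2" if "y \<in> {2..Suc ?N}" for y
        proof
          assume "high n ys' (u y)"
          then have "Suc n < u y" using m nth1(2)[OF m(1)] by auto
          moreover have "1 \<le> y - 1" "y - 1 \<le> ?N" using that by auto
          then have "\<theta> (y - 1) \<le> ?N" using mem[of "y - 1"] by blast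
          ultimately show "y = 2" using that n by (auto simp: u_def split: if_splits)
        qed (use p'(4) in \<open>auto simp: nth1 u_def less_Suc_eq_le\<close>)
        fix y assume y: "y \<in> {2..Suc ?N}"
        show "low n ys y \<longleftrightarrow> high n ys' (u y)" using low2[OF y] high2[OF y] by simp
        assume "low n ys y"
        then have y2: "y = 2" using low2[OF y] by simp
        fix z assume z: "z \<in> {2..Suc ?N}"
        show "y < z \<longleftrightarrow> u z < u y"
        proof (cases "z = 2")
          case False
          have u2: "u 2 = Suc ?N" by (simp add: u_def)
          have "u z \<noteq> u 2" using inj_onD[OF bij_betw_imp_inj_on[OF u], of z 2] z False by force
          moreover have "u z \<le> Suc ?N" using bij_betwE[OF u] z by force
          ultimately have "u z < u y" using u2 y2 by simp
          then show ?thesis using z False y2 by simp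
        qed (simp add: y2)
      qed simp
    qed
    then show ?thesis by (simp add: ys_def ys'_def x'_def)
  qed
  then show ?thesis using \<theta> by blast
qed

lemma Sim_1: "Sim [Suc 0] [Suc 0]"
proof -
  have occ: "occs R [Suc 0] = {}" "occs S [Suc 0] = {}" by (rule occs_singleton)+
  show ?thesis
    unfolding Sim_def occ by (rule conjI, simp, rule conjI, simp, rule exI[of _ id], rule exI[of _ 0]) simp
qed

lemma equid: "equid R S"
proof (rule equid_by_tree[of Sim])
  show "Sim [Suc 0] [Suc 0]" by (rule Sim_1)
  show "card (occs S xs') = card (occs R xs)" if "Sim xs xs'" for xs xs'
    using that by (simp add: Sim_def)
qed (rule Sim_step)

end

section \<open>Patterns with a single creating slot\<close>

lemma ex_less_perms:
  assumes "xs \<in> perms n" "1 \<le> x" "x \<le> Suc n"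
  shows "(\<forall>l<n. xs ! l < x) \<longleftrightarrow> x = Suc n"
proof
  assume a: "\<forall>l<n. xs ! l < x"
  show "x = Suc n"
  proof (rule ccontr)
    assume "x \<noteq> Suc n"
    then obtain l where "l < n" "xs ! l = x" using perms_ex[OF assms(1), of x] assms by auto
    with a show False by blast
  qed
qed (use perms_D(4)[OF assms(1)] in \<open>auto simp: less_Suc_eq_le\<close>)

lemma news_iff:
  assumes "length xs = n"
  shows "k \<in> news T xs x \<longleftrightarrow> k < n \<and> xs ! k < x \<and>
    (\<forall>l<k. (xs ! l < xs ! k \<longrightarrow> (0, 0) \<notin> T) \<and> (xs ! k \<le> xs ! l \<and> xs ! l < x \<longrightarrow> (0, 1) \<notin> T) \<and>
      (xs ! k \<le> xs ! l \<and> x \<le> xs ! l \<longrightarrow> (0, 2) \<notin> T)) \<and>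
    (\<forall>l<n. k < l \<longrightarrow> (xs ! l < xs ! k \<longrightarrow> (1, 0) \<notin> T) \<and> (xs ! k \<le> xs ! l \<and> xs ! l < x \<longrightarrow> (1, 1) \<notin> T) \<and>
      (xs ! k \<le> xs ! l \<and> x \<le> xs ! l \<longrightarrow> (1, 2) \<notin> T))" (is "?L \<longleftrightarrow> ?R")
proof
  let ?r = "\<lambda>l. if xs ! l < xs ! k then 0 else if xs ! l < x then 1 else 2 :: nat"
  assume L: ?L
  then have k: "k < n" "xs ! k < x" "\<And>l. l < n \<Longrightarrow> l < k \<Longrightarrow> (0, ?r l) \<notin> T"
    "\<And>l. l < n \<Longrightarrow> k < l \<Longrightarrow> (1, ?r l) \<notin> T"
  proof -
    have all: "\<forall>l<n. l \<noteq> k \<longrightarrow> (if l < k then 0 else 1, ?r l) \<notin> T" using L assms by (simp add: news_def)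
    show "k < n" "xs ! k < x" using L assms by (simp_all add: news_def)
    show "(0, ?r l) \<notin> T" if "l < n" "l < k" for l using all[rule_format, of l] that by simp
    show "(1, ?r l) \<notin> T" if "l < n" "k < l" for l using all[rule_format, of l] that by simp
  qed
  show ?R
  proof (intro conjI allI impI)
    fix l assume l: "l < k"
    show "(0, 0) \<notin> T" if "xs ! l < xs ! k" using k(3)[of l] k(1) l that by simp
    show "(0, 1) \<notin> T" if "xs ! k \<le> xs ! l \<and> xs ! l < x" using k(3)[of l] k(1) l that by simp
    show "(0, 2) \<notin> T" if "xs ! k \<le> xs ! l \<and> x \<le> xs ! l" using k(3)[of l] k(1) l that by simp
  next
    fix l assume l: "l < n" "k < l"
    show "(1, 0) \<notin> T" if "xs ! l < xs ! k" using k(4)[OF l] that by simp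
    show "(1, 1) \<notin> T" if "xs ! k \<le> xs ! l \<and> xs ! l < x" using k(4)[OF l] that by simp
    show "(1, 2) \<notin> T" if "xs ! k \<le> xs ! l \<and> x \<le> xs ! l" using k(4)[OF l] that by simp
  qed (use k in auto)
next
  assume R: ?R
  show ?L
    unfolding news_def mem_Collect_eq assms
  proof (intro conjI allI impI)
    fix l assume l: "l < n" "l \<noteq> k"
    show "(if l < k then 0 else 1, if xs ! l < xs ! k then 0 else if xs ! l < x then 1 else 2) \<notin> T"
    proof (cases "l < k")
      case True
      then show ?thesis using R by (simp add: not_less[symmetric])
    next
      case False
      then have "k < l" using l by simp
      then show ?thesis using R l False by (simp add: not_less[symmetric])
    qed
  qed (use R in auto)
qed

text \<open>Column 0 forces the first position, and (1,2) then leaves no old value above the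
  slot.\<close>

lemma news_first:
  assumes "xs \<in> perms n" "0 < n" "1 \<le> x" "x \<le> Suc n"
    and T: "(0, 0) \<in> T" "(0, 1) \<in> T" "(0, 2) \<in> T" "(1, 0) \<notin> T" "(1, 1) \<notin> T" "(1, 2) \<in> T"
  shows "news T xs x = (if x = Suc n then {0} else {})"
proof -
  note p = perms_D[OF assms(1)]
  have iff: "k \<in> news T xs x \<longleftrightarrow> k < n \<and> xs ! k < x \<and> (\<forall>l<k. False) \<and>
      (\<forall>l<n. k < l \<longrightarrow> xs ! l < xs ! k \<or> xs ! l < x)" for k
    unfolding news_iff[OF p(3)] using T by (simp add: not_less[symmetric]) (meson not_less)
  have "k \<in> news T xs x \<longleftrightarrow> k = 0 \<and> (\<forall>l<n. xs ! l < x)" for k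
  proof
    assume "k \<in> news T xs x"
    then have k: "k = 0" "xs ! 0 < x" "\<forall>l<n. 0 < l \<longrightarrow> xs ! l < xs ! 0 \<or> xs ! l < x"
      unfolding iff by (cases k; auto)+
    have "xs ! l < x" if "l < n" for l
      using k(2) k(3)[rule_format, of l] that by (cases "l = 0") auto
    with k(1) show "k = 0 \<and> (\<forall>l<n. xs ! l < x)" by blast
  qed (use assms(2) in \<open>simp add: iff\<close>)
  then have "k \<in> news T xs x \<longleftrightarrow> k = 0 \<and> x = Suc n" for k
    unfolding ex_less_perms[OF assms(1,3,4)] .
  then show ?thesis by (intro set_eqI) simp
qed

text \<open>Row 0 forces the minimum, as in \<open>news_argmin\<close>; (0,2) and (1,2) leave
  nothing above the slot.\<close>

lemma news_argmin_top:
  assumes "xs \<in> perms n" "1 \<le> x" "x \<le> Suc n" "i < n" "xs ! i = 1"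
    and T: "(0, 0) \<in> T" "(0, 1) \<notin> T" "(0, 2) \<in> T" "(1, 0) \<in> T" "(1, 1) \<notin> T" "(1, 2) \<in> T"
  shows "news T xs x = (if x = Suc n then {i} else {})"
proof -
  have "1 < x \<and> (\<forall>l<i. (0, if xs ! l < x then 1 else 2) \<notin> T) \<and>
      (\<forall>l<n. i < l \<longrightarrow> (1, if xs ! l < x then 1 else 2) \<notin> T) \<longleftrightarrow>
      xs ! i < x \<and> (\<forall>l<i. xs ! l < x) \<and> (\<forall>l<n. i < l \<longrightarrow> xs ! l < x)"
    using T assms(5) by simp blast
  also have "\<dots> \<longleftrightarrow> (\<forall>l<n. xs ! l < x)" using assms(4) by (metis less_trans linorder_neqE_nat)
  finally show ?thesis
    unfolding news_argmin[OF assms(1,4,5) T(1,4)] ex_less_perms[OF assms(1-3)] by simp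
qed

text \<open>Rows 1 and 2 are empty on both sides of the first entry, so it exceeds all others, and a
  slot above the maximum is the top one.\<close>

lemma news_argmax_top:
  assumes "xs \<in> perms n" "1 \<le> x" "x \<le> Suc n" "i < n" "xs ! i = n"
    and T: "(0, 0) \<notin> T" "(0, 1) \<in> T" "(0, 2) \<in> T" "(1, 0) \<notin> T" "(1, 1) \<in> T" "(1, 2) \<in> T"
  shows "news T xs x = (if x = Suc n then {i} else {})"
proof -
  note p = perms_D[OF assms(1)]
  have iff: "k \<in> news T xs x \<longleftrightarrow> k < n \<and> xs ! k < x \<and> (\<forall>l<k. xs ! l < xs ! k) \<and> (\<forall>l<n. k < l \<longrightarrow> xs ! l < xs ! k)" for k
    unfolding news_iff[OF p(3)] using T by (simp add: not_less[symmetric]) (meson not_less)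
  have "k = i \<and> x = Suc n" if "k \<in> news T xs x" for k
  proof -
    have k: "k < n" "xs ! k < x" "\<And>l. l < n \<Longrightarrow> l \<noteq> k \<Longrightarrow> xs ! l < xs ! k"
      using that unfolding iff by (auto elim: linorder_neqE_nat)
    have "k = i" using k(3)[of i] k(1) p(4)[OF k(1)] assms(4,5) by fastforce
    then show ?thesis using k(2) assms(3,5) by simp
  qed
  moreover have "i \<in> news T xs x" if "x = Suc n"
  proof -
    have "xs ! l < xs ! i" if "l < n" "l \<noteq> i" for l
      using p(4)[OF that(1)] p(5)[OF that(1) assms(4)] that(2) assms(5) by simp
    then show ?thesis using that assms(4,5) unfolding iff by simp
  qed
  ultimately have "k \<in> news T xs x \<longleftrightarrow> k = i \<and> x = Suc n" for k by blast
  then show ?thesis by (intro set_eqI) simp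
qed

lemma eq_last_iff:
  "0 < n \<Longrightarrow> k < n \<and> (\<forall>l<n. k < l \<longrightarrow> False) \<longleftrightarrow> k = n - (1 :: nat)"
proof (rule iffI)
  assume a: "k < n \<and> (\<forall>l<n. k < l \<longrightarrow> False)" and "0 < n"
  then have "\<not> k < n - 1" by (metis diff_less zero_less_one)
  with a show "k = n - 1" by linarith
qed auto

text \<open>A full column 1 makes the first entry adjacent to the new one, and (0,2) leaves nothing
  above the slot.\<close>

lemma news_last_top:
  assumes "xs \<in> perms n" "1 \<le> x" "x \<le> Suc n" "0 < n"
    and T: "(0, 0) \<notin> T" "(0, 1) \<notin> T" "(0, 2) \<in> T" "(1, 0) \<in> T" "(1, 1) \<in> T" "(1, 2) \<in> T"
  shows "news T xs x = (if x = Suc n then {n - 1} else {})"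
proof -
  note p = perms_D[OF assms(1)]
  have "k \<in> news T xs x \<longleftrightarrow> (k < n \<and> (\<forall>l<n. k < l \<longrightarrow> False)) \<and> xs ! k < x \<and> (\<forall>l<k. xs ! l < xs ! k \<or> xs ! l < x)" for k
    unfolding news_iff[OF p(3)] using T by (simp add: not_less[symmetric]) (meson not_less)
  also have "(k < n \<and> (\<forall>l<n. k < l \<longrightarrow> False)) \<and> xs ! k < x \<and> (\<forall>l<k. xs ! l < xs ! k \<or> xs ! l < x) \<longleftrightarrow>
      k = n - 1 \<and> xs ! (n - 1) < x \<and> (\<forall>l<n - 1. xs ! l < x)" for k
    unfolding eq_last_iff[OF assms(4)] by (metis less_trans)
  also have "k = n - 1 \<and> xs ! (n - 1) < x \<and> (\<forall>l<n - 1. xs ! l < x) \<longleftrightarrow> k = n - 1 \<and> (\<forall>l<n. xs ! l < x)" for k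
    using assms(4) by (cases n) (auto simp: less_Suc_eq)
  finally have iff: "k \<in> news T xs x \<longleftrightarrow> k = n - 1 \<and> x = Suc n" for k
    unfolding ex_less_perms[OF assms(1-3)] .
  show ?thesis by (rule set_eqI) (simp add: iff)
qed

text \<open>Again the first entry is the last old one. Now (0,1) forbids values between it and the
  new entry, which therefore sits immediately above it.\<close>

lemma news_last_succ:
  assumes "xs \<in> perms n" "1 \<le> x" "x \<le> Suc n" "0 < n"
    and T: "(0, 0) \<notin> T" "(0, 1) \<in> T" "(0, 2) \<notin> T" "(1, 0) \<in> T" "(1, 1) \<in> T" "(1, 2) \<in> T"
  shows "news T xs x = (if x = Suc (xs ! (n - 1)) then {n - 1} else {})"
proof -
  note p = perms_D[OF assms(1)]
  have iff: "k \<in> news T xs x \<longleftrightarrow> (k < n \<and> (\<forall>l<n. k < l \<longrightarrow> False)) \<and> xs ! k < x \<and> (\<forall>l<k. xs ! l < xs ! k \<or> x \<le> xs ! l)" for k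
    unfolding news_iff[OF p(3)] using T by (simp add: not_less[symmetric]) (meson not_less)
  have "k \<in> news T xs x \<longleftrightarrow> k = n - 1 \<and> x = Suc (xs ! (n - 1))" for k
  proof
    assume a: "k \<in> news T xs x"
    then have k: "k = n - 1" unfolding iff eq_last_iff[OF assms(4)] by simp
    have lt: "xs ! k < x" and less: "\<And>l. l < k \<Longrightarrow> xs ! l < xs ! k \<or> x \<le> xs ! l" using a unfolding iff by auto
    have "x = Suc (xs ! k)"
    proof (rule ccontr)
      assume "x \<noteq> Suc (xs ! k)"
      then have x: "Suc (xs ! k) < x" using lt by simp
      then obtain l where l: "l < n" "xs ! l = Suc (xs ! k)"
        using perms_ex[OF assms(1), of "Suc (xs ! k)"] assms(3) by auto
      then have "l \<noteq> k" by auto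
      then have "l < k" using l(1) k by simp
      then show False using less[of l] l(2) x by simp
    qed
    then show "k = n - 1 \<and> x = Suc (xs ! (n - 1))" using k by simp
  next
    assume a: "k = n - 1 \<and> x = Suc (xs ! (n - 1))"
    have "xs ! l < xs ! k \<or> x \<le> xs ! l" if "l < k" for l
      using that a p(5)[of l k] assms(4) by auto
    then show "k \<in> news T xs x" unfolding iff eq_last_iff[OF assms(4)] using a by simp
  qed
  then show ?thesis by (intro set_eqI) simp
qed

section \<open>A single creating slot: Stirling numbers and birth-death chains\<close>

definition unit_slot :: "(nat \<times> nat) set \<Rightarrow> (nat list \<Rightarrow> nat) \<Rightarrow> bool" where
  "unit_slot T s \<longleftrightarrow> (\<forall>n xs. 0 < n \<longrightarrow> xs \<in> perms n \<longrightarrow> s xs \<in> {1..Suc n} \<and>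
     (\<forall>x\<in>{1..Suc n}. card (news T xs x) = (if x = s xs then 1 else 0)))"

lemma unit_slot_topI:
  assumes "\<And>n xs x. 0 < n \<Longrightarrow> xs \<in> perms n \<Longrightarrow> 1 \<le> x \<Longrightarrow> x \<le> Suc n \<Longrightarrow>
    \<exists>i. news T xs x = (if x = Suc n then {i} else {})"
  shows "unit_slot T (\<lambda>xs. Suc (length xs))"
proof -
  have "card (news T xs x) = (if x = Suc (length xs) then 1 else 0)"
    if "0 < n" "xs \<in> perms n" "x \<in> {1..Suc n}" for n xs x
  proof -
    have "\<exists>i. news T xs x = (if x = Suc n then {i} else {})" by (rule assms) (use that in auto)
    then obtain i where i: "news T xs x = (if x = Suc n then {i} else {})" ..
    show ?thesis unfolding i perms_D(3)[OF that(2)] by simp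
  qed
  then show ?thesis unfolding unit_slot_def by (simp add: perms_D(3))
qed

lemma unit_slot_first:
  assumes "(0, 0) \<in> T" "(0, 1) \<in> T" "(0, 2) \<in> T" "(1, 0) \<notin> T" "(1, 1) \<notin> T" "(1, 2) \<in> T"
  shows "unit_slot T (\<lambda>xs. Suc (length xs))"
proof (rule unit_slot_topI)
  fix n xs x assume a: "0 < n" "xs \<in> perms n" "1 \<le> x" "x \<le> Suc n"
  show "\<exists>i. news T xs x = (if x = Suc n then {i} else {})"
    by (rule exI) (rule news_first[OF a(2,1,3,4) assms])
qed

lemma unit_slot_argmin:
  assumes "(0, 0) \<in> T" "(0, 1) \<notin> T" "(0, 2) \<in> T" "(1, 0) \<in> T" "(1, 1) \<notin> T" "(1, 2) \<in> T"
  shows "unit_slot T (\<lambda>xs. Suc (length xs))"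
proof (rule unit_slot_topI)
  fix n xs x assume a: "0 < n" "xs \<in> perms n" "1 \<le> x" "x \<le> Suc n"
  obtain i where "i < n" "xs ! i = 1" using perms_ex[OF a(2), of 1] a(1) by auto
  then show "\<exists>i. news T xs x = (if x = Suc n then {i} else {})" by (intro exI) (rule news_argmin_top[OF a(2-4) _ _ assms])
qed

lemma unit_slot_argmax:
  assumes "(0, 0) \<notin> T" "(0, 1) \<in> T" "(0, 2) \<in> T" "(1, 0) \<notin> T" "(1, 1) \<in> T" "(1, 2) \<in> T"
  shows "unit_slot T (\<lambda>xs. Suc (length xs))"
proof (rule unit_slot_topI)
  fix n xs x assume a: "0 < n" "xs \<in> perms n" "1 \<le> x" "x \<le> Suc n"
  obtain i where "i < n" "xs ! i = n" using perms_ex[OF a(2), of n] a(1) by auto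
  then show "\<exists>i. news T xs x = (if x = Suc n then {i} else {})" by (intro exI) (rule news_argmax_top[OF a(2-4) _ _ assms])
qed

lemma unit_slot_last:
  assumes "(0, 0) \<notin> T" "(0, 1) \<notin> T" "(0, 2) \<in> T" "(1, 0) \<in> T" "(1, 1) \<in> T" "(1, 2) \<in> T"
  shows "unit_slot T (\<lambda>xs. Suc (length xs))"
proof (rule unit_slot_topI)
  fix n xs x assume a: "0 < n" "xs \<in> perms n" "1 \<le> x" "x \<le> Suc n"
  show "\<exists>i. news T xs x = (if x = Suc n then {i} else {})"
    by (rule exI) (rule news_last_top[OF a(2,3,4,1) assms])
qed

lemma unit_slot_succ:
  assumes "(0, 0) \<notin> T" "(0, 1) \<in> T" "(0, 2) \<notin> T" "(1, 0) \<in> T" "(1, 1) \<in> T" "(1, 2) \<in> T"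
  shows "unit_slot T (\<lambda>xs. Suc (last xs))"
proof -
  have "Suc (last xs) \<in> {1..Suc n} \<and> card (news T xs x) = (if x = Suc (last xs) then 1 else 0)"
    if a: "0 < n" "xs \<in> perms n" "x \<in> {1..Suc n}" for n xs x
  proof -
    have l: "last xs = xs ! (n - 1)" using a(1) perms_D(3)[OF a(2)] by (metis last_conv_nth length_greater_0_conv)
    have "news T xs x = (if x = Suc (xs ! (n - 1)) then {n - 1} else {})"
      by (rule news_last_succ[OF a(2) _ _ a(1) assms]) (use a(3) in auto)
    then show ?thesis using perms_D(4)[OF a(2), of "n - 1"] a(1) by (simp add: l)
  qed
  then have *: "Suc (last xs) \<in> {1..Suc n} \<and> card (news T xs x) = (if x = Suc (last xs) then 1 else 0)"
    if "0 < n" "xs \<in> perms n" "x \<in> {1..Suc n}" for n xs x using that by blast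
  show ?thesis unfolding unit_slot_def
  proof (intro allI impI conjI ballI)
    fix n xs assume a: "0 < n" "xs \<in> perms n"
    show "Suc (last xs) \<in> {1..Suc n}" using *[OF a, of 1] by simp
  qed (use * in blast)
qed

text \<open>With column 2 unshaded nothing is destroyed. Of the n + 1 slots one adds an occurrence
  and n add none, whatever the permutation. Thus the distribution for n >= 1 has generating function
  (q + 1)(q + 2)...(q + n - 1), with unsigned Stirling numbers of the first kind as coefficients.
  The coupling only has to pair the two creating slots, which a transposition does.\<close>

lemma equid_stirling:
  assumes T: "unit_slot T s" "\<And>y. (2, y) \<notin> T" and T': "unit_slot T' s'" "\<And>y. (2, y) \<notin> T'"
  shows "equid T T'"
proof (rule equid_by_tree[where Sim = "\<lambda>xs xs'. card (occs T' xs') = card (occs T xs)"])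
  fix n and xs xs' :: "nat list"
  assume n: "0 < n" and xs: "xs \<in> perms n" "xs' \<in> perms n" and eq: "card (occs T' xs') = card (occs T xs)"
  let ?\<theta> = "Transposition.transpose (s xs) (s' xs')"
  have s: "s xs \<in> {1..Suc n}" "s' xs' \<in> {1..Suc n}"
    using T(1) T'(1) n xs unfolding unit_slot_def by blast+
  have "bij_betw ?\<theta> {1..Suc n} {1..Suc n}"
    using permutes_imp_bij[OF permutes_swap_id[OF s]] .
  moreover have "card (occs T' (child (?\<theta> x) xs')) = card (occs T (child x xs))" if x: "x \<in> {1..Suc n}" for x
  proof -
    have "?\<theta> x \<in> {1..Suc n}" using x s by (auto simp: Transposition.transpose_def)
    moreover have "?\<theta> x = s' xs' \<longleftrightarrow> x = s xs" by (auto simp: Transposition.transpose_def)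
    ultimately have "card (news T' xs' (?\<theta> x)) = card (news T xs x)"
      using T(1) T'(1) n xs x unfolding unit_slot_def by metis
    then show ?thesis unfolding card_occs_child using T(2) T'(2) eq by simp
  qed
  ultimately show "\<exists>\<theta>. bij_betw \<theta> {1..Suc n} {1..Suc n} \<and>
      (\<forall>x\<in>{1..Suc n}. card (occs T' (child (\<theta> x) xs')) = card (occs T (child x xs)))" by blast
qed (simp_all add: occs_singleton)

text \<open>When row 1 is full, every occurrence occupies two consecutive values, so it is destroyed by
  exactly one slot of the next step.\<close>

lemma occs_consecutive:
  assumes "xs \<in> perms n" "(0, 1) \<in> T" "(1, 1) \<in> T" "(2, 1) \<in> T" "(i, j) \<in> occs T xs"
  shows "i < n" "j < n" "i < j" "xs ! j = Suc (xs ! i)"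
proof -
  note p = perms_D[OF assms(1)]
  show ij: "i < n" "j < n" "i < j" using assms(5) p by (auto simp: occs_def)
  show "xs ! j = Suc (xs ! i)"
  proof (rule ccontr)
    have lt: "xs ! i < xs ! j" using assms(5) by (simp add: occs_def)
    assume "xs ! j \<noteq> Suc (xs ! i)"
    then have "Suc (xs ! i) < xs ! j" using lt by simp
    then obtain l where l: "l < n" "xs ! l = Suc (xs ! i)"
      using perms_ex[OF assms(1), of "Suc (xs ! i)"] p(4)[OF ij(2)] by auto
    then have "l \<noteq> i" "l \<noteq> j" using \<open>xs ! j \<noteq> Suc (xs ! i)\<close> by auto
    then have "(mcell i j l, mcell (xs ! i) (xs ! j) (xs ! l)) \<notin> T"
      using assms(5) l(1) p(3) by (simp add: occs_def)
    moreover have "mcell (xs ! i) (xs ! j) (xs ! l) = 1"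
      using l \<open>Suc (xs ! i) < xs ! j\<close> by (simp add: mcell_def)
    moreover have "mcell i j l \<in> {0, 1, 2}" by (simp add: mcell_def)
    ultimately show False using assms(2-4) by auto
  qed
qed

text \<open>\<open>D\<close> consists of the destroying slots and \<open>s\<close> is the creating
  one. Since \<open>D\<close> has as many elements as there are occurrences, the numbers of children
  with one occurrence less, one more or equally many depend only on the length and the present
  count.\<close>

definition birth_death :: "(nat \<times> nat) set \<Rightarrow> nat list \<Rightarrow> nat set \<Rightarrow> nat \<Rightarrow> bool" where
  "birth_death T xs D s \<longleftrightarrow> D \<subseteq> {1..Suc (length xs)} \<and> card D = card (occs T xs) \<and>
     s \<in> {1..Suc (length xs)} - D \<and> (\<forall>x\<in>{1..Suc (length xs)}.
       card (occs T (child x xs)) + (if x \<in> D then 1 else 0) = card (occs T xs) + (if x = s then 1 else 0))"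

text \<open>An occurrence with values v and v + 1 is destroyed exactly by slot v + 1, its second
  value. Different occurrences have different second values, whence the size of \<open>D\<close>;
  the hypothesis on \<open>s\<close> keeps creation and destruction in different slots.\<close>

lemma birth_deathI:
  assumes "unit_slot T s" "(0, 1) \<in> T" "(1, 1) \<in> T" "(2, 0) \<notin> T" "(2, 1) \<in> T" "(2, 2) \<notin> T"
    and "\<And>n xs i j. xs \<in> perms n \<Longrightarrow> (i, j) \<in> occs T xs \<Longrightarrow> xs ! j \<noteq> s xs"
    and n: "0 < n" and xs: "xs \<in> perms n"
  shows "\<exists>D. birth_death T xs D (s xs)"
proof -
  note p = perms_D[OF xs]
  let ?D = "(\<lambda>(i, j). xs ! j) ` occs T xs"
  note c = occs_consecutive[OF xs assms(2,3,5)]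
  have inj: "inj_on (\<lambda>(i, j). xs ! j) (occs T xs)"
  proof (rule inj_onI, clarify)
    fix i j i' j' assume a: "(i, j) \<in> occs T xs" "(i', j') \<in> occs T xs" "xs ! j = xs ! j'"
    then show "i = i' \<and> j = j'" using c[OF a(1)] c[OF a(2)] p(5) by (metis Suc_inject)
  qed
  have "card (occs T (child x xs)) + (if x \<in> ?D then 1 else 0) = card (occs T xs) + (if x = s xs then 1 else 0)"
    if x: "x \<in> {1..Suc n}" for x
  proof -
    let ?A = "{(i, j) \<in> occs T xs. xs ! j \<noteq> x}"
    have "{(i, j) \<in> occs T xs. (2, if x \<le> xs ! i then 0 else if x \<le> xs ! j then 1 else 2) \<notin> T} = ?A"
      (is "?B = _")
    proof -
      have "(i, j) \<in> ?B \<longleftrightarrow> (i, j) \<in> ?A" for i j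
        using c(4)[of i j] assms(4-6) by (auto split: if_splits)
      then show ?thesis by auto
    qed
    moreover have "card (news T xs x) = (if x = s xs then 1 else 0)"
      using assms(1) n xs x unfolding unit_slot_def by blast
    moreover have "card ?A + (if x \<in> ?D then 1 else 0) = card (occs T xs)"
    proof (cases "x \<in> ?D")
      case True
      then obtain i j where ij: "(i, j) \<in> occs T xs" "xs ! j = x" by auto
      have "xs ! b \<noteq> x \<longleftrightarrow> (a, b) \<noteq> (i, j)" if "(a, b) \<in> occs T xs" for a b
        using inj_onD[OF inj, of "(a, b)" "(i, j)"] that ij by auto
      then have "?A = occs T xs - {(i, j)}" by blast
      moreover have "0 < card (occs T xs)" using ij by (auto simp: card_gt_0_iff)
      ultimately show ?thesis using True ij by (simp add: card_Diff_singleton)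
    next
      case False
      then have "?A = occs T xs" by force
      then show ?thesis using False by simp
    qed
    ultimately show ?thesis unfolding card_occs_child by simp
  qed
  moreover have "?D \<subseteq> {1..Suc n}"
    using c(2) p(4) by (fastforce simp: Suc_le_eq)
  moreover have "s xs \<in> {1..Suc n}" using assms(1) n xs unfolding unit_slot_def by blast
  moreover have "s xs \<notin> ?D" using assms(7)[OF xs] by force
  ultimately have "birth_death T xs ?D (s xs)"
    unfolding birth_death_def p(3) using card_image[OF inj] by simp
  then show ?thesis ..
qed

text \<open>The invariant is the bare number of occurrences. Destroying, creating and neutral slots
  are equally numerous on both sides and are matched kind by kind, arbitrarily within each
  kind.\<close>

lemma equid_birth_death:
  assumes "\<And>n xs. 0 < n \<Longrightarrow> xs \<in> perms n \<Longrightarrow> \<exists>D s. birth_death T xs D s"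
    and "\<And>n xs. 0 < n \<Longrightarrow> xs \<in> perms n \<Longrightarrow> \<exists>D s. birth_death T' xs D s"
  shows "equid T T'"
proof (rule equid_by_tree[where Sim = "\<lambda>xs xs'. card (occs T' xs') = card (occs T xs)"])
  fix n and xs xs' :: "nat list"
  assume n: "0 < n" and xs: "xs \<in> perms n" "xs' \<in> perms n" and eq: "card (occs T' xs') = card (occs T xs)"
  let ?U = "{1..Suc n}"
  obtain D s where "birth_death T xs D s" using assms(1)[OF n xs(1)] by blast
  then have D: "D \<subseteq> ?U" "card D = card (occs T xs)" "s \<in> ?U - D"
    "\<And>x. x \<in> ?U \<Longrightarrow> card (occs T (child x xs)) + (if x \<in> D then 1 else 0) = card (occs T xs) + (if x = s then 1 else 0)"
    unfolding birth_death_def perms_D(3)[OF xs(1)] by blast+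
  obtain D' s' where "birth_death T' xs' D' s'" using assms(2)[OF n xs(2)] by blast
  then have D': "D' \<subseteq> ?U" "card D' = card (occs T' xs')" "s' \<in> ?U - D'"
    "\<And>x. x \<in> ?U \<Longrightarrow> card (occs T' (child x xs')) + (if x \<in> D' then 1 else 0) = card (occs T' xs') + (if x = s' then 1 else 0)"
    unfolding birth_death_def perms_D(3)[OF xs(2)] by blast+
  have fin: "finite D" "finite D'" using finite_subset[OF D(1)] finite_subset[OF D'(1)] by simp_all
  have "card D = card D'" using D(2) D'(2) eq by simp
  then obtain f where f: "bij_betw f D D'" using finite_same_card_bij[OF fin] by blast
  have "card (?U - insert s D) = card (?U - insert s' D')"
    using D(1-3) D'(1-3) fin eq by (simp add: card_Diff_subset)
  then obtain g where g: "bij_betw g (?U - insert s D) (?U - insert s' D')"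
    using finite_same_card_bij[of "?U - insert s D" "?U - insert s' D'"] by blast
  define \<theta> where "\<theta> x = (if x \<in> D then f x else if x = s then s' else g x)" for x
  have 1: "bij_betw \<theta> D D'" using f by (rule iffD1[OF bij_betw_cong, rotated]) (simp add: \<theta>_def)
  have 2: "bij_betw \<theta> {s} {s'}" using D(3) by (simp add: \<theta>_def bij_betw_def)
  have 3: "bij_betw \<theta> (?U - insert s D) (?U - insert s' D')"
    using g by (rule iffD1[OF bij_betw_cong, rotated]) (simp add: \<theta>_def)
  have "bij_betw \<theta> (D \<union> {s} \<union> (?U - insert s D)) (D' \<union> {s'} \<union> (?U - insert s' D'))"
    by (intro bij_betw_combine 1 2 3) (use D'(3) in auto)
  moreover have "D \<union> {s} \<union> (?U - insert s D) = ?U" "D' \<union> {s'} \<union> (?U - insert s' D') = ?U"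
    using D D' by auto
  ultimately have \<theta>: "bij_betw \<theta> ?U ?U" by simp
  have "card (occs T' (child (\<theta> x) xs')) = card (occs T (child x xs))" if x: "x \<in> ?U" for x
  proof -
    have x': "\<theta> x \<in> ?U" using bij_betwE[OF \<theta>] x by blast
    have "\<theta> x \<in> D' \<longleftrightarrow> x \<in> D"
      using bij_betwE[OF 1] bij_betwE[OF 3] x D(3) D'(3) by (cases "x = s") (auto simp: \<theta>_def)
    moreover have "\<theta> x = s' \<longleftrightarrow> x = s"
      using bij_betwE[OF 1] bij_betwE[OF 3] x D(3) D'(3) by (cases "x = s") (auto simp: \<theta>_def)
    ultimately show ?thesis using D(4)[OF x] D'(4)[OF x'] eq by (simp split: if_splits)
  qed
  with \<theta> show "\<exists>\<theta>. bij_betw \<theta> {1..Suc n} {1..Suc n} \<and>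
      (\<forall>x\<in>{1..Suc n}. card (occs T' (child (\<theta> x) xs')) = card (occs T (child x xs)))" by blast
qed (simp_all add: occs_singleton)

text \<open>On both sides only the top slot creates. For \<open>T\<close> the first entry is the
  maximum, and the slots up to its value destroy; for \<open>T'\<close> the first entry is the
  minimum, and the slots between the two values destroy. When the top entry is appended to length n,
  the new occurrence is destroyed by n slots in either case, among them all those that destroy an
  older one.\<close>

locale nested_kills =
  fixes T T' :: "(nat \<times> nat) set"
  assumes T: "(0, 0) \<notin> T" "(0, 1) \<in> T" "(0, 2) \<in> T" "(1, 0) \<notin> T" "(1, 1) \<in> T" "(1, 2) \<in> T"
      "(2, 0) \<in> T" "(2, 1) \<notin> T" "(2, 2) \<notin> T"
    and T': "(0, 0) \<in> T'" "(0, 1) \<notin> T'" "(0, 2) \<in> T'" "(1, 0) \<in> T'" "(1, 1) \<notin> T'" "(1, 2) \<in> T'"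
      "(2, 0) \<notin> T'" "(2, 1) \<in> T'" "(2, 2) \<notin> T'"
begin

text \<open>The slots destroying \<open>p\<close> under \<open>T\<close> are matched with those
  destroying \<open>q\<close> under \<open>T'\<close>.\<close>

definition match :: "nat list \<Rightarrow> nat list \<Rightarrow> (nat \<Rightarrow> nat) \<Rightarrow> nat \<times> nat \<Rightarrow> nat \<times> nat \<Rightarrow> bool" where
  "match xs xs' \<theta> p q \<longleftrightarrow>
     (\<forall>y\<in>{1..Suc (length xs)}. y \<le> xs ! fst p \<longleftrightarrow> xs' ! fst q < \<theta> y \<and> \<theta> y \<le> xs' ! snd q)"

definition Sim :: "nat list \<Rightarrow> nat list \<Rightarrow> bool" where
  "Sim xs xs' \<longleftrightarrow> (\<exists>\<theta> \<beta>. bij_betw \<theta> {1..Suc (length xs)} {1..Suc (length xs)} \<and>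
      \<theta> (Suc (length xs)) = Suc (length xs) \<and> bij_betw \<beta> (occs T xs) (occs T' xs') \<and>
      (\<forall>p\<in>occs T xs. match xs xs' \<theta> p (\<beta> p)))"

definition survivors :: "nat list \<Rightarrow> nat \<Rightarrow> (nat \<times> nat) set" where
  "survivors xs x = {(i, j) \<in> occs T xs. (2, if x \<le> xs ! i then 0 else if x \<le> xs ! j then 1 else 2) \<notin> T}"

definition survivors' :: "nat list \<Rightarrow> nat \<Rightarrow> (nat \<times> nat) set" where
  "survivors' xs x = {(i, j) \<in> occs T' xs. (2, if x \<le> xs ! i then 0 else if x \<le> xs ! j then 1 else 2) \<notin> T'}"

lemma survivors_iff: "p \<in> survivors xs x \<longleftrightarrow> p \<in> occs T xs \<and> \<not> x \<le> xs ! fst p"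
  using T(7-9) by (cases p) (simp add: survivors_def)

lemma survivors'_iff: "p \<in> survivors' xs x \<longleftrightarrow> p \<in> occs T' xs \<and> \<not> (xs ! fst p < x \<and> x \<le> xs ! snd p)"
proof (cases p)
  case (Pair i j)
  have "xs ! i < xs ! j" if "(i, j) \<in> occs T' xs" using that by (simp add: occs_def)
  then show ?thesis using T'(7-9) Pair by (auto simp: survivors'_def)
qed

lemma Sim_step:
  assumes n: "0 < n" and xs: "xs \<in> perms n" and xs': "xs' \<in> perms n" and sim: "Sim xs xs'"
  shows "\<exists>\<theta>. bij_betw \<theta> {1..Suc n} {1..Suc n} \<and> (\<forall>x\<in>{1..Suc n}. Sim (child x xs) (child (\<theta> x) xs'))"
proof -
  note p = perms_D[OF xs] and p' = perms_D[OF xs']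
  let ?N = "Suc n"
  obtain \<theta> \<beta> where \<theta>: "bij_betw \<theta> {1..?N} {1..?N}" and top: "\<theta> ?N = ?N"
    and \<beta>: "bij_betw \<beta> (occs T xs) (occs T' xs')"
    and K: "\<And>p y. p \<in> occs T xs \<Longrightarrow> 1 \<le> y \<Longrightarrow> y \<le> ?N \<Longrightarrow>
      y \<le> xs ! fst p \<longleftrightarrow> xs' ! fst (\<beta> p) < \<theta> y \<and> \<theta> y \<le> xs' ! snd (\<beta> p)"
    using sim unfolding Sim_def match_def p(3) by (metis atLeastAtMost_iff)
  obtain i where i: "i < n" "xs ! i = n" using perms_ex[OF xs, of n] n by auto
  obtain i' where i': "i' < n" "xs' ! i' = 1" using perms_ex[OF xs', of 1] n by auto
  have mem: "1 \<le> \<theta> y \<and> \<theta> y \<le> ?N" if "1 \<le> y" "y \<le> ?N" for y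
    using bij_betwE[OF \<theta>] that by auto
  have inj: "y = z" if "\<theta> y = \<theta> z" "1 \<le> y" "y \<le> ?N" "1 \<le> z" "z \<le> ?N" for y z
    using inj_onD[OF bij_betw_imp_inj_on[OF \<theta>] that(1)] that by auto
  have fs: "fst q < snd q" "snd q < n" "fst q < n" if "q \<in> occs T xs" for q
    using that p(3) by (auto simp: occs_def)
  have fs': "fst q < snd q" "snd q < n" "fst q < n" if "q \<in> occs T' xs'" for q
    using that p'(3) by (auto simp: occs_def)
  have \<beta>m: "\<beta> q \<in> occs T' xs'" if "q \<in> occs T xs" for q using bij_betwE[OF \<beta>] that by blast
  have "Sim (child x xs) (child (\<theta> x) xs')" if x: "x \<in> {1..?N}" for x
  proof -
    define x' where "x' = \<theta> x"
    define ys ys' where "ys = child x xs" and "ys' = child x' xs'"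
    have x': "x' \<in> {1..?N}" using mem x by (auto simp: x'_def)
    have len: "length ys = ?N" "length ys' = ?N" by (simp_all add: ys_def ys'_def p(3) p'(3))
    have nth: "ys ! l = lift x (xs ! l)" "ys' ! l = lift x' (xs' ! l)" if "l < n" for l
      using that by (simp_all add: ys_def ys'_def child_nth p(3) p'(3))
    have nthn: "ys ! n = x" "ys' ! n = x'"
      by (simp_all add: ys_def ys'_def child_nth p(3) p'(3))
    have sv: "bij_betw \<beta> (survivors xs x) (survivors' xs' x')"
    proof -
      have iff: "\<beta> q \<in> survivors' xs' x' \<longleftrightarrow> q \<in> survivors xs x" if "q \<in> occs T xs" for q
        unfolding survivors_iff survivors'_iff x'_def using \<beta>m[OF that] that K[OF that, of x] x by auto
      have sub: "survivors xs x \<subseteq> occs T xs" "survivors' xs' x' \<subseteq> occs T' xs'"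
        by (auto simp: survivors_iff survivors'_iff)
      have "\<beta> ` survivors xs x = survivors' xs' x'"
      proof (intro equalityI subsetI)
        fix q assume q: "q \<in> survivors' xs' x'"
        then obtain r where "r \<in> occs T xs" "q = \<beta> r"
          using bij_betw_imp_surj_on[OF \<beta>] sub(2) by (metis imageE subsetD)
        then show "q \<in> \<beta> ` survivors xs x" using iff q by blast
      qed (use iff sub in blast)
      then show ?thesis using inj_on_subset[OF bij_betw_imp_inj_on[OF \<beta>] sub(1)] by (simp add: bij_betw_def)
    qed
    have top_iff: "x' = ?N \<longleftrightarrow> x = ?N" using inj[of x ?N] top x by (auto simp: x'_def)
    have occ: "occs T ys = survivors xs x \<union> (if x = ?N then {(i, n)} else {})"
      unfolding ys_def occs_child survivors_def p(3)
      by (subst news_argmax_top[OF xs _ _ i T(1-6)]) (use x in auto)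
    have occ': "occs T' ys' = survivors' xs' x' \<union> (if x = ?N then {(i', n)} else {})"
      unfolding ys'_def occs_child survivors'_def p'(3) top_iff[symmetric]
      by (subst news_argmin_top[OF xs' _ _ i' T'(1-6)]) (use x' in auto)
    show ?thesis
    proof (cases "x = ?N")
      case False
      \<comment> \<open>Without a new occurrence only old values matter, and both halves of a split
        slot are on the same side of each of them. The refinement is thus correct, its crossing
        being immaterial here.\<close>
      define t where "t = split_slots x x' \<theta>"
      have t: "bij_betw t {1..Suc ?N} {1..Suc ?N}" unfolding t_def x'_def by (rule bij_betw_split_slots[OF \<theta> x])
      have un: "unlift x' (t y) = \<theta> (unlift x y)" if "1 \<le> y" "y \<le> Suc ?N" for y
        unfolding t_def x'_def by (rule unlift_split_slots[OF \<theta> x that])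
      have uy: "1 \<le> unlift x y \<and> unlift x y \<le> ?N" if "1 \<le> y" "y \<le> Suc ?N" for y
        using that x by (auto simp: unlift_def)
      have "x < ?N" "x' < ?N" using False x x' top_iff by auto
      then have ttop: "t (Suc ?N) = Suc ?N" using top by (simp add: t_def split_slots_def unlift_def lift_def)
      have "match ys ys' t q (\<beta> q)" if q: "q \<in> survivors xs x" for q
        unfolding match_def len
      proof
        fix y assume y: "y \<in> {1..Suc ?N}"
        have qo: "q \<in> occs T xs" using q by (simp add: survivors_iff)
        show "y \<le> ys ! fst q \<longleftrightarrow> ys' ! fst (\<beta> q) < t y \<and> t y \<le> ys' ! snd (\<beta> q)"
          using fs[OF qo] fs'[OF \<beta>m[OF qo]] K[OF qo, of "unlift x y"] uy[of y] un[of y] y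
          by (simp add: nth lift_less_unlift le_lift_unlift)
      qed
      moreover have "occs T ys = survivors xs x" "occs T' ys' = survivors' xs' x'"
        using occ occ' False by simp_all
      ultimately have "Sim ys ys'"
        unfolding Sim_def len using t ttop sv by (intro exI[of _ t] exI[of _ \<beta>]) simp
      then show ?thesis by (simp add: ys_def ys'_def x'_def)
    next
      case True
      then have xN: "x = ?N" "x' = ?N" using top_iff by auto
      have nth1: "ys ! l = xs ! l" "ys' ! l = xs' ! l" if "l < n" for l
        using that p(4)[OF that] p'(4)[OF that] by (simp_all add: nth xN lift_def)
      \<comment> \<open>The harmless slots for the new occurrence are the two highest for
        \<open>T\<close>, but the lowest and the highest for \<open>T'\<close>; so ?N must go to 1.
        The slot formerly sent to 1 goes to ?N, which like 1 lies between the values of no old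
        occurrence of \<open>T'\<close>.\<close>
      define u where "u y = (if y = Suc ?N then Suc ?N else if y = ?N then 1
        else if \<theta> y = 1 then ?N else \<theta> y)" for y
      have c: "u w = Suc ?N \<and> w = Suc ?N \<or> u w = 1 \<and> w = ?N \<or>
          w \<le> n \<and> (\<theta> w = 1 \<and> u w = ?N \<or> 1 < \<theta> w \<and> \<theta> w \<le> n \<and> u w = \<theta> w)"
        if "1 \<le> w" "w \<le> Suc ?N" for w
      proof -
        have "1 \<le> \<theta> w \<and> \<theta> w \<le> n" if "w \<le> n"
          using mem[of w] inj[of w ?N] top that \<open>1 \<le> w\<close> by (cases "\<theta> w = ?N") auto
        then show ?thesis using that by (auto simp: u_def)
      qed
      have u: "bij_betw u {1..Suc ?N} {1..Suc ?N}"
      proof (rule bij_betw_inj_intervalI)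
        fix y assume y: "1 \<le> y" "y \<le> Suc ?N"
        then show "1 \<le> u y \<and> u y \<le> Suc ?N" using c[OF y] by auto
        fix z assume z: "1 \<le> z" "z \<le> Suc ?N" "u y = u z"
        have "y = z" if "y \<le> n" "z \<le> n" "\<theta> y = \<theta> z"
          using inj[OF that(3)] that y z by auto
        then show "y = z" using c[OF y] c[OF z(1,2)] z(3) n by auto
      qed
      define \<gamma> where "\<gamma> q = (if snd q = n then (i', n) else \<beta> q)" for q
      have sn: "snd q < n" if "q \<in> survivors xs x" for q using that fs by (simp add: survivors_iff)
      have sn': "snd q < n" if "q \<in> survivors' xs' x'" for q using that fs' by (simp add: survivors'_iff)
      have "bij_betw \<gamma> (survivors xs x) (survivors' xs' x')"
        using sv by (rule iffD1[OF bij_betw_cong, rotated]) (use sn in \<open>force simp: \<gamma>_def\<close>)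
      moreover have "bij_betw \<gamma> {(i, n)} {(i', n)}" by (simp add: \<gamma>_def bij_betw_def)
      moreover have "survivors' xs' x' \<inter> {(i', n)} = {}" using sn' by force
      ultimately have "bij_betw \<gamma> (survivors xs x \<union> {(i, n)}) (survivors' xs' x' \<union> {(i', n)})"
        by (rule bij_betw_combine)
      then have g: "bij_betw \<gamma> (occs T ys) (occs T' ys')" using occ occ' xN(1) by simp
      have "match ys ys' u q (\<gamma> q)" if q: "q \<in> occs T ys" for q
        unfolding match_def len
      proof
        fix y assume "y \<in> {1..Suc ?N}"
        then have y: "1 \<le> y" "y \<le> Suc ?N" by auto
        show "y \<le> ys ! fst q \<longleftrightarrow> ys' ! fst (\<gamma> q) < u y \<and> u y \<le> ys' ! snd (\<gamma> q)"
        proof (cases "q = (i, n)")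
          case True
          then have "\<gamma> q = (i', n)" by (simp add: \<gamma>_def)
          then show ?thesis using c[OF y] True i i' n by (auto simp: nthn nth1 xN)
        next
          case False
          then have qs: "q \<in> survivors xs x" using q unfolding occ xN(1) by simp
          then have qo: "q \<in> occs T xs" by (simp add: survivors_iff)
          have gq: "\<gamma> q = \<beta> q" using sn[OF qs] by (simp add: \<gamma>_def)
          note f = fs[OF qo] fs'[OF \<beta>m[OF qo]]
          have v: "xs ! fst q \<le> n" "0 < xs' ! fst (\<beta> q)" "xs' ! snd (\<beta> q) \<le> n"
            using p(4) p'(4) f by blast+
          have Ky: "y \<le> xs ! fst q \<longleftrightarrow> xs' ! fst (\<beta> q) < \<theta> y \<and> \<theta> y \<le> xs' ! snd (\<beta> q)" if "y \<le> n"
            using K[OF qo y(1)] that by simp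
          show ?thesis unfolding gq nth1(1)[OF f(3)] nth1(2)[OF f(6)] nth1(2)[OF f(5)]
            using c[OF y] Ky v by auto
        qed
      qed
      moreover have "u (Suc ?N) = Suc ?N" by (simp add: u_def)
      ultimately have "Sim ys ys'"
        unfolding Sim_def len using u g by (intro exI[of _ u] exI[of _ \<gamma>]) simp
      then show ?thesis by (simp add: ys_def ys'_def x'_def)
    qed
  qed
  then show ?thesis using \<theta> by blast
qed

lemma equid: "equid T T'"
proof (rule equid_by_tree[of Sim])
  show "Sim [Suc 0] [Suc 0]"
    unfolding Sim_def occs_singleton by (intro exI[of _ id] conjI) auto
  show "card (occs T' xs') = card (occs T xs)" if "Sim xs xs'" for xs xs'
    using that bij_betw_same_card unfolding Sim_def by fastforce
qed (rule Sim_step)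

end

lemma equid_pointwise:
  assumes "\<And>n xs. xs \<in> perms n \<Longrightarrow> card (occs S xs) = card (occs R xs)"
  shows "equid R S"
  by (rule equid_invol[where F = id]) (use assms in auto)

section \<open>Swapping the upper rows, one value at a time\<close>

lemma ex_antitone_bij:
  fixes A B :: "nat set"
  assumes "finite A" "finite B" "card A = card B"
  shows "\<exists>\<theta>. bij_betw \<theta> A B \<and> (\<forall>u\<in>A. \<forall>w\<in>A. u < w \<longleftrightarrow> \<theta> w < \<theta> u)"
  using assms
proof (induction A arbitrary: B rule: finite_linorder_max_induct)
  case empty
  then show ?case by (auto simp: bij_betw_def)
next
  case (insert a A)
  have aA: "a \<notin> A" using insert.hyps(2) by blast
  have "B \<noteq> {}" using insert.prems insert.hyps(1) aA by auto
  define b where "b = Min B"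
  have b: "b \<in> B" "\<And>y. y \<in> B - {b} \<Longrightarrow> b < y"
    using insert.prems(1) \<open>B \<noteq> {}\<close> Min_le[of B] by (auto simp: b_def le_neq_implies_less)
  have "card A = card (B - {b})"
    using insert.prems insert.hyps(1) aA b(1) by (simp add: card_Diff_singleton)
  then obtain \<theta> where \<theta>: "bij_betw \<theta> A (B - {b})" "\<And>u w. u \<in> A \<Longrightarrow> w \<in> A \<Longrightarrow> u < w \<longleftrightarrow> \<theta> w < \<theta> u"
    using insert.IH[of "B - {b}"] insert.prems(1) by auto
  define \<phi> where "\<phi> = \<theta>(a := b)"
  have \<phi>: "\<phi> a = b" "\<And>u. u \<in> A \<Longrightarrow> \<phi> u = \<theta> u" using aA by (auto simp: \<phi>_def)
  have "bij_betw \<phi> A (B - {b})" using \<theta>(1) by (rule iffD1[OF bij_betw_cong, rotated]) (simp add: \<phi>)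
  then have "bij_betw \<phi> (A \<union> {a}) ((B - {b}) \<union> {b})"
    by (rule bij_betw_combine) (auto simp: bij_betw_def \<phi>)
  then have "bij_betw \<phi> (insert a A) B" using b(1) by (simp add: insert_absorb)
  moreover have "u < w \<longleftrightarrow> \<phi> w < \<phi> u" if uw: "u \<in> insert a A" "w \<in> insert a A" for u w
  proof -
    have lt: "b < \<theta> z" if "z \<in> A" for z using b(2) bij_betwE[OF \<theta>(1)] that by blast
    consider "u = a" "w = a" | "u = a" "w \<in> A" | "u \<in> A" "w = a" | "u \<in> A" "w \<in> A" using uw by blast
    then show ?thesis
    proof cases
      case 1
      then show ?thesis by simp
    next
      case 2
      then show ?thesis using insert.hyps(2)[rule_format, of w] lt[of w] by (simp add: \<phi>)
    next
      case 3
      then show ?thesis using insert.hyps(2)[rule_format, of u] lt[of u] by (simp add: \<phi>)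
    next
      case 4
      then show ?thesis using \<theta>(2) by (simp add: \<phi>)
    qed
  qed
  ultimately show ?case by blast
qed

section \<open>Prefixes that keep their final values\<close>

definition prefixes_of_length :: "nat \<Rightarrow> nat \<Rightarrow> nat list set" where
  "prefixes_of_length n r = {xs. distinct xs \<and> set xs \<subseteq> {1..n} \<and> length xs = r}"

lemma bij_betw_append:
  "bij_betw (\<lambda>(xs, v). xs @ [v]) (SIGMA xs:prefixes_of_length n r. {1..n} - set xs) (prefixes_of_length n (Suc r))"
proof (rule bij_betw_byWitness[where f' = "\<lambda>zs. (butlast zs, last zs)"])
  have "butlast zs \<in> prefixes_of_length n r \<and> last zs \<in> {1..n} - set (butlast zs) \<and> butlast zs @ [last zs] = zs"
    if zs: "zs \<in> prefixes_of_length n (Suc r)" for zs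
  proof -
    obtain ys v where "zs = ys @ [v]" using zs by (cases zs rule: rev_cases) (auto simp: prefixes_of_length_def)
    then show ?thesis using zs by (auto simp: prefixes_of_length_def)
  qed
  then show "\<forall>a'\<in>prefixes_of_length n (Suc r). (case (butlast a', last a') of (xs, v) \<Rightarrow> xs @ [v]) = a'"
    "(\<lambda>zs. (butlast zs, last zs)) ` prefixes_of_length n (Suc r) \<subseteq> (SIGMA xs:prefixes_of_length n r. {1..n} - set xs)"
    by auto
qed (auto simp: prefixes_of_length_def)

lemma prefixes_full: "prefixes_of_length n n = perms n"
proof (intro equalityI subsetI)
  fix xs assume "xs \<in> prefixes_of_length n n"
  then have xs: "distinct xs" "set xs \<subseteq> {1..n}" "length xs = n" by (auto simp: prefixes_of_length_def)
  then have "set xs = {1..n}" using distinct_card[of xs] by (intro card_subset_eq) auto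
  with xs(1) show "xs \<in> perms n" by (simp add: perms_iff)
next
  fix xs assume "xs \<in> perms n"
  then show "xs \<in> prefixes_of_length n n" using perms_D(1-3)[of xs n] by (simp add: prefixes_of_length_def)
qed

text \<open>The occurrences in a prefix of a permutation of $\{1,\dots,n\}$: the values still to come are
  exactly the unused ones.\<close>

definition prefix_occs :: "(nat \<times> nat) set \<Rightarrow> nat \<Rightarrow> nat list \<Rightarrow> (nat \<times> nat) set" where
  "prefix_occs R n xs = {(i, j). i < j \<and> j < length xs \<and> xs ! i < xs ! j \<and>
     (\<forall>l<j. l \<noteq> i \<longrightarrow> (if l < i then 0 else 1, mcell (xs ! i) (xs ! j) (xs ! l)) \<notin> R) \<and>
     (\<forall>u\<in>{1..n} - set (take (Suc j) xs). (2, mcell (xs ! i) (xs ! j) u) \<notin> R)}"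

definition prefix_news :: "(nat \<times> nat) set \<Rightarrow> nat \<Rightarrow> nat list \<Rightarrow> nat \<Rightarrow> nat set" where
  "prefix_news R n xs v = {i. i < length xs \<and> xs ! i < v \<and>
     (\<forall>l<length xs. l \<noteq> i \<longrightarrow> (if l < i then 0 else 1, mcell (xs ! i) v (xs ! l)) \<notin> R) \<and>
     (\<forall>u\<in>{1..n} - insert v (set xs). (2, mcell (xs ! i) v u) \<notin> R)}"

lemma prefix_occs_perms:
  assumes "xs \<in> perms n"
  shows "prefix_occs R n xs = occs R xs"
proof -
  note p = perms_D[OF assms]
  have "(i, j) \<in> prefix_occs R n xs \<longleftrightarrow> (i, j) \<in> occs R xs" for i j
  proof (cases "i < j \<and> j < n \<and> xs ! i < xs ! j")
    case True
    let ?v = "\<lambda>u. mcell (xs ! i) (xs ! j) u"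
    have 1: "{1..n} - set (take (Suc j) xs) = {xs ! l | l. j < l \<and> l < n}"
    proof -
      have "set xs = set (take (Suc j) xs) \<union> set (drop (Suc j) xs)"
        by (metis append_take_drop_id set_append)
      moreover have "set (take (Suc j) xs) \<inter> set (drop (Suc j) xs) = {}"
        using p(1) by (simp add: set_take_disj_set_drop_if_distinct)
      moreover have "set (drop (Suc j) xs) = {xs ! l | l. j < l \<and> l < n}"
      proof -
        have "u \<in> set (drop (Suc j) xs) \<longleftrightarrow> (\<exists>l. j < l \<and> l < n \<and> u = xs ! l)" for u
        proof
          assume "u \<in> set (drop (Suc j) xs)"
          then obtain k where "k < n - Suc j" "u = xs ! (Suc j + k)"
            using p(3) by (auto simp: in_set_conv_nth)
          then show "\<exists>l. j < l \<and> l < n \<and> u = xs ! l" by (intro exI[of _ "Suc j + k"]) auto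
        next
          assume "\<exists>l. j < l \<and> l < n \<and> u = xs ! l"
          then obtain l where l: "j < l" "l < n" "u = xs ! l" by blast
          then have "drop (Suc j) xs ! (l - Suc j) = u" "l - Suc j < length (drop (Suc j) xs)"
            using p(3) by auto
          then show "u \<in> set (drop (Suc j) xs)" by (metis nth_mem)
        qed
        then show ?thesis by auto
      qed
      ultimately show ?thesis using p(2) by auto
    qed
    have "(\<forall>l<n. l \<noteq> i \<longrightarrow> l \<noteq> j \<longrightarrow> (mcell i j l, ?v (xs ! l)) \<notin> R) \<longleftrightarrow>
      (\<forall>l<j. l \<noteq> i \<longrightarrow> (if l < i then 0 else 1, ?v (xs ! l)) \<notin> R) \<and> (\<forall>l. j < l \<and> l < n \<longrightarrow> (2, ?v (xs ! l)) \<notin> R)"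
      (is "?L \<longleftrightarrow> ?A \<and> ?B")
    proof
      assume L: ?L
      have ?A
      proof (intro allI impI)
        fix l assume l: "l < j" "l \<noteq> i"
        then have mc: "mcell i j l = (if l < i then 0 else 1)" by (simp add: mcell_def)
        have "(mcell i j l, ?v (xs ! l)) \<notin> R" using L[rule_format, of l] True l by simp
        then show "(if l < i then 0 else 1, ?v (xs ! l)) \<notin> R" unfolding mc .
      qed
      moreover have ?B
      proof (intro allI impI)
        fix l assume "j < l \<and> l < n"
        moreover then have "mcell i j l = 2" using True by (simp add: mcell_def)
        ultimately show "(2, ?v (xs ! l)) \<notin> R" using L[rule_format, of l] True by simp
      qed
      ultimately show "?A \<and> ?B" by blast
    next
      assume AB: "?A \<and> ?B"
      show ?L
      proof (intro allI impI)
        fix l assume l: "l < n" "l \<noteq> i" "l \<noteq> j"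
        show "(mcell i j l, ?v (xs ! l)) \<notin> R"
        proof (cases "l < j")
          case True
          then have "mcell i j l = (if l < i then 0 else 1)" by (simp add: mcell_def)
          then show ?thesis using AB True l by metis
        next
          case False
          then have "mcell i j l = 2" "j < l" using True l by (simp_all add: mcell_def)
          then show ?thesis using AB l by simp
        qed
      qed
    qed
    moreover have "(\<forall>u\<in>{1..n} - set (take (Suc j) xs). (2, ?v u) \<notin> R) \<longleftrightarrow>
        (\<forall>l. j < l \<and> l < n \<longrightarrow> (2, ?v (xs ! l)) \<notin> R)"
      unfolding 1 by blast
    ultimately show ?thesis
      unfolding prefix_occs_def occs_def mem_Collect_eq case_prod_conv p(3) by blast
  qed (auto simp: prefix_occs_def occs_def p)
  then show ?thesis by auto
qed

text \<open>The condition on column 2 involves only the set of values after position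
  \<open>j\<close>, which is fixed once \<open>j\<close> is filled. So appending adds occurrences
  and never removes any.\<close>

lemma card_prefix_occs_append:
  "card (prefix_occs R n (xs @ [v])) = card (prefix_occs R n xs) + card (prefix_news R n xs v)"
proof -
  let ?r = "length xs"
  have fin: "finite (prefix_occs R n xs)"
    by (rule finite_subset[of _ "{..<?r} \<times> {..<?r}"]) (auto simp: prefix_occs_def)
  have "(i, j) \<in> prefix_occs R n (xs @ [v]) \<longleftrightarrow> (i, j) \<in> prefix_occs R n xs \<union> (\<lambda>i. (i, ?r)) ` prefix_news R n xs v" for i j
  proof -
    consider "j < ?r" | "j = ?r" | "j > ?r" by linarith
    then show ?thesis
    proof cases
      case 1
      then show ?thesis by (cases "i < j") (auto simp: prefix_occs_def nth_append)
    next
      case 2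
      then show ?thesis by (cases "i < j") (auto simp: prefix_occs_def prefix_news_def nth_append)
    next
      case 3
      then show ?thesis by (auto simp: prefix_occs_def)
    qed
  qed
  then have "prefix_occs R n (xs @ [v]) = prefix_occs R n xs \<union> (\<lambda>i. (i, ?r)) ` prefix_news R n xs v" by auto
  moreover have "finite (prefix_news R n xs v)"
    by (rule finite_subset[of _ "{..<?r}"]) (auto simp: prefix_news_def)
  moreover have "prefix_occs R n xs \<inter> (\<lambda>i. (i, ?r)) ` prefix_news R n xs v = {}"
    by (auto simp: prefix_occs_def)
  ultimately show ?thesis using fin by (simp add: card_Un_disjoint card_image inj_on_def)
qed

locale block_swap =
  fixes R S :: "(nat \<times> nat) set"
  assumes R: "(0, 0) \<in> R" "(1, 0) \<in> R" "(0, 1) \<notin> R" "(0, 2) \<notin> R"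
    and S: "\<And>x y. x \<le> 2 \<Longrightarrow> y \<le> 2 \<Longrightarrow> (x, y) \<in> S \<longleftrightarrow> (x, swap12 y) \<in> R"
begin

definition is_min :: "nat list \<Rightarrow> nat \<Rightarrow> bool" where
  "is_min xs i \<longleftrightarrow> i < length xs \<and> (\<forall>l<length xs. l \<noteq> i \<longrightarrow> xs ! i < xs ! l)"

text \<open>As in \<open>news_argmin\<close>, the minimum would occupy a shaded cell of row 0 of any
  other candidate.\<close>

lemma prefix_news_min:
  assumes T: "(0, 0) \<in> T" "(1, 0) \<in> T" "(0, 1) \<notin> T" "(0, 2) \<notin> T" and i: "is_min xs i"
  shows "prefix_news T n xs v = (if xs ! i < v \<and>
      (\<forall>l<length xs. i < l \<longrightarrow> (1, mcell (xs ! i) v (xs ! l)) \<notin> T) \<and>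
      (\<forall>u\<in>{1..n} - insert v (set xs). (2, mcell (xs ! i) v u) \<notin> T) then {i} else {})"
proof -
  have eq: "k = i" if k: "k \<in> prefix_news T n xs v" for k
  proof (rule ccontr)
    assume "k \<noteq> i"
    moreover have "k < length xs" using k by (simp add: prefix_news_def)
    ultimately have lt: "xs ! i < xs ! k" using i by (simp add: is_min_def)
    have "(if i < k then 0 else 1, mcell (xs ! k) v (xs ! i)) \<notin> T"
      using k i \<open>k \<noteq> i\<close> unfolding prefix_news_def is_min_def by blast
    then show False using lt T by (simp add: mcell_def split: if_splits)
  qed
  have "(\<forall>l<length xs. l \<noteq> i \<longrightarrow> (if l < i then 0 else 1, mcell (xs ! i) v (xs ! l)) \<notin> T) \<longleftrightarrow>
      (\<forall>l<length xs. i < l \<longrightarrow> (1, mcell (xs ! i) v (xs ! l)) \<notin> T)" (is "?A \<longleftrightarrow> ?B")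
  proof
    assume A: ?A
    show ?B
    proof (intro allI impI)
      fix l assume "l < length xs" "i < l"
      then show "(1, mcell (xs ! i) v (xs ! l)) \<notin> T" using A[rule_format, of l] by simp
    qed
  next
    assume B: ?B
    show ?A
    proof (intro allI impI)
      fix l assume l: "l < length xs" "l \<noteq> i"
      then have "xs ! i < xs ! l" using i by (simp add: is_min_def)
      then have "mcell (xs ! i) v (xs ! l) \<in> {1, 2}" by (simp add: mcell_def)
      then have "(0, mcell (xs ! i) v (xs ! l)) \<notin> T" using T by auto
      then show "(if l < i then 0 else 1, mcell (xs ! i) v (xs ! l)) \<notin> T"
        using B[rule_format, of l] l by (cases "l < i") auto
    qed
  qed
  then have iff: "i \<in> prefix_news T n xs v \<longleftrightarrow> xs ! i < v \<and>
      (\<forall>l<length xs. i < l \<longrightarrow> (1, mcell (xs ! i) v (xs ! l)) \<notin> T) \<and>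
      (\<forall>u\<in>{1..n} - insert v (set xs). (2, mcell (xs ! i) v u) \<notin> T)"
    using i unfolding prefix_news_def is_min_def by blast
  have "prefix_news T n xs v \<subseteq> {i}" using eq by blast
  then have "prefix_news T n xs v = (if i \<in> prefix_news T n xs v then {i} else {})"
    by (metis empty_iff subset_singletonD singletonI)
  then show ?thesis unfolding iff .
qed

abbreviation above :: "nat \<Rightarrow> nat list \<Rightarrow> nat \<Rightarrow> nat set" where
  "above n xs m \<equiv> {u \<in> {1..n}. m < u \<and> u \<notin> set xs}"

text \<open>Until the next left-to-right minimum, the unused values above the current one are matched in
  reverse order. The next minimum is the same on both sides, and then a new matching is chosen.\<close>

definition Sim :: "nat \<Rightarrow> nat list \<Rightarrow> nat list \<Rightarrow> bool" where
  "Sim n xs xs' \<longleftrightarrow> card (prefix_occs S n xs') = card (prefix_occs R n xs) \<and>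
    (\<exists>i \<theta>. is_min xs i \<and> is_min xs' i \<and> xs' ! i = xs ! i \<and>
      bij_betw \<theta> (above n xs (xs ! i)) (above n xs' (xs ! i)) \<and>
      (\<forall>u\<in>above n xs (xs ! i). \<forall>w\<in>above n xs (xs ! i). u < w \<longleftrightarrow> \<theta> w < \<theta> u) \<and>
      (\<forall>l<length xs. i < l \<longrightarrow> (\<forall>u\<in>above n xs (xs ! i). u < xs ! l \<longleftrightarrow> xs' ! l < \<theta> u)))"

lemma S': "(0, 0) \<in> S" "(1, 0) \<in> S" "(0, 1) \<notin> S" "(0, 2) \<notin> S"
  using R S[of 0 0] S[of 1 0] S[of 0 2] S[of 0 1] by (simp_all add: swap12_def)

lemma Sim_step:
  assumes xs: "xs \<in> prefixes_of_length n r" and xs': "xs' \<in> prefixes_of_length n r" and sim: "Sim n xs xs'"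
  shows "\<exists>\<phi>. bij_betw \<phi> ({1..n} - set xs) ({1..n} - set xs') \<and>
     (\<forall>v\<in>{1..n} - set xs. Sim n (xs @ [v]) (xs' @ [\<phi> v]))"
proof -
  have len: "length xs = r" "length xs' = r" using xs xs' by (simp_all add: prefixes_of_length_def)
  from sim obtain i \<theta> where i: "is_min xs i" "is_min xs' i" "xs' ! i = xs ! i"
    and \<theta>: "bij_betw \<theta> (above n xs (xs ! i)) (above n xs' (xs ! i))"
    and anti': "\<forall>u\<in>above n xs (xs ! i). \<forall>w\<in>above n xs (xs ! i). u < w \<longleftrightarrow> \<theta> w < \<theta> u"
    and B': "\<forall>l<length xs. i < l \<longrightarrow> (\<forall>u\<in>above n xs (xs ! i). u < xs ! l \<longleftrightarrow> xs' ! l < \<theta> u)"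
    unfolding Sim_def by (elim conjE exE) rule
  have anti: "u < w \<longleftrightarrow> \<theta> w < \<theta> u" if "u \<in> above n xs (xs ! i)" "w \<in> above n xs (xs ! i)" for u w
    by (rule anti'[rule_format, OF that])
  have B: "u < xs ! l \<longleftrightarrow> xs' ! l < \<theta> u" if "l < r" "i < l" "u \<in> above n xs (xs ! i)" for l u
    by (rule B'[rule_format, unfolded len, OF that])
  have cnt: "card (prefix_occs S n xs') = card (prefix_occs R n xs)" using sim by (simp add: Sim_def)
  define m where "m = xs ! i"
  note i = i[folded m_def] and \<theta> = \<theta>[folded m_def] and anti = anti[folded m_def] and B = B[folded m_def]
  have ir: "i < r" using i(1) len by (simp add: is_min_def)
  have le: "m \<le> u" if "u \<in> set xs \<or> u \<in> set xs'" for u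
    using that i len unfolding is_min_def m_def in_set_conv_nth by (metis le_refl less_imp_le)
  have m_in: "m \<in> set xs" using nth_mem[of i xs] ir len by (simp add: m_def)
  have m_in': "m \<in> set xs'" using nth_mem[of i xs'] ir len i(3) by simp
  have mn: "m \<le> n" using subsetD[OF _ m_in, of "{1..n}"] xs by (simp add: prefixes_of_length_def)
  have un: "{1..n} - set xs = {1..<m} \<union> above n xs m"
  proof (rule set_eqI)
    fix u show "u \<in> {1..n} - set xs \<longleftrightarrow> u \<in> {1..<m} \<union> above n xs m"
      by (cases u m rule: linorder_cases) (use le[of u] mn m_in in auto)
  qed
  have un': "{1..n} - set xs' = {1..<m} \<union> above n xs' m"
  proof (rule set_eqI)
    fix u show "u \<in> {1..n} - set xs' \<longleftrightarrow> u \<in> {1..<m} \<union> above n xs' m"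
      by (cases u m rule: linorder_cases) (use le[of u] mn m_in' in auto)
  qed
  define \<phi> where "\<phi> v = (if v < m then v else \<theta> v)" for v
  have "bij_betw \<phi> {1..<m} {1..<m}"
    using bij_betw_id by (rule iffD1[OF bij_betw_cong, rotated]) (simp add: \<phi>_def)
  moreover have "bij_betw \<phi> (above n xs m) (above n xs' m)"
    using \<theta> by (rule iffD1[OF bij_betw_cong, rotated]) (simp add: \<phi>_def)
  ultimately have \<phi>: "bij_betw \<phi> ({1..n} - set xs) ({1..n} - set xs')"
    unfolding un un' by (rule bij_betw_combine) auto
  have "Sim n (xs @ [v]) (xs' @ [\<phi> v])" if v: "v \<in> {1..n} - set xs" for v
  proof (cases "v < m")
    case True
    then have \<phi>v: "\<phi> v = v" by (simp add: \<phi>_def)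
    have "prefix_news R n xs v = {}" "prefix_news S n xs' v = {}"
      unfolding prefix_news_min[OF R i(1)] prefix_news_min[OF S' i(2)] using True i(3) by (auto simp: m_def)
    then have c: "card (prefix_occs S n (xs' @ [v])) = card (prefix_occs R n (xs @ [v]))"
      unfolding card_prefix_occs_append using cnt by simp
    have "v < xs ! l" "v < xs' ! l" if "l < r" for l
      using True le[of "xs ! l"] le[of "xs' ! l"] nth_mem[of l xs] nth_mem[of l xs'] len that by force+
    then have "is_min (xs @ [v]) r" "is_min (xs' @ [v]) r"
      using len by (auto simp: is_min_def nth_append)
    moreover have nth: "(xs @ [v]) ! r = v" "(xs' @ [v]) ! r = v" by (simp_all add: nth_append len)
    moreover have "card (above n (xs @ [v]) v) = card (above n (xs' @ [v]) v)"
    proof -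
      have "above n (xs @ [v]) v = {v<..<m} \<union> above n xs m"
      proof (rule set_eqI)
        fix u show "u \<in> above n (xs @ [v]) v \<longleftrightarrow> u \<in> {v<..<m} \<union> above n xs m"
          by (cases u m rule: linorder_cases) (use True le[of u] mn m_in v in auto)
      qed
      moreover have "above n (xs' @ [v]) v = {v<..<m} \<union> above n xs' m"
      proof (rule set_eqI)
        fix u show "u \<in> above n (xs' @ [v]) v \<longleftrightarrow> u \<in> {v<..<m} \<union> above n xs' m"
          by (cases u m rule: linorder_cases) (use True le[of u] mn m_in' v in auto)
      qed
      moreover have "card ({v<..<m} \<union> above n xs m) = card ({v<..<m} \<union> above n xs' m)"
        by (subst (1 2) card_Un_disjoint) (use bij_betw_same_card[OF \<theta>] in auto)
      ultimately show ?thesis by simp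
    qed
    then obtain \<psi> where "bij_betw \<psi> (above n (xs @ [v]) v) (above n (xs' @ [v]) v)"
      "\<forall>u\<in>above n (xs @ [v]) v. \<forall>w\<in>above n (xs @ [v]) v. u < w \<longleftrightarrow> \<psi> w < \<psi> u"
      using ex_antitone_bij[of "above n (xs @ [v]) v" "above n (xs' @ [v]) v"] by auto
    ultimately show ?thesis unfolding Sim_def \<phi>v using c len
      by (intro conjI exI[of _ r] exI[of _ \<psi>]) simp_all
  next
    case False
    then have va: "v \<in> above n xs m" using v m_in by (cases v m rule: linorder_cases) auto
    define v' where "v' = \<theta> v"
    have \<phi>v: "\<phi> v = v'" using False by (simp add: \<phi>_def v'_def)
    have va': "v' \<in> above n xs' m" using bij_betwE[OF \<theta>] va by (simp add: v'_def)
    have mv: "m < v" "m < v'" using va va' by auto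
    have min: "is_min (xs @ [v]) i" "is_min (xs' @ [v']) i"
      using i mv ir len by (auto simp: is_min_def nth_append m_def less_Suc_eq)
    have nth: "(xs @ [v]) ! i = m" "(xs' @ [v']) ! i = m" using ir len i(3) by (simp_all add: nth_append m_def)
    have ab: "above n (xs @ [v]) m = above n xs m - {v}" "above n (xs' @ [v']) m = above n xs' m - {v'}" by auto
    have c1: "(1, mcell m v (xs ! l)) \<in> R \<longleftrightarrow> (1, mcell m v' (xs' ! l)) \<in> S" if l: "l < r" "i < l" for l
    proof -
      have "m < xs ! l" "m < xs' ! l" using i l len by (auto simp: is_min_def m_def)
      moreover have "xs ! l \<noteq> v" "xs' ! l \<noteq> v'" using va va' l len nth_mem[of l xs] nth_mem[of l xs'] by auto
      ultimately have "mcell m v' (xs' ! l) = swap12 (mcell m v (xs ! l))"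
        using B[OF l va] by (auto simp: mcell_def swap12_def v'_def)
      then show ?thesis using S[of 1 "swap12 (mcell m v (xs ! l))"] by (simp add: mcell_le)
    qed
    have c2: "(2, mcell m v u) \<in> R \<longleftrightarrow> (2, mcell m v' (\<phi> u)) \<in> S" if u: "u \<in> {1..n} - insert v (set xs)" for u
    proof (cases "u < m")
      case True
      then show ?thesis using S[of 2 0] by (simp add: \<phi>_def mcell_def swap12_def)
    next
      case False
      then have ua: "u \<in> above n xs m" "u \<noteq> v" using u m_in by (cases u m rule: linorder_cases; auto)+
      then have "\<theta> u \<in> above n xs' m" using bij_betwE[OF \<theta>] by blast
      then have "mcell m v' (\<theta> u) = swap12 (mcell m v u)"
        using anti[OF ua(1) va] anti[OF va ua(1)] ua by (auto simp: mcell_def swap12_def v'_def)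
      then show ?thesis using S[of 2 "swap12 (mcell m v u)"] False by (simp add: mcell_le \<phi>_def)
    qed
    \<comment> \<open>The values that remain after this step correspond under \<phi>, so the
      conditions on column 2 can be compared value by value.\<close>
    have rest: "\<phi> ` ({1..n} - insert v (set xs)) = {1..n} - insert v' (set xs')"
    proof -
      have "\<phi> ` (({1..n} - set xs) - {v}) = \<phi> ` ({1..n} - set xs) - \<phi> ` {v}"
        by (rule inj_on_image_set_diff[OF bij_betw_imp_inj_on[OF \<phi>]]) (use v in auto)
      then show ?thesis using bij_betw_imp_surj_on[OF \<phi>] \<phi>v by (simp add: set_diff_eq conj_ac Diff_insert)
    qed
    have "(\<forall>u\<in>{1..n} - insert v' (set xs'). (2, mcell m v' u) \<notin> S) \<longleftrightarrow>
        (\<forall>u\<in>{1..n} - insert v (set xs). (2, mcell m v u) \<notin> R)"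
      unfolding rest[symmetric] using c2 by blast
    moreover have "(\<forall>l<r. i < l \<longrightarrow> (1, mcell m v (xs ! l)) \<notin> R) \<longleftrightarrow> (\<forall>l<r. i < l \<longrightarrow> (1, mcell m v' (xs' ! l)) \<notin> S)"
      using c1 by blast
    ultimately have "prefix_news R n xs v = prefix_news S n xs' v'"
      unfolding prefix_news_min[OF R i(1)] prefix_news_min[OF S' i(2)] i(3) m_def[symmetric] len using mv by simp
    then have c: "card (prefix_occs S n (xs' @ [v'])) = card (prefix_occs R n (xs @ [v]))"
      unfolding card_prefix_occs_append using cnt by simp
    have "\<theta> ` (above n xs m - {v}) = above n xs' m - {v'}"
      using inj_on_image_set_diff[OF bij_betw_imp_inj_on[OF \<theta>], of "above n xs m" "{v}"] va
        bij_betw_imp_surj_on[OF \<theta>] by (simp add: v'_def)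
    then have bij: "bij_betw \<theta> (above n (xs @ [v]) m) (above n (xs' @ [v']) m)"
      unfolding ab using inj_on_subset[OF bij_betw_imp_inj_on[OF \<theta>], of "above n xs m - {v}"]
      unfolding bij_betw_def by blast
    have an: "u < w \<longleftrightarrow> \<theta> w < \<theta> u" if "u \<in> above n (xs @ [v]) m" "w \<in> above n (xs @ [v]) m" for u w
      by (rule anti) (use that in auto)
    have Bn: "u < (xs @ [v]) ! l \<longleftrightarrow> (xs' @ [v']) ! l < \<theta> u"
      if l: "l < length (xs @ [v])" "i < l" and u: "u \<in> above n (xs @ [v]) m" for l u
    proof (cases "l = r")
      case True
      have "u \<in> above n xs m" using u by simp
      then show ?thesis using anti[OF _ va] True len by (simp add: nth_append v'_def)
    next
      case False
      have "u \<in> above n xs m" using u by simp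
      then show ?thesis using B[of l u] False l len by (simp add: nth_append)
    qed
    show ?thesis unfolding Sim_def \<phi>v
    proof (intro conjI exI[of _ i] exI[of _ \<theta>])
      show "(xs' @ [v']) ! i = (xs @ [v]) ! i" using nth by simp
      show "bij_betw \<theta> (above n (xs @ [v]) ((xs @ [v]) ! i)) (above n (xs' @ [v']) ((xs @ [v]) ! i))"
        unfolding nth by (rule bij)
      show "\<forall>u\<in>above n (xs @ [v]) ((xs @ [v]) ! i). \<forall>w\<in>above n (xs @ [v]) ((xs @ [v]) ! i). u < w \<longleftrightarrow> \<theta> w < \<theta> u"
        unfolding nth by (intro ballI an)
      show "\<forall>l<length (xs @ [v]). i < l \<longrightarrow> (\<forall>u\<in>above n (xs @ [v]) ((xs @ [v]) ! i). u < (xs @ [v]) ! l \<longleftrightarrow> (xs' @ [v']) ! l < \<theta> u)"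
        unfolding nth by (intro allI impI ballI Bn)
    qed (fact c min)+
  qed
  with \<phi> show ?thesis by blast
qed

lemma equid: "equid R S"
proof (rule equid_bij)
  fix n
  show "\<exists>F. bij_betw F (perms n) (perms n) \<and> (\<forall>xs\<in>perms n. card (occs S (F xs)) = card (occs R xs))"
  proof (cases n)
    case 0
    then show ?thesis by (intro exI[of _ id]) (auto simp: perms_0 occs_def)
  next
    case (Suc k)
    have "\<exists>F. bij_betw F (prefixes_of_length n n) (prefixes_of_length n n) \<and>
      (\<forall>xs\<in>prefixes_of_length n n. Sim n xs (F xs))"
    proof (rule coupled_trees[where A = "prefixes_of_length n" and m = "Suc 0" and Sim = "\<lambda>_. Sim n" and
        c = "\<lambda>_ xs v. xs @ [v]" and X = "\<lambda>_ xs. {1..n} - set xs"])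
      have "Sim n [v] [v]" for v
      proof -
        obtain \<theta> where "bij_betw \<theta> (above n [v] v) (above n [v] v)"
          "\<forall>u\<in>above n [v] v. \<forall>w\<in>above n [v] v. u < w \<longleftrightarrow> \<theta> w < \<theta> u"
          using ex_antitone_bij[of "above n [v] v" "above n [v] v"] by auto
        moreover have "prefix_occs T n [v] = {}" for T by (auto simp: prefix_occs_def)
        ultimately show ?thesis unfolding Sim_def
          by (intro conjI exI[of _ 0] exI[of _ \<theta>]) (simp_all add: is_min_def)
      qed
      then have "Sim n xs xs" if "xs \<in> prefixes_of_length n (Suc 0)" for xs
        using that by (auto simp: prefixes_of_length_def length_Suc_conv)
      then show "\<exists>F. bij_betw F (prefixes_of_length n (Suc 0)) (prefixes_of_length n (Suc 0)) \<and>
          (\<forall>s\<in>prefixes_of_length n (Suc 0). Sim n s (F s))"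
        by (intro exI[of _ id]) simp
    qed (use Sim_step bij_betw_append Suc in auto)
    then obtain F where F: "bij_betw F (perms n) (perms n)" "\<And>xs. xs \<in> perms n \<Longrightarrow> Sim n xs (F xs)"
      unfolding prefixes_full by blast
    have "card (occs S (F xs)) = card (occs R xs)" if "xs \<in> perms n" for xs
      using F(2)[OF that] bij_betwE[OF F(1)] that by (simp add: Sim_def prefix_occs_perms)
    with F(1) show ?thesis by blast
  qed
qed

end

section \<open>Unique partners\<close>

lemma occs_iff:
  assumes "length xs = n"
  shows "(i, j) \<in> occs R xs \<longleftrightarrow> i < j \<and> j < n \<and> xs ! i < xs ! j \<and>
    (\<forall>l<i. (mcell (xs ! i) (xs ! j) (xs ! l) = 0 \<longrightarrow> (0, 0) \<notin> R) \<and> (mcell (xs ! i) (xs ! j) (xs ! l) = 1 \<longrightarrow> (0, 1) \<notin> R)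
       \<and> (mcell (xs ! i) (xs ! j) (xs ! l) = 2 \<longrightarrow> (0, 2) \<notin> R)) \<and>
    (\<forall>l<j. i < l \<longrightarrow> (mcell (xs ! i) (xs ! j) (xs ! l) = 0 \<longrightarrow> (1, 0) \<notin> R) \<and> (mcell (xs ! i) (xs ! j) (xs ! l) = 1 \<longrightarrow> (1, 1) \<notin> R)
       \<and> (mcell (xs ! i) (xs ! j) (xs ! l) = 2 \<longrightarrow> (1, 2) \<notin> R)) \<and>
    (\<forall>l<n. j < l \<longrightarrow> (mcell (xs ! i) (xs ! j) (xs ! l) = 0 \<longrightarrow> (2, 0) \<notin> R) \<and> (mcell (xs ! i) (xs ! j) (xs ! l) = 1 \<longrightarrow> (2, 1) \<notin> R)
       \<and> (mcell (xs ! i) (xs ! j) (xs ! l) = 2 \<longrightarrow> (2, 2) \<notin> R))"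
proof (cases "i < j \<and> j < n \<and> xs ! i < xs ! j")
  case ij: True
  let ?v = "\<lambda>l. mcell (xs ! i) (xs ! j) (xs ! l)"
  have v: "?v l = 0 \<or> ?v l = 1 \<or> ?v l = 2" for l by (simp add: mcell_def)
  have P: "((?v l = 0 \<longrightarrow> (x, 0) \<notin> R) \<and> (?v l = 1 \<longrightarrow> (x, 1) \<notin> R) \<and> (?v l = 2 \<longrightarrow> (x, 2) \<notin> R)) \<longleftrightarrow> (x, ?v l) \<notin> R" for x l
    using v[of l] by (elim disjE) simp_all
  have "(\<forall>l<n. l \<noteq> i \<longrightarrow> l \<noteq> j \<longrightarrow> (mcell i j l, ?v l) \<notin> R) \<longleftrightarrow>
    (\<forall>l<i. (0, ?v l) \<notin> R) \<and> (\<forall>l<j. i < l \<longrightarrow> (1, ?v l) \<notin> R) \<and> (\<forall>l<n. j < l \<longrightarrow> (2, ?v l) \<notin> R)"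
    (is "?L \<longleftrightarrow> ?A \<and> ?B \<and> ?C")
  proof
    assume L: ?L
    have "(0, ?v l) \<notin> R" if "l < i" for l
    proof -
      have "mcell i j l = 0" using that by (simp add: mcell_def)
      then show ?thesis using L[rule_format, of l] that ij by simp
    qed
    moreover have "(1, ?v l) \<notin> R" if "l < j" "i < l" for l
    proof -
      have "mcell i j l = 1" using that by (simp add: mcell_def)
      then show ?thesis using L[rule_format, of l] that ij by simp
    qed
    moreover have "(2, ?v l) \<notin> R" if "l < n" "j < l" for l
    proof -
      have "mcell i j l = 2" using that ij by (simp add: mcell_def)
      then show ?thesis using L[rule_format, of l] that ij by simp
    qed
    ultimately show "?A \<and> ?B \<and> ?C" by blast
  next
    assume ABC: "?A \<and> ?B \<and> ?C"
    show ?L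
    proof (intro allI impI)
      fix l assume l: "l < n" "l \<noteq> i" "l \<noteq> j"
      consider "l < i" | "i < l" "l < j" | "j < l" using l by linarith
      then show "(mcell i j l, ?v l) \<notin> R"
      proof cases
        case 1
        then have "mcell i j l = 0" by (simp add: mcell_def)
        then show ?thesis using ABC 1 by simp
      next
        case 2
        then have "mcell i j l = 1" by (simp add: mcell_def)
        then show ?thesis using ABC 2 by simp
      next
        case 3
        then have "mcell i j l = 2" using ij by (simp add: mcell_def)
        then show ?thesis using ABC 3 l by simp
      qed
    qed
  qed
  then show ?thesis using ij assms unfolding P occs_def by simp
qed (use assms in \<open>auto simp: occs_def\<close>)

lemma mcell_eq_iff:
  assumes "a < b"
  shows "mcell a b v = 0 \<longleftrightarrow> v < a" "mcell a b v = 1 \<longleftrightarrow> a \<le> v \<and> v < b" "mcell a b v = 2 \<longleftrightarrow> b \<le> v"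
  using assms by (auto simp: mcell_def)

lemma card_inj_snd:
  fixes A B :: "(nat \<times> nat) set"
  assumes "\<And>i i' j. (i, j) \<in> A \<Longrightarrow> (i', j) \<in> A \<Longrightarrow> i = i'" "\<And>i i' j. (i, j) \<in> B \<Longrightarrow> (i', j) \<in> B \<Longrightarrow> i = i'"
    and "\<And>i j. (i, j) \<in> A \<Longrightarrow> \<exists>k. (k, j) \<in> B" "\<And>i j. (i, j) \<in> B \<Longrightarrow> \<exists>k. (k, j) \<in> A"
  shows "card A = card B"
proof -
  have "inj_on snd A" "inj_on snd B" using assms(1,2) by (auto simp: inj_on_def)
  moreover have "snd ` A = snd ` B" using assms(3,4) by force
  ultimately show ?thesis by (metis card_image)
qed

lemma card_inj_fst:
  fixes A B :: "(nat \<times> nat) set"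
  assumes "\<And>i j j'. (i, j) \<in> A \<Longrightarrow> (i, j') \<in> A \<Longrightarrow> j = j'" "\<And>i j j'. (i, j) \<in> B \<Longrightarrow> (i, j') \<in> B \<Longrightarrow> j = j'"
    and "\<And>i j. (i, j) \<in> A \<Longrightarrow> \<exists>k. (i, k) \<in> B" "\<And>i j. (i, j) \<in> B \<Longrightarrow> \<exists>k. (i, k) \<in> A"
  shows "card A = card B"
proof -
  have "inj_on fst A" "inj_on fst B" using assms(1,2) by (auto simp: inj_on_def)
  moreover have "fst ` A = fst ` B" using assms(3,4) by force
  ultimately show ?thesis by (metis card_image)
qed

text \<open>In the same permutation, a given second entry has at most one partner: for
  \<open>R\<close> the leftmost smaller entry, for \<open>S\<close> the largest smaller entry to its
  left. Either exists as soon as some smaller entry precedes, and cell (2,2) restricts the second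
  entry alone.\<close>

lemma equid_unique_first:
  assumes R: "(0, 0) \<in> R" "(0, 1) \<in> R" "(0, 2) \<notin> R" "(1, 0) \<notin> R" "(1, 1) \<notin> R" "(1, 2) \<notin> R" "(2, 0) \<notin> R" "(2, 1) \<notin> R"
    and S: "(0, 0) \<notin> S" "(0, 1) \<in> S" "(0, 2) \<notin> S" "(1, 0) \<notin> S" "(1, 1) \<in> S" "(1, 2) \<notin> S" "(2, 0) \<notin> S" "(2, 1) \<notin> S"
    and "(2, 2) \<in> S \<longleftrightarrow> (2, 2) \<in> R"
  shows "equid R S"
proof (rule equid_pointwise)
  fix n xs assume xs: "xs \<in> perms n"
  note p = perms_D[OF xs]
  define Q where "Q j \<longleftrightarrow> ((2, 2) \<in> R \<longrightarrow> (\<forall>l<n. j < l \<longrightarrow> xs ! l < xs ! j))" for j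
  have Q: "(\<forall>l<n. j < l \<longrightarrow> xs ! j \<le> xs ! l \<longrightarrow> (2, 2) \<notin> R) \<longleftrightarrow> Q j" for j
    unfolding Q_def by (auto simp: not_le)
  have R_iff: "(i, j) \<in> occs R xs \<longleftrightarrow> i < j \<and> j < n \<and> xs ! i < xs ! j \<and> (\<forall>l<i. xs ! j \<le> xs ! l) \<and> Q j" for i j
  proof (cases "i < j \<and> j < n \<and> xs ! i < xs ! j")
    case True
    then have m: "mcell (xs ! i) (xs ! j) v = 0 \<longleftrightarrow> v < xs ! i" "mcell (xs ! i) (xs ! j) v = 1 \<longleftrightarrow> xs ! i \<le> v \<and> v < xs ! j"
      "mcell (xs ! i) (xs ! j) v = 2 \<longleftrightarrow> xs ! j \<le> v" for v by (simp_all only: mcell_eq_iff)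
    have e: "\<not> v < xs ! i \<and> (xs ! i \<le> v \<longrightarrow> \<not> v < xs ! j) \<longleftrightarrow> xs ! j \<le> v" for v using True by linarith
    show ?thesis unfolding occs_iff[OF p(3)] m Q[symmetric] e[symmetric] using True R by simp
  qed (auto simp: occs_def p)
  have S_iff: "(i, j) \<in> occs S xs \<longleftrightarrow> i < j \<and> j < n \<and> xs ! i < xs ! j \<and>
      (\<forall>l<j. l \<noteq> i \<longrightarrow> xs ! l < xs ! i \<or> xs ! j \<le> xs ! l) \<and> Q j" for i j
  proof (cases "i < j \<and> j < n \<and> xs ! i < xs ! j")
    case True
    then have m: "mcell (xs ! i) (xs ! j) v = 0 \<longleftrightarrow> v < xs ! i" "mcell (xs ! i) (xs ! j) v = 1 \<longleftrightarrow> xs ! i \<le> v \<and> v < xs ! j"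
      "mcell (xs ! i) (xs ! j) v = 2 \<longleftrightarrow> xs ! j \<le> v" for v by (simp_all only: mcell_eq_iff)
    have e: "xs ! i \<le> v \<longrightarrow> \<not> v < xs ! j \<longleftrightarrow> v < xs ! i \<or> xs ! j \<le> v" for v using True by linarith
    have split: "(\<forall>l<j. l \<noteq> i \<longrightarrow> F l) \<longleftrightarrow> (\<forall>l<i. F l) \<and> (\<forall>l<j. i < l \<longrightarrow> F l)" for F
      using True by (metis less_trans linorder_neqE_nat nat_neq_iff)
    show ?thesis unfolding occs_iff[OF p(3)] m Q[symmetric] split using True S assms(17)
      by (auto simp: not_less not_le)
  qed (auto simp: occs_def p)
  show "card (occs S xs) = card (occs R xs)"
  proof (rule card_inj_snd)
    show "i = i'" if "(i, j) \<in> occs S xs" "(i', j) \<in> occs S xs" for i i' j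
    proof (rule ccontr)
      assume "i \<noteq> i'"
      with that show False unfolding S_iff by (metis less_asym not_less)
    qed
    show "i = i'" if "(i, j) \<in> occs R xs" "(i', j) \<in> occs R xs" for i i' j
      using that unfolding R_iff by (metis linorder_neqE_nat not_less)
    show "\<exists>k. (k, j) \<in> occs R xs" if "(i, j) \<in> occs S xs" for i j
    proof -
      have ij: "i < j" "j < n" "xs ! i < xs ! j" "Q j" using that unfolding S_iff by auto
      \<comment> \<open>For any position below \<open>xs ! j\<close>, the least such position has
        only larger values than \<open>xs ! j\<close> on its left.\<close>
      define k where "k = (LEAST k. xs ! k < xs ! j)"
      have "xs ! k < xs ! j" "k \<le> i" unfolding k_def using ij(3) by (rule LeastI, rule Least_le)
      moreover have "xs ! j \<le> xs ! l" if "l < k" for l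
        using not_less_Least[of l "\<lambda>k. xs ! k < xs ! j"] that unfolding k_def by simp
      ultimately have "(k, j) \<in> occs R xs" unfolding R_iff using ij by simp
      then show ?thesis ..
    qed
    show "\<exists>k. (k, j) \<in> occs S xs" if "(i, j) \<in> occs R xs" for i j
    proof -
      have ij: "i < j" "j < n" "xs ! i < xs ! j" "Q j" using that unfolding R_iff by auto
      let ?P = "\<lambda>k. k < j \<and> xs ! k < xs ! j"
      have "\<exists>k. ?P k \<and> (\<forall>l. ?P l \<longrightarrow> xs ! l \<le> xs ! k)"
        by (rule ex_has_greatest_nat[of ?P i _ "xs ! j"]) (use ij in auto)
      then obtain k where k: "?P k" "\<And>l. ?P l \<Longrightarrow> xs ! l \<le> xs ! k" by blast
      have "xs ! l < xs ! k \<or> xs ! j \<le> xs ! l" if "l < j" "l \<noteq> k" for l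
        using k(2)[of l] that p(5)[of l k] k(1) ij(2) by (cases "xs ! l < xs ! j") auto
      then have "(k, j) \<in> occs S xs" unfolding S_iff using k(1) ij by simp
      then show ?thesis ..
    qed
  qed
qed

text \<open>Now the first entry determines its partner: for \<open>R\<close> the next larger entry,
  for \<open>S\<close> the largest entry to its right. Either exists as soon as some larger entry
  follows. Row 0 is shaded alike in both, and its conditions, like those on column 0, concern the
  first entry alone.\<close>

lemma equid_unique_second:
  assumes R: "(0, 1) \<in> R" "(0, 2) \<in> R" "(1, 1) \<in> R" "(1, 2) \<in> R" "(2, 1) \<notin> R" "(2, 2) \<notin> R"
    and S: "(0, 1) \<in> S" "(0, 2) \<in> S" "(1, 1) \<notin> S" "(1, 2) \<in> S" "(2, 1) \<notin> S" "(2, 2) \<in> S"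
    and eq: "(0, 0) \<in> S \<longleftrightarrow> (0, 0) \<in> R" "(1, 0) \<in> S \<longleftrightarrow> (1, 0) \<in> R" "(2, 0) \<in> S \<longleftrightarrow> (1, 0) \<in> R" "(2, 0) \<in> R \<longleftrightarrow> (1, 0) \<in> R"
  shows "equid R S"
proof (rule equid_pointwise)
  fix n xs assume xs: "xs \<in> perms n"
  note p = perms_D[OF xs]
  \<comment> \<open>The conditions on the first entry: it is a left-to-right maximum, even at the
    first position if (0,0) is shaded, and if (1,0) is shaded, all later entries exceed it.\<close>
  define P where "P i \<longleftrightarrow> (\<forall>l<i. xs ! l < xs ! i \<and> (0, 0) \<notin> R) \<and> ((1, 0) \<in> R \<longrightarrow> (\<forall>l<n. i < l \<longrightarrow> xs ! i < xs ! l))" for i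
  have ne: "xs ! i \<le> xs ! l \<longleftrightarrow> xs ! i < xs ! l" if "l < n" "i < n" "l \<noteq> i" for l i
    using p(5)[OF that(1,2)] that(3) by auto
  have R_iff: "(i, j) \<in> occs R xs \<longleftrightarrow> i < j \<and> j < n \<and> xs ! i < xs ! j \<and> P i \<and> (\<forall>l<j. i < l \<longrightarrow> xs ! l < xs ! i)"
    (is "_ \<longleftrightarrow> ?r") for i j
  proof (cases "i < j \<and> j < n \<and> xs ! i < xs ! j")
    case True
    then have m: "mcell (xs ! i) (xs ! j) v = 0 \<longleftrightarrow> v < xs ! i" "mcell (xs ! i) (xs ! j) v = 1 \<longleftrightarrow> xs ! i \<le> v \<and> v < xs ! j"
      "mcell (xs ! i) (xs ! j) v = 2 \<longleftrightarrow> xs ! j \<le> v" for v by (simp_all only: mcell_eq_iff)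
    have "(i, j) \<in> occs R xs \<longleftrightarrow> (\<forall>l<i. xs ! l < xs ! i \<and> (0, 0) \<notin> R) \<and>
        (\<forall>l<j. i < l \<longrightarrow> xs ! l < xs ! i \<and> (1, 0) \<notin> R) \<and> ((1, 0) \<in> R \<longrightarrow> (\<forall>l<n. j < l \<longrightarrow> xs ! i \<le> xs ! l))"
      unfolding occs_iff[OF p(3)] m using True R eq by (simp add: not_less[symmetric]) (meson leD leI order.strict_trans)
    also have "\<dots> \<longleftrightarrow> P i \<and> (\<forall>l<j. i < l \<longrightarrow> xs ! l < xs ! i)"
      unfolding P_def using True ne
      by (cases "(1, 0) \<in> R") (auto, (metis less_asym less_trans linorder_neqE_nat nat_neq_iff)+)
    finally show ?thesis using True by simp
  qed (auto simp: occs_def p)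
  have S_iff: "(i, j) \<in> occs S xs \<longleftrightarrow> i < j \<and> j < n \<and> xs ! i < xs ! j \<and> P i \<and> (\<forall>l<n. i < l \<and> l \<noteq> j \<longrightarrow> xs ! l < xs ! j)"
    for i j
  proof (cases "i < j \<and> j < n \<and> xs ! i < xs ! j")
    case True
    then have m: "mcell (xs ! i) (xs ! j) v = 0 \<longleftrightarrow> v < xs ! i" "mcell (xs ! i) (xs ! j) v = 1 \<longleftrightarrow> xs ! i \<le> v \<and> v < xs ! j"
      "mcell (xs ! i) (xs ! j) v = 2 \<longleftrightarrow> xs ! j \<le> v" for v by (simp_all only: mcell_eq_iff)
    have "(i, j) \<in> occs S xs \<longleftrightarrow> (\<forall>l<i. xs ! l < xs ! i \<and> (0, 0) \<notin> R) \<and>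
        (\<forall>l<j. i < l \<longrightarrow> xs ! l < xs ! j \<and> ((1, 0) \<in> R \<longrightarrow> xs ! i \<le> xs ! l)) \<and>
        (\<forall>l<n. j < l \<longrightarrow> xs ! l < xs ! j \<and> ((1, 0) \<in> R \<longrightarrow> xs ! i \<le> xs ! l))"
      unfolding occs_iff[OF p(3)] m using True S eq by (simp add: not_less[symmetric]) (meson leD leI order.strict_trans)
    also have "\<dots> \<longleftrightarrow> P i \<and> (\<forall>l<n. i < l \<and> l \<noteq> j \<longrightarrow> xs ! l < xs ! j)"
      unfolding P_def using True ne
      by (cases "(1, 0) \<in> R") (auto, (metis less_asym less_trans linorder_neqE_nat nat_neq_iff)+)
    finally show ?thesis using True by simp
  qed (auto simp: occs_def p)
  show "card (occs S xs) = card (occs R xs)"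
  proof (rule card_inj_fst)
    show "j = j'" if "(i, j) \<in> occs S xs" "(i, j') \<in> occs S xs" for i j j'
      using that unfolding S_iff by (metis less_asym)
    show "j = j'" if "(i, j) \<in> occs R xs" "(i, j') \<in> occs R xs" for i j j'
      using that unfolding R_iff by (metis less_asym linorder_neqE_nat)
    show "\<exists>k. (i, k) \<in> occs R xs" if "(i, j) \<in> occs S xs" for i j
    proof -
      have ij: "i < j" "j < n" "xs ! i < xs ! j" "P i" using that unfolding S_iff by auto
      let ?Q = "\<lambda>k. i < k \<and> xs ! i < xs ! k"
      define k where "k = (LEAST k. ?Q k)"
      have q: "?Q j" using ij by simp
      have "?Q k" "k \<le> j" unfolding k_def by (rule LeastI[of ?Q, OF q], rule Least_le[of ?Q, OF q])
      moreover have "xs ! l < xs ! i" if "l < k" "i < l" for l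
        using not_less_Least[of l ?Q] that ne[of l i] \<open>k \<le> j\<close> ij unfolding k_def[symmetric] by auto
      ultimately have "(i, k) \<in> occs R xs" unfolding R_iff using ij by simp
      then show ?thesis ..
    qed
    show "\<exists>k. (i, k) \<in> occs S xs" if "(i, j) \<in> occs R xs" for i j
    proof -
      have ij: "i < j" "j < n" "xs ! i < xs ! j" "P i" using that unfolding R_iff by auto
      let ?Q = "\<lambda>k. k < n \<and> i < k"
      have "\<exists>k. ?Q k \<and> (\<forall>l. ?Q l \<longrightarrow> xs ! l \<le> xs ! k)"
        by (rule ex_has_greatest_nat[of ?Q j _ "Suc n"]) (use ij p(4) in \<open>auto simp: less_Suc_eq_le\<close>)
      then obtain k where k: "?Q k" "\<And>l. ?Q l \<Longrightarrow> xs ! l \<le> xs ! k" by blast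
      have "xs ! l < xs ! k" if "l < n" "i < l" "l \<noteq> k" for l
        using k(2)[of l] that p(5)[of l k] k(1) by (auto simp: le_neq_implies_less)
      moreover have "xs ! i < xs ! k" using k(2)[of j] ij by simp
      ultimately have "(i, k) \<in> occs S xs" unfolding S_iff using k(1) ij by simp
      then show ?thesis ..
    qed
  qed
qed

section \<open>Exchanging the outer columns\<close>

text \<open>The pattern \<open>corner True\<close> is obtained from \<open>corner False\<close> by exchanging the outer columns.\<close>

definition corner :: "bool \<Rightarrow> (nat \<times> nat) set" where
  "corner b = {(0, 2), (1, 0), (1, 1), (2, 2), if b then (2, 0) else (0, 0)}"

text \<open>\<open>d\<close> is the distance of the two entries and \<open>c\<close> the number of
  entries behind them. Both outer blocks stay below the second entry; \<open>b\<close> tells which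
  of them must also stay above the first.\<close>

definition corner_at :: "bool \<Rightarrow> nat list \<Rightarrow> nat \<Rightarrow> nat \<Rightarrow> nat \<Rightarrow> bool" where
  "corner_at b xs i d c \<longleftrightarrow> 0 < d \<and> xs ! i < xs ! (i + d) \<and>
     (\<forall>l<i. xs ! l < xs ! (i + d) \<and> (\<not> b \<longrightarrow> xs ! i < xs ! l)) \<and>
     (\<forall>e. 0 < e \<and> e < d \<longrightarrow> xs ! (i + d) < xs ! (i + e)) \<and>
     (\<forall>l<c. xs ! (i + d + 1 + l) < xs ! (i + d) \<and> (b \<longrightarrow> xs ! i < xs ! (i + d + 1 + l)))"

lemma corner_occs:
  assumes xs: "xs \<in> perms n" and n: "n = i + d + 1 + c"
  shows "(i, i + d) \<in> occs (corner b) xs \<longleftrightarrow> corner_at b xs i d c"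
proof (cases "0 < d \<and> xs ! i < xs ! (i + d)")
  case True
  note p = perms_D[OF xs]
  let ?j = "i + d"
  have m: "mcell (xs ! i) (xs ! ?j) v = 0 \<longleftrightarrow> v < xs ! i" "mcell (xs ! i) (xs ! ?j) v = 1 \<longleftrightarrow> xs ! i \<le> v \<and> v < xs ! ?j"
    "mcell (xs ! i) (xs ! ?j) v = 2 \<longleftrightarrow> xs ! ?j \<le> v" for v using True by (simp_all only: mcell_eq_iff)
  have ne: "xs ! l \<noteq> xs ! i" "xs ! l \<noteq> xs ! ?j" if "l < n" "l \<noteq> i" "l \<noteq> ?j" for l
    using p(5)[of l i] p(5)[of l ?j] that n by auto
  have col0: "(\<forall>l<i. (xs ! l < xs ! i \<longrightarrow> b) \<and> \<not> xs ! ?j \<le> xs ! l) \<longleftrightarrow>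
      (\<forall>l<i. xs ! l < xs ! ?j \<and> (\<not> b \<longrightarrow> xs ! i < xs ! l))"
  proof (intro all_cong1 imp_cong refl)
    fix l assume "l < i"
    then show "(xs ! l < xs ! i \<longrightarrow> b) \<and> \<not> xs ! ?j \<le> xs ! l \<longleftrightarrow> xs ! l < xs ! ?j \<and> (\<not> b \<longrightarrow> xs ! i < xs ! l)"
      using ne[of l] n by auto
  qed
  have col1: "(\<forall>l<?j. i < l \<longrightarrow> \<not> xs ! l < xs ! i \<and> (xs ! i \<le> xs ! l \<longrightarrow> \<not> xs ! l < xs ! ?j)) \<longleftrightarrow>
      (\<forall>e. 0 < e \<and> e < d \<longrightarrow> xs ! ?j < xs ! (i + e))" (is "?L \<longleftrightarrow> ?R")
  proof
    assume L: ?L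
    show ?R
    proof (intro allI impI)
      fix e assume "0 < e \<and> e < d"
      then show "xs ! ?j < xs ! (i + e)" using L[rule_format, of "i + e"] ne[of "i + e"] n by auto
    qed
  next
    assume R: ?R
    show ?L
    proof (intro allI impI)
      fix l assume l: "l < ?j" "i < l"
      then have "xs ! ?j < xs ! l" using R[rule_format, of "l - i"] by auto
      then show "\<not> xs ! l < xs ! i \<and> (xs ! i \<le> xs ! l \<longrightarrow> \<not> xs ! l < xs ! ?j)" using True by auto
    qed
  qed
  have col2: "(\<forall>l<n. ?j < l \<longrightarrow> (xs ! l < xs ! i \<longrightarrow> \<not> b) \<and> \<not> xs ! ?j \<le> xs ! l) \<longleftrightarrow>
      (\<forall>l<c. xs ! (?j + 1 + l) < xs ! ?j \<and> (b \<longrightarrow> xs ! i < xs ! (?j + 1 + l)))" (is "?L \<longleftrightarrow> ?R")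
  proof
    assume L: ?L
    show ?R
    proof (intro allI impI)
      fix l assume "l < c"
      then show "xs ! (?j + 1 + l) < xs ! ?j \<and> (b \<longrightarrow> xs ! i < xs ! (?j + 1 + l))"
        using L[rule_format, of "?j + 1 + l"] ne[of "?j + 1 + l"] n by auto
    qed
  next
    assume R: ?R
    show ?L
    proof (intro allI impI)
      fix l assume l: "l < n" "?j < l"
      then have "?j + 1 + (l - (?j + 1)) = l" "l - (?j + 1) < c" using n by auto
      then show "(xs ! l < xs ! i \<longrightarrow> \<not> b) \<and> \<not> xs ! ?j \<le> xs ! l" using R[rule_format, of "l - (?j + 1)"] by auto
    qed
  qed
  have "(i, ?j) \<in> occs (corner b) xs \<longleftrightarrow>
      (\<forall>l<i. (xs ! l < xs ! i \<longrightarrow> b) \<and> \<not> xs ! ?j \<le> xs ! l) \<and>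
      (\<forall>l<?j. i < l \<longrightarrow> \<not> xs ! l < xs ! i \<and> (xs ! i \<le> xs ! l \<longrightarrow> \<not> xs ! l < xs ! ?j)) \<and>
      (\<forall>l<n. ?j < l \<longrightarrow> (xs ! l < xs ! i \<longrightarrow> \<not> b) \<and> \<not> xs ! ?j \<le> xs ! l)"
    unfolding occs_iff[OF p(3)] m corner_def using True n by (cases b) simp_all
  then show ?thesis unfolding col0 col1 col2 corner_at_def using True by simp
qed (auto simp: occs_def corner_at_def)

lemma corner_occsE:
  assumes "xs \<in> perms n" "(i, j) \<in> occs (corner b) xs"
  obtains d c where "j = i + d" "n = i + d + 1 + c" "corner_at b xs i d c"
proof -
  have "i < j" "j < n" using assms perms_D(3) by (auto simp: occs_def)
  then obtain d c where dc: "j = i + d" "n = i + d + 1 + c"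
    by (metis less_imp_add_positive add.assoc add.commute Suc_eq_plus1 less_iff_Suc_add)
  with assms(2) corner_occs[OF assms(1) dc(2)] that show thesis by simp
qed

text \<open>Let the second occurrence start later. If it starts strictly inside the first, its first
  entry exceeds \<open>xs ! j\<close>; but it is below \<open>xs ! i\<close> by the shaded (0,0), or
  below \<open>xs ! j\<close> by the position of \<open>j\<close> in the second occurrence. If it
  starts at \<open>j\<close> or later, its second entry is right of \<open>j\<close> and hence below
  \<open>xs ! j\<close>, whereas it has to exceed \<open>xs ! j\<close>.\<close>

lemma corner_first_le:
  assumes xs: "xs \<in> perms n" and "(i, j) \<in> occs (corner b) xs" "(i', j') \<in> occs (corner b) xs"
  shows "\<not> i < i'"
proof
  assume lt: "i < i'"
  obtain d c where d: "j = i + d" "n = i + d + 1 + c" and A: "corner_at b xs i d c"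
    using corner_occsE[OF xs assms(2)] .
  obtain d' c' where d': "j' = i' + d'" "n = i' + d' + 1 + c'" and A': "corner_at b xs i' d' c'"
    using corner_occsE[OF xs assms(3)] .
  have pos: "0 < d" "0 < d'" "xs ! i < xs ! j" "xs ! i' < xs ! j'" using A A' d d' by (auto simp: corner_at_def)
  have left': "xs ! l < xs ! j' \<and> (\<not> b \<longrightarrow> xs ! i' < xs ! l)" if "l < i'" for l
    using A' d'(1) that by (auto simp: corner_at_def)
  have mid: "xs ! j < xs ! l" if "i < l" "l < j" for l
  proof -
    have "0 < l - i \<and> l - i < d" using that d by auto
    moreover have "\<forall>e. 0 < e \<and> e < d \<longrightarrow> xs ! (i + d) < xs ! (i + e)" using A unfolding corner_at_def by blast
    ultimately have "xs ! (i + d) < xs ! (i + (l - i))" by blast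
    then show ?thesis using that d by simp
  qed
  have right: "xs ! l < xs ! j \<and> (b \<longrightarrow> xs ! i < xs ! l)" if "j < l" "l < n" for l
  proof -
    have "j + 1 + (l - (j + 1)) = l" "l - (j + 1) < c" using that d by auto
    then show ?thesis using A d unfolding corner_at_def by metis
  qed
  have right': "xs ! l < xs ! j' \<and> (b \<longrightarrow> xs ! i' < xs ! l)" if "j' < l" "l < n" for l
  proof -
    have "j' + 1 + (l - (j' + 1)) = l" "l - (j' + 1) < c'" using that d' by auto
    then show ?thesis using A' d' unfolding corner_at_def by metis
  qed
  have mid': "xs ! j' < xs ! l" if "i' < l" "l < j'" for l
  proof -
    have "0 < l - i' \<and> l - i' < d'" using that d' by auto
    moreover have "\<forall>e. 0 < e \<and> e < d' \<longrightarrow> xs ! (i' + d') < xs ! (i' + e)" using A' unfolding corner_at_def by blast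
    ultimately have "xs ! (i' + d') < xs ! (i' + (l - i'))" by blast
    then show ?thesis using that d' by simp
  qed
  have jn: "j < n" "j' < n" "i' < j'" using d d' pos by auto
  consider "i' < j" | "i' = j" | "j < i'" by linarith
  then show False
  proof cases
    case 1
    have "xs ! j < xs ! i'" using mid[OF lt 1] .
    moreover have "xs ! i' < xs ! j" if b
    proof -
      consider "j < j'" | "j = j'" | "j' < j" by linarith
      then show ?thesis
      proof cases
        case 1
        then show ?thesis using mid'[of j] pos(4) \<open>i' < j\<close> by simp
      next
        case 2
        then show ?thesis using pos(4) by simp
      next
        case 3
        then show ?thesis using right'[of j] jn that by simp
      qed
    qed
    moreover have "xs ! i' < xs ! i" if "\<not> b" using left'[OF lt] that by simp
    ultimately show False using pos(3) by (cases b) auto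
  next
    case 2
    then have "xs ! j' < xs ! j" using right[of j'] jn by simp
    then show False using 2 pos(4) by simp
  next
    case 3
    then have "xs ! j < xs ! j'" using left' by simp
    moreover have "xs ! j' < xs ! j" using right[of j'] jn 3 by simp
    ultimately show False by simp
  qed
qed

text \<open>All occurrences share their first entry, so they are ordered by the second one. The number of those
  up to a given one is visible between its two entries, hence not affected by \<open>exchange_ends\<close>.\<close>

definition corner_rank :: "nat list \<Rightarrow> nat \<Rightarrow> nat \<Rightarrow> nat" where
  "corner_rank xs i d = card {e. 0 < e \<and> e \<le> d \<and> (\<forall>f. 0 < f \<and> f < e \<longrightarrow> xs ! (i + e) < xs ! (i + f)) \<and>
     (\<forall>f. e < f \<and> f \<le> d \<longrightarrow> xs ! (i + f) < xs ! (i + e))}"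

text \<open>All occurrences start at \<open>i\<close>. For an end \<open>i + e\<close> not beyond
  \<open>i + d\<close>, the outer blocks satisfy their conditions automatically, being below
  \<open>xs ! (i + d)\<close>, which is at most \<open>xs ! (i + e)\<close>. What remains is a
  condition on the entries between.\<close>

lemma corner_rank_eq:
  assumes xs: "xs \<in> perms n" and n: "n = i + d + 1 + c" and A: "corner_at b xs i d c"
  shows "card {j. j \<le> i + d \<and> (\<exists>k. (k, j) \<in> occs (corner b) xs)} = corner_rank xs i d"
proof -
  have "(i, i + d) \<in> occs (corner b) xs" using corner_occs[OF xs n] A by simp
  then have same: "k = i" if "(k, j) \<in> occs (corner b) xs" for k j
    using corner_first_le[OF xs] that by (metis linorder_neqE_nat)
  define M where "M e \<longleftrightarrow> (\<forall>f. 0 < f \<and> f < e \<longrightarrow> xs ! (i + e) < xs ! (i + f)) \<and>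
     (\<forall>f. e < f \<and> f \<le> d \<longrightarrow> xs ! (i + f) < xs ! (i + e))" for e
  have e: "(i, i + e) \<in> occs (corner b) xs \<longleftrightarrow> M e" if e: "0 < e" "e \<le> d" for e
  proof -
    \<comment> \<open>Seen from the end \<open>i + e\<close>, the right block also contains the d -
      e entries up to \<open>i + d\<close>.\<close>
    have n': "n = i + e + 1 + (d - e + c)" using n e by simp
    have ge: "xs ! (i + d) \<le> xs ! (i + e)"
      using A e unfolding corner_at_def by (cases "e = d") auto
    show ?thesis unfolding corner_occs[OF xs n']
    proof
      assume C: "corner_at b xs i e (d - e + c)"
      have "xs ! (i + f) < xs ! (i + e)" if "e < f" "f \<le> d" for f
      proof -
        have "i + e + 1 + (f - (e + 1)) = i + f" "f - (e + 1) < d - e + c" using that by auto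
        then show ?thesis using C unfolding corner_at_def by metis
      qed
      then show "M e" using C unfolding corner_at_def M_def by blast
    next
      assume M: "M e"
      show "corner_at b xs i e (d - e + c)"
        unfolding corner_at_def
      proof (intro conjI allI impI)
        show "xs ! i < xs ! (i + e)" using A ge unfolding corner_at_def by auto
        show "xs ! l < xs ! (i + e)" if "l < i" for l using A ge that unfolding corner_at_def by fastforce
        show "xs ! i < xs ! l" if "l < i" "\<not> b" for l using A that unfolding corner_at_def by blast
        fix l assume l: "l < d - e + c"
        have "xs ! (i + e + 1 + l) < xs ! (i + e) \<and> (b \<longrightarrow> xs ! i < xs ! (i + e + 1 + l))"
        proof (cases "e + 1 + l \<le> d")
          case True
          then have "xs ! (i + (e + 1 + l)) < xs ! (i + e)" using M[unfolded M_def, THEN conjunct2, rule_format, of "e + 1 + l"] by simp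
          moreover have "xs ! i < xs ! (i + (e + 1 + l))"
            using A True unfolding corner_at_def
            by (cases "e + 1 + l = d") (auto, metis add.assoc add_Suc_right le_neq_implies_less less_trans zero_less_Suc)
          ultimately show ?thesis by (simp add: add.assoc)
        next
          case False
          then have "i + e + 1 + l = i + d + 1 + (e + l - d)" "e + l - d < c" using l e by auto
          moreover have "\<forall>l<c. xs ! (i + d + 1 + l) < xs ! (i + d) \<and> (b \<longrightarrow> xs ! i < xs ! (i + d + 1 + l))"
            using A unfolding corner_at_def by blast
          ultimately have "xs ! (i + e + 1 + l) < xs ! (i + d) \<and> (b \<longrightarrow> xs ! i < xs ! (i + e + 1 + l))" by metis
          then show ?thesis using ge by simp
        qed
        then show "xs ! (i + e + 1 + l) < xs ! (i + e)" "b \<Longrightarrow> xs ! i < xs ! (i + e + 1 + l)" by auto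
      qed (use M e in \<open>auto simp: M_def\<close>)
    qed
  qed
  have "{j. j \<le> i + d \<and> (\<exists>k. (k, j) \<in> occs (corner b) xs)} = (\<lambda>e. i + e) ` {e. 0 < e \<and> e \<le> d \<and> M e}"
  proof (intro equalityI subsetI)
    fix j assume "j \<in> {j. j \<le> i + d \<and> (\<exists>k. (k, j) \<in> occs (corner b) xs)}"
    then have j: "j \<le> i + d" "(i, j) \<in> occs (corner b) xs" using same by blast+
    then have "i < j" by (simp add: occs_def)
    then have "j = i + (j - i)" "0 < j - i" "j - i \<le> d" using j(1) by auto
    then show "j \<in> (\<lambda>e. i + e) ` {e. 0 < e \<and> e \<le> d \<and> M e}" using e[of "j - i"] j(2) by (metis (mono_tags, lifting) imageI mem_Collect_eq)
  qed (use e in auto)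
  then show ?thesis unfolding corner_rank_def M_def by (simp add: card_image)
qed

definition exchange_ends :: "nat list \<Rightarrow> nat \<Rightarrow> nat \<Rightarrow> nat list" where
  "exchange_ends xs i d = drop (i + d + 1) xs @ take (d + 1) (drop i xs) @ take i xs"

lemma exchange_ends_nth:
  assumes "length xs = i + d + 1 + c"
  shows "l < c \<Longrightarrow> exchange_ends xs i d ! l = xs ! (i + d + 1 + l)"
    "e \<le> d \<Longrightarrow> exchange_ends xs i d ! (c + e) = xs ! (i + e)"
    "l < i \<Longrightarrow> exchange_ends xs i d ! (c + d + 1 + l) = xs ! l"
    "length (exchange_ends xs i d) = c + d + 1 + i"
  using assms by (auto simp: exchange_ends_def nth_append)

lemma exchange_ends_perms:
  assumes "xs \<in> perms n"
  shows "exchange_ends xs i d \<in> perms n"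
proof -
  have s: "xs = take i xs @ take (d + 1) (drop i xs) @ drop (i + d + 1) xs"
    by (metis append_take_drop_id drop_drop add.assoc add.commute)
  have "mset (exchange_ends xs i d) = mset (take i xs @ take (d + 1) (drop i xs) @ drop (i + d + 1) xs)"
    by (simp add: exchange_ends_def)
  then have "mset (exchange_ends xs i d) = mset xs" by (simp only: s[symmetric])
  then show ?thesis using assms by (metis perms_iff mset_eq_imp_distinct_iff mset_eq_setD)
qed

text \<open>After the exchange the marked occurrence starts at \<open>c\<close>, the old length of
  the right block, and its distance \<open>d\<close> is unchanged; so \<open>c\<close>,
  \<open>d\<close> are the parameters of the inverse.\<close>

lemma exchange_ends_exchange_ends:
  assumes "length xs = i + d + 1 + c"
  shows "exchange_ends (exchange_ends xs i d) c d = xs"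
proof -
  have "length (drop (i + d + 1) xs) = c" "length (take (d + 1) (drop i xs)) = d + 1" using assms by auto
  then have "exchange_ends (exchange_ends xs i d) c d = take i xs @ take (d + 1) (drop i xs) @ drop (i + d + 1) xs"
    by (simp add: exchange_ends_def)
  then show ?thesis by (metis append_take_drop_id drop_drop add.assoc add.commute)
qed

text \<open>Each condition on an outer block compares single entries with the two marked values,
  which do not change. So it travels with its block, and the extra condition changes sides.\<close>

lemma corner_at_exchange_ends:
  assumes "length xs = i + d + 1 + c" and A: "corner_at b xs i d c"
  shows "corner_at (\<not> b) (exchange_ends xs i d) c d i"
    and "corner_rank (exchange_ends xs i d) c d = corner_rank xs i d"
proof -
  note n = exchange_ends_nth[OF assms(1)]
  have n0: "exchange_ends xs i d ! c = xs ! i" using n(2)[of 0] by simp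
  have n3: "exchange_ends xs i d ! Suc (c + d + l) = xs ! l" if "l < i" for l using n(3)[OF that] by simp
  show "corner_at (\<not> b) (exchange_ends xs i d) c d i"
    using A unfolding corner_at_def by (simp add: n n0 n3)
  show "corner_rank (exchange_ends xs i d) c d = corner_rank xs i d"
    unfolding corner_rank_def by (rule arg_cong[where f = card]) (auto simp: n)
qed

section \<open>Permutations marked by an occurrence of given rank\<close>

definition corner_marks :: "bool \<Rightarrow> nat \<Rightarrow> nat \<Rightarrow> (nat list \<times> nat \<times> nat) set" where
  "corner_marks b n k = {(xs, i, d). xs \<in> perms n \<and> i + d < n \<and> corner_at b xs i d (n - (i + d + 1)) \<and> corner_rank xs i d = k}"

text \<open>As \<open>b\<close> is arbitrary, an injection is enough to get equality. It is
  injective because \<open>n\<close> and the image determine the length of the outer blocks, hence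
  the inverse exchange.\<close>

lemma card_corner_marks_le: "card (corner_marks b n k) \<le> card (corner_marks (\<not> b) n k)"
proof (rule card_inj_on_le)
  let ?f = "\<lambda>(xs, i, d). (exchange_ends xs i d, n - (i + d + 1), d)"
  show "inj_on ?f (corner_marks b n k)"
  proof (rule inj_onI)
    fix x y assume xy: "x \<in> corner_marks b n k" "y \<in> corner_marks b n k" "?f x = ?f y"
    obtain xs i d ys i' d' where e: "x = (xs, i, d)" "y = (ys, i', d')" by (cases x; cases y) auto
    have a: "exchange_ends xs i d = exchange_ends ys i' d'" "n - (i + d + 1) = n - (i' + d' + 1)" "d = d'"
      "xs \<in> perms n" "ys \<in> perms n" "i + d < n" "i' + d' < n"
      using xy by (auto simp: e corner_marks_def)
    have "length xs = i + d + 1 + (n - (i + d + 1))" "length ys = i' + d' + 1 + (n - (i' + d' + 1))"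
      using a perms_D(3) by simp_all
    then have "xs = ys" using exchange_ends_exchange_ends a(1-3) by metis
    moreover have "i = i'" using a by simp
    ultimately show "x = y" using a e by simp
  qed
  show "?f ` corner_marks b n k \<subseteq> corner_marks (\<not> b) n k"
  proof
    fix y assume "y \<in> ?f ` corner_marks b n k"
    then obtain xs i d where y: "y = (exchange_ends xs i d, n - (i + d + 1), d)"
      and a: "xs \<in> perms n" "i + d < n" "corner_at b xs i d (n - (i + d + 1))" "corner_rank xs i d = k"
      by (auto simp: corner_marks_def)
    have l: "length xs = i + d + 1 + (n - (i + d + 1))" using a perms_D(3)[OF a(1)] by simp
    have "n - (n - (i + d + 1) + d + 1) = i" "n - (i + d + 1) + d < n" using a by auto
    then show "y \<in> corner_marks (\<not> b) n k"
      using corner_at_exchange_ends[OF l a(3)] exchange_ends_perms[OF a(1)] a(4)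
      unfolding y corner_marks_def by simp
  qed
  show "finite (corner_marks (\<not> b) n k)"
    by (rule finite_subset[of _ "perms n \<times> {..<n} \<times> {..<n}"]) (auto simp: corner_marks_def perms_def)
qed

lemma unique_rank:
  fixes J :: "nat set"
  assumes "finite J" "j \<in> J" "j' \<in> J" "card {x \<in> J. x \<le> j} = card {x \<in> J. x \<le> j'}"
  shows "j = j'"
proof -
  have "\<not> a < b" if "a \<in> J" "b \<in> J" "card {x \<in> J. x \<le> a} = card {x \<in> J. x \<le> b}" for a b
  proof
    assume "a < b"
    then have "{x \<in> J. x \<le> a} \<subseteq> {x \<in> J. x \<le> b}" "b \<in> {x \<in> J. x \<le> b}" "b \<notin> {x \<in> J. x \<le> a}"
      using that by auto
    then have "{x \<in> J. x \<le> a} \<subset> {x \<in> J. x \<le> b}" by blast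
    then have "card {x \<in> J. x \<le> a} < card {x \<in> J. x \<le> b}" using assms(1) by (intro psubset_card_mono) auto
    then show False using that by simp
  qed
  then show ?thesis using assms by (metis linorder_neqE_nat)
qed

lemma ex_rank:
  fixes J :: "nat set"
  assumes "finite J" "1 \<le> k" "k \<le> card J"
  shows "\<exists>j\<in>J. card {x \<in> J. x \<le> j} = k"
proof -
  let ?r = "\<lambda>j. card {x \<in> J. x \<le> j}"
  have "inj_on ?r J" using unique_rank[OF assms(1)] by (auto simp: inj_on_def)
  then have "card (?r ` J) = card J" by (rule card_image)
  moreover have "?r ` J \<subseteq> {1..card J}"
  proof
    fix r assume "r \<in> ?r ` J"
    then obtain j where j: "j \<in> J" "r = ?r j" by auto
    have "{x \<in> J. x \<le> j} \<noteq> {}" using j by auto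
    then have "0 < r" using j assms(1) by (simp add: card_gt_0_iff)
    moreover have "r \<le> card J" unfolding j(2) using assms(1) by (intro card_mono) auto
    ultimately show "r \<in> {1..card J}" by simp
  qed
  ultimately have "?r ` J = {1..card J}" by (intro card_subset_eq) auto
  then show ?thesis using assms by (metis (no_types, lifting) atLeastAtMost_iff imageE)
qed

text \<open>Ordered by their second entries, the occurrences have ranks 1, 2, and so on. A
  permutation with at least \<open>k\<close> of them thus carries exactly one mark of rank
  \<open>k\<close>.\<close>

lemma card_corner_marks:
  assumes "1 \<le> k"
  shows "card (corner_marks b n k) = card {xs \<in> perms n. k \<le> card (occs (corner b) xs)}"
proof -
  define J where "J xs = snd ` occs (corner b) xs" for xs
  have cJ: "card (J xs) = card (occs (corner b) xs)" if xs: "xs \<in> perms n" for xs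
  proof -
    have "inj_on snd (occs (corner b) xs)"
    proof (rule inj_onI, clarsimp)
      fix i i' j assume "(i, j) \<in> occs (corner b) xs" "(i', j) \<in> occs (corner b) xs"
      then show "i = i'" using corner_first_le[OF xs] by (metis linorder_neqE_nat)
    qed
    then show ?thesis unfolding J_def by (rule card_image)
  qed
  have fin: "finite (J xs)" for xs by (simp add: J_def)
  have rank: "(i, i + d) \<in> occs (corner b) xs \<and> card {x \<in> J xs. x \<le> i + d} = corner_rank xs i d"
    if "xs \<in> perms n" "i + d < n" "corner_at b xs i d (n - (i + d + 1))" for xs i d
  proof -
    have n: "n = i + d + 1 + (n - (i + d + 1))" using that by simp
    have "{x \<in> J xs. x \<le> i + d} = {j. j \<le> i + d \<and> (\<exists>k. (k, j) \<in> occs (corner b) xs)}"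
      by (force simp: J_def)
    then show ?thesis using corner_rank_eq[OF that(1) n that(3)] corner_occs[OF that(1) n] that(3) by simp
  qed
  have "bij_betw fst (corner_marks b n k) {xs \<in> perms n. k \<le> card (occs (corner b) xs)}"
    unfolding bij_betw_def
  proof
    show "inj_on fst (corner_marks b n k)"
    proof (rule inj_onI)
      fix x y assume xy: "x \<in> corner_marks b n k" "y \<in> corner_marks b n k" "fst x = fst y"
      obtain xs i d i' d' where e: "x = (xs, i, d)" "y = (xs, i', d')" using xy(3) by (cases x; cases y) auto
      have r: "xs \<in> perms n" "(i, i + d) \<in> occs (corner b) xs" "(i', i' + d') \<in> occs (corner b) xs"
        "card {x \<in> J xs. x \<le> i + d} = k" "card {x \<in> J xs. x \<le> i' + d'} = k"
        using xy(1,2) rank by (auto simp: e corner_marks_def)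
      have "i = i'" using corner_first_le[OF r(1,2,3)] corner_first_le[OF r(1,3,2)] by simp
      moreover have "i + d = i' + d'"
        by (rule unique_rank[OF fin, of _ xs]) (use r in \<open>force simp: J_def\<close>)+
      ultimately show "x = y" by (simp add: e)
    qed
    show "fst ` corner_marks b n k = {xs \<in> perms n. k \<le> card (occs (corner b) xs)}"
    proof (intro equalityI subsetI)
      fix xs assume "xs \<in> fst ` corner_marks b n k"
      then obtain i d where m: "(xs, i, d) \<in> corner_marks b n k" by force
      then have xs: "xs \<in> perms n" and "card {x \<in> J xs. x \<le> i + d} = k"
        using rank by (auto simp: corner_marks_def)
      moreover have "card {x \<in> J xs. x \<le> i + d} \<le> card (J xs)" using fin by (intro card_mono) auto
      ultimately show "xs \<in> {xs \<in> perms n. k \<le> card (occs (corner b) xs)}" using cJ[OF xs] by simp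
    next
      fix xs assume "xs \<in> {xs \<in> perms n. k \<le> card (occs (corner b) xs)}"
      then have xs: "xs \<in> perms n" and "k \<le> card (J xs)" using cJ by auto
      then obtain j where j: "j \<in> J xs" "card {x \<in> J xs. x \<le> j} = k" using ex_rank[OF fin assms] by blast
      then obtain i where i: "(i, j) \<in> occs (corner b) xs" by (auto simp: J_def)
      then obtain d c where d: "j = i + d" "n = i + d + 1 + c" "corner_at b xs i d c" using corner_occsE[OF xs] by metis
      then have c: "n - (i + d + 1) = c" "i + d < n" by auto
      then have "(xs, i, d) \<in> corner_marks b n k" using xs d j(2) rank[of xs i d] by (simp add: corner_marks_def)
      then show "xs \<in> fst ` corner_marks b n k" by force
    qed
  qed
  then show ?thesis by (rule bij_betw_same_card)
qed

lemma equid_corner: "equid (corner b) (corner (\<not> b))"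
  unfolding equid_def
proof (intro allI)
  fix n k
  have fin: "finite (perms n)" by (simp add: perms_def)
  have le: "card {xs \<in> perms n. m \<le> card (occs (corner b) xs)} = card {xs \<in> perms n. m \<le> card (occs (corner (\<not> b)) xs)}" for m
  \<comment> \<open>Ranks start at 1, so marks do not describe the case \<open>m = 0\<close>; there
    both sides count all permutations.\<close>
  proof (cases "m = 0")
    case False
    then show ?thesis
      using card_corner_marks_le[of b n m] card_corner_marks_le[of "\<not> b" n m] card_corner_marks[of m b n] card_corner_marks[of m "\<not> b" n]
      by simp
  qed simp
  \<comment> \<open>The exact distribution is recovered from the tails by differences.\<close>
  have "card {xs \<in> perms n. card (occs T xs) = k} = card {xs \<in> perms n. k \<le> card (occs T xs)} - card {xs \<in> perms n. Suc k \<le> card (occs T xs)}" for T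
  proof -
    have "{xs \<in> perms n. card (occs T xs) = k} = {xs \<in> perms n. k \<le> card (occs T xs)} - {xs \<in> perms n. Suc k \<le> card (occs T xs)}"
      by auto
    then show ?thesis using fin by (simp add: card_Diff_subset subset_iff)
  qed
  then show "card {xs \<in> perms n. card (occs (corner b) xs) = k} = card {xs \<in> perms n. card (occs (corner (\<not> b)) xs) = k}"
    using le by simp
qed

section \<open>The upper bound\<close>

definition cells :: "bool list \<Rightarrow> (nat \<times> nat) set" where
  "cells bs = {(x, y). x \<le> 2 \<and> y \<le> 2 \<and> bs ! (3 * x + y)}"

lemma cells_iff: "(x, y) \<in> cells bs \<longleftrightarrow> x \<le> 2 \<and> y \<le> 2 \<and> bs ! (3 * x + y)"
  by (simp add: cells_def)

lemma le_2_iff: "(x :: nat) \<le> 2 \<longleftrightarrow> x = 0 \<or> x = Suc 0 \<or> x = 2"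
  by auto

text \<open>A shading is coded by the number $2^9 + \sum 2^{3x+y}$ over its cells $(x, y)$; the leading bit
  makes the binary representation of the right length.\<close>

fun bits :: "num \<Rightarrow> bool list" where
  "bits num.One = []"
| "bits (num.Bit0 m) = False # bits m"
| "bits (num.Bit1 m) = True # bits m"

definition shading_bits :: "int \<Rightarrow> bool list" where
  "shading_bits k = bits (num_of_nat (nat k))"

lemma shading_bits_Pos [code]: "shading_bits (Int.Pos m) = bits m"
  by (simp add: shading_bits_def num_of_nat_numeral_eq)

lemma shading_bits_numeral [simp]: "shading_bits (numeral m) = bits m"
  by (simp add: shading_bits_def num_of_nat_numeral_eq)

text \<open>The nine letters stand for (0,0), (0,1), (0,2), (1,0), ..., (2,2), column by column. In
  this order the half-turn of the shading is simply \<open>rev\<close>.\<close>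

fun transpose_bits :: "bool list \<Rightarrow> bool list" where
  "transpose_bits [a, b, c, d, e, f, g, h, i] = [a, d, g, b, e, h, c, f, i]"
| "transpose_bits bs = bs"

fun swap_cols :: "bool list \<Rightarrow> bool list" where
  "swap_cols [a, b, c, d, e, f, g, h, i] = [a, b, c, g, h, i, d, e, f]"
| "swap_cols bs = bs"

fun swap_rows :: "bool list \<Rightarrow> bool list" where
  "swap_rows [a, b, c, d, e, f, g, h, i] = [a, c, b, d, f, e, g, i, h]"
| "swap_rows bs = bs"

fun cols_swappable :: "bool list \<Rightarrow> bool" where
  "cols_swappable [a, b, c, d, e, f, g, h, i] \<longleftrightarrow> a \<and> b \<and> c"
| "cols_swappable bs \<longleftrightarrow> False"

text \<open>The three alternatives are the hypotheses of \<open>equid_first_rows\<close>,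
  \<open>block_swap\<close> and \<open>row_swap\<close>. The mirror image of the last one, with
  (0,2) shaded instead of (0,1), is reached by using \<open>related\<close> backwards.\<close>

fun rows_swappable :: "bool list \<Rightarrow> bool" where
  "rows_swappable [a, b, c, d, e, f, g, h, i] \<longleftrightarrow>
     a \<and> (b \<and> c \<or> d \<and> \<not> b \<and> \<not> c \<or> d \<and> b \<and> \<not> c \<and> \<not> g \<and> \<not> h)"
| "rows_swappable bs \<longleftrightarrow> False"

text \<open>In order: two pairs with unique first entries, four linking the five Stirling patterns,
  two with unique second entries, one birth-death pair, the pair with nested destroying slots, and
  the corner pair.\<close>

definition special_pairs :: "(int \<times> int) list" where
  "special_pairs =
    [(515, 530), (771, 786), (551, 557), (551, 566), (551, 572), (551, 570), (567, 807), (638, 878),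
    (694, 698), (630, 685), (860, 797)]"

definition related :: "bool list \<Rightarrow> bool list \<Rightarrow> bool" where
  "related bs cs \<longleftrightarrow> cs = transpose_bits bs \<or> cs = rev bs \<or> cols_swappable bs \<and> cs = swap_cols bs \<or>
     rows_swappable bs \<and> cs = swap_rows bs \<or>
     list_ex (\<lambda>(k, l). bs = shading_bits k \<and> cs = shading_bits l) special_pairs"

lemma length_9E:
  assumes "length bs = 9"
  obtains a b c d e f g h i where "bs = [a, b, c, d, e, f, g, h, i]"
  using assms by (auto simp: numeral_eq_Suc length_Suc_conv)

lemma equid_special:
  assumes "(k, l) \<in> set special_pairs"
  shows "equid (cells (shading_bits k)) (cells (shading_bits l))"
proof -
  have 1: "equid (cells (shading_bits 515)) (cells (shading_bits 530))"
    by (rule equid_unique_first) (simp_all add: cells_iff)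
  have 2: "equid (cells (shading_bits 771)) (cells (shading_bits 786))"
    by (rule equid_unique_first) (simp_all add: cells_iff)
  have c2: "(2, y) \<notin> cells (shading_bits k)" if "k \<in> {551, 557, 566, 572, 570}" for y k
  proof
    assume "(2, y) \<in> cells (shading_bits k)"
    then have "y = 0 \<or> y = 1 \<or> y = 2" "shading_bits k ! (6 + y)" by (auto simp: cells_iff)
    then show False using that by (elim disjE insertE emptyE) simp_all
  qed
  have s1: "unit_slot (cells (shading_bits 551)) (\<lambda>xs. Suc (length xs))"
    by (rule unit_slot_first) (simp_all add: cells_iff)
  have s2: "unit_slot (cells (shading_bits 557)) (\<lambda>xs. Suc (length xs))"
    by (rule unit_slot_argmin) (simp_all add: cells_iff)
  have s3: "unit_slot (cells (shading_bits 566)) (\<lambda>xs. Suc (length xs))"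
    by (rule unit_slot_argmax) (simp_all add: cells_iff)
  have s4: "unit_slot (cells (shading_bits 572)) (\<lambda>xs. Suc (length xs))"
    by (rule unit_slot_last) (simp_all add: cells_iff)
  have s5: "unit_slot (cells (shading_bits 570)) (\<lambda>xs. Suc (last xs))"
    by (rule unit_slot_succ) (simp_all add: cells_iff)
  have 3: "equid (cells (shading_bits 551)) (cells (shading_bits 557))"
    by (rule equid_stirling[OF s1 c2 s2 c2]) simp_all
  have 4: "equid (cells (shading_bits 551)) (cells (shading_bits 566))"
    by (rule equid_stirling[OF s1 c2 s3 c2]) simp_all
  have 5: "equid (cells (shading_bits 551)) (cells (shading_bits 572))"
    by (rule equid_stirling[OF s1 c2 s4 c2]) simp_all
  have 6: "equid (cells (shading_bits 551)) (cells (shading_bits 570))"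
    by (rule equid_stirling[OF s1 c2 s5 c2]) simp_all
  have 7: "equid (cells (shading_bits 567)) (cells (shading_bits 807))"
    by (rule equid_unique_second) (simp_all add: cells_iff)
  have 8: "equid (cells (shading_bits 638)) (cells (shading_bits 878))"
    by (rule equid_unique_second) (simp_all add: cells_iff)
  have 9: "equid (cells (shading_bits 694)) (cells (shading_bits 698))"
  proof (rule equid_birth_death)
    fix n xs assume n: "0 < n" and xs: "xs \<in> perms n"
    have "unit_slot (cells (shading_bits 694)) (\<lambda>xs. Suc (length xs))"
      by (rule unit_slot_argmax) (simp_all add: cells_iff)
    then have "\<exists>D. birth_death (cells (shading_bits 694)) xs D (Suc (length xs))"
    proof (rule birth_deathI)
      fix n xs i j assume "xs \<in> perms n" "(i, j) \<in> occs (cells (shading_bits 694)) xs"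
      then have "j < n" "length xs = n" "xs ! j \<le> n" using perms_D(3,4)[of xs n] by (auto simp: occs_def)
      then show "xs ! j \<noteq> Suc (length xs)" by simp
    qed (use n xs in \<open>simp_all add: cells_iff\<close>)
    then show "\<exists>D s. birth_death (cells (shading_bits 694)) xs D s" by blast
    have "unit_slot (cells (shading_bits 698)) (\<lambda>xs. Suc (last xs))"
      by (rule unit_slot_succ) (simp_all add: cells_iff)
    then have "\<exists>D. birth_death (cells (shading_bits 698)) xs D (Suc (last xs))"
    proof (rule birth_deathI)
      fix n xs i j assume xs: "xs \<in> perms n" and ij: "(i, j) \<in> occs (cells (shading_bits 698)) xs"
      \<comment> \<open>An occurrence has consecutive values, so its second value could only be the
        successor of the last entry if its first entry were the last one, which is impossible as the
        second entry follows it.\<close>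
      have c: "i < n" "j < n" "i < j" "xs ! j = Suc (xs ! i)"
        by (rule occs_consecutive[OF xs _ _ _ ij]; simp add: cells_iff)+
      have "last xs = xs ! (n - 1)" using c(1) perms_D(3)[OF xs] by (metis last_conv_nth length_greater_0_conv gr_implies_not0 neq0_conv)
      then show "xs ! j \<noteq> Suc (last xs)" using perms_D(5)[OF xs, of i "n - 1"] c by auto
    qed (use n xs in \<open>simp_all add: cells_iff\<close>)
    then show "\<exists>D s. birth_death (cells (shading_bits 698)) xs D s" by blast
  qed
  have 10: "equid (cells (shading_bits 630)) (cells (shading_bits 685))"
    by (rule nested_kills.equid, unfold_locales) (simp_all add: cells_iff)
  have 11: "equid (cells (shading_bits 860)) (cells (shading_bits 797))"
  proof -
    have "cells (shading_bits 860) = corner True"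
      by (rule set_eqI, clarify) (auto simp: cells_iff corner_def le_2_iff)
    moreover have "cells (shading_bits 797) = corner False"
      by (rule set_eqI, clarify) (auto simp: cells_iff corner_def le_2_iff)
    ultimately show ?thesis using equid_corner[of True] by simp
  qed
  from assms 1 2 3 4 5 6 7 8 9 10 11 show ?thesis unfolding special_pairs_def by auto
qed

lemma equid_related:
  assumes "length bs = 9" "related bs cs"
  shows "equid (cells bs) (cells cs)"
proof -
  obtain a b c d e f g h i where bs: "bs = [a, b, c, d, e, f, g, h, i]" using length_9E[OF assms(1)] .
  consider "cs = transpose_bits bs" | "cs = rev bs" | "cols_swappable bs" "cs = swap_cols bs" |
    "rows_swappable bs" "cs = swap_rows bs" |
    k l where "(k, l) \<in> set special_pairs" "bs = shading_bits k" "cs = shading_bits l"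
    using assms(2) unfolding related_def list_ex_iff by blast
  then show ?thesis
  proof cases
    case 1
    then show ?thesis by (intro equid_transpose) (auto simp: bs cells_iff le_2_iff)
  next
    case 2
    then show ?thesis by (intro equid_rc) (auto simp: bs cells_iff le_2_iff)
  next
    case 3
    then show ?thesis by (intro equid_first_cols) (auto simp: bs cells_iff le_2_iff swap12_def)
  next
    case 4
    then have r: "a" "b \<and> c \<or> d \<and> \<not> b \<and> \<not> c \<or> d \<and> b \<and> \<not> c \<and> \<not> g \<and> \<not> h"
      and S: "\<And>x y. x \<le> 2 \<Longrightarrow> y \<le> 2 \<Longrightarrow> (x, y) \<in> cells cs \<longleftrightarrow> (x, swap12 y) \<in> cells bs"
      by (auto simp: bs cells_iff le_2_iff swap12_def)
    from r(2) consider "b \<and> c" | "d \<and> \<not> b \<and> \<not> c" | "d \<and> b \<and> \<not> c \<and> \<not> g \<and> \<not> h" by blast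
    then show ?thesis
    proof cases
      case 1
      then show ?thesis by (intro equid_first_rows[OF _ _ S]) (use r(1) 4 in \<open>auto simp: bs cells_iff\<close>)
    next
      case 2
      then show ?thesis
        by (intro block_swap.equid block_swap.intro S) (use r(1) in \<open>auto simp: bs cells_iff\<close>)
    next
      case 3
      then show ?thesis
        by (intro row_swap.equid row_swap.intro S) (use r(1) in \<open>auto simp: bs cells_iff\<close>)
    qed
  next
    case 5
    then show ?thesis using equid_special by simp
  qed
qed

text \<open>Each class is listed in such an order that every entry is related to an earlier one. The last class
  and the class $\{689, 794\}$ are the two that are not separated for $n \le 6$.\<close>

definition classes :: "int list list" where
  "classes =
    [[512], [513, 768], [514, 520, 640, 544], [515, 521, 530, 896, 800, 536, 656, 560], [516, 576], [517,
    577, 832, 772], [518, 584, 704, 548], [519, 585, 960, 804], [522, 672], [523, 525, 928, 579, 864,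
    900], [524, 578, 608, 644], [526, 586, 736, 676], [527, 583, 587, 992, 589, 964, 932, 868], [528],
    [529, 784], [531, 537, 912, 553, 816, 643, 808, 898], [532, 592], [533, 593, 848, 788], [534, 600,
    720, 564], [535, 551, 601, 647, 976, 557, 566, 570, 572, 713, 775, 968, 617, 820, 962, 539, 707, 872,
    728, 666, 696, 632, 722, 806, 841, 961, 812, 944, 902, 690, 662, 805], [538, 688], [540, 594, 624,
    660], [541, 555, 595, 880, 651, 936, 916, 930], [542, 602, 752, 692], [543, 559, 603, 711, 1008, 715,
    839, 1000, 948, 621, 966, 934, 845, 965, 876, 869], [545, 641, 776, 770], [546, 648], [547, 649, 904,
    777, 802, 771, 801, 786, 897, 657, 792, 561], [549, 705, 840, 774], [550, 712], [552, 642], [554,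
    650, 680, 674], [556, 616, 706, 646], [558, 714, 744, 678], [562, 664], [563, 665, 920, 809, 818,
    899], [565, 721, 856, 790], [567, 729, 807, 903, 984, 822, 873, 663, 969, 963, 813, 633, 978, 828],
    [568, 658], [569, 659, 824, 914], [571, 573, 667, 952, 723, 888, 946, 918], [574, 730, 760, 694,
    698], [575, 731, 967, 1016, 950, 877], [580], [581, 836], [582, 588, 708, 612], [590, 740], [591,
    996], [596], [597, 852], [598, 604, 724, 628], [599, 605, 615, 655, 980, 884, 717, 783, 972, 619,
    994, 870, 843, 993, 940, 933], [606, 756], [607, 623, 719, 1012, 847, 1004, 998, 997], [609, 645,
    780, 834], [610, 652], [611, 653, 908, 779, 866, 929], [613, 709, 844, 838], [614, 716], [618, 654,
    684, 738], [620, 710], [622, 718, 748, 742], [625, 661, 796, 850], [627, 669, 924, 811, 882, 907,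
    937, 931, 921, 819], [629, 725, 860, 854, 797, 851, 881, 917], [630, 685, 732, 739, 795, 874, 910,
    945], [631, 733, 911, 988, 886, 875, 995, 941], [634, 670, 700, 754], [635, 671, 956, 727, 815, 1010,
    637, 871, 982, 971, 1001, 892, 973, 935, 985, 823, 919, 695, 889, 979, 761, 986, 829, 830], [636,
    726], [638, 734, 764, 878, 758, 749, 974, 743, 799, 855, 687, 859, 1009, 861, 981, 747, 1002, 949,
    885, 942], [639, 735, 975, 1020, 879, 1014, 999, 1005, 831, 983, 703, 987, 1017, 893, 763, 1018, 951,
    958], [673, 778], [675, 681, 906, 793, 810, 787, 817, 913], [677, 737, 842, 782], [679, 745, 791,
    970, 814, 857, 977, 821], [682], [683, 938], [686, 746], [689, 794], [691, 697, 922, 825, 826, 915],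
    [693, 753, 858, 798], [699, 954], [701, 755, 827, 890, 926, 923, 953, 947], [702, 762], [741, 846],
    [750], [751, 863, 1006, 1013], [757, 862], [759, 765, 887, 927, 990, 894, 943, 989, 891, 1011, 1003,
    957], [766], [767, 895, 991, 1022, 1007, 1021, 1015, 959, 1019], [769], [773, 833], [781, 835, 865,
    901], [785], [789, 849], [803, 905], [837], [853], [867, 909], [883, 925], [939], [955], [1023],
    [626, 668]]"

text \<open>The accumulator holds the codes already connected to the head of the class. Testing both
  directions of \<open>related\<close> makes the one-sided row swaps usable either way.\<close>

fun chained :: "bool list list \<Rightarrow> bool list list \<Rightarrow> bool" where
  "chained ks [] \<longleftrightarrow> True"
| "chained ks (x # xs) \<longleftrightarrow> length x = 9 \<and> list_ex (\<lambda>k. related k x \<or> related x k) ks \<and> chained (x # ks) xs"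

fun class_ok :: "bool list list \<Rightarrow> bool" where
  "class_ok [] \<longleftrightarrow> False"
| "class_ok (x # xs) \<longleftrightarrow> length x = 9 \<and> chained [x] xs"

text \<open>Exhaustiveness is checked by repeatedly splitting the list by leading bits: every branch
  must still contain a word after \<open>n\<close> bits. This avoids searching the whole list for
  each of the 512 shadings.\<close>

fun covers :: "nat \<Rightarrow> bool list list \<Rightarrow> bool" where
  "covers 0 L \<longleftrightarrow> list_ex (\<lambda>x. x = []) L"
| "covers (Suc n) L \<longleftrightarrow> covers n (map tl (filter (\<lambda>x. x \<noteq> [] \<and> hd x) L)) \<and>
     covers n (map tl (filter (\<lambda>x. x \<noteq> [] \<and> \<not> hd x) L))"

lemma covers_D: "covers n L \<Longrightarrow> length bs = n \<Longrightarrow> bs \<in> set L"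
proof (induction n L arbitrary: bs rule: covers.induct)
  case (1 L)
  then show ?case by (auto simp: list_ex_iff)
next
  case (2 n L)
  obtain b bs' where bs: "bs = b # bs'" "length bs' = n" using 2(4) by (cases bs) auto
  show ?case
  proof (cases b)
    case True
    then have "bs' \<in> set (map tl (filter (\<lambda>x. x \<noteq> [] \<and> hd x) L))" using 2 bs by auto
    then obtain x where x: "x \<in> set L" "x \<noteq> []" "hd x" "tl x = bs'" by auto
    have "x = hd x # tl x" using x(2) by simp
    also have "\<dots> = bs" using x(3,4) bs(1) True by simp
    finally show ?thesis using x(1) by simp
  next
    case False
    then have "bs' \<in> set (map tl (filter (\<lambda>x. x \<noteq> [] \<and> \<not> hd x) L))" using 2 bs by auto
    then obtain x where x: "x \<in> set L" "x \<noteq> []" "\<not> hd x" "tl x = bs'" by auto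
    have "x = hd x # tl x" using x(2) by simp
    also have "\<dots> = bs" using x(3,4) bs(1) False by simp
    finally show ?thesis using x(1) by simp
  qed
qed

lemma chained_D:
  assumes "chained ks xs" "\<forall>k\<in>set ks. length k = 9 \<and> equid (cells r) (cells k)"
  shows "\<forall>x\<in>set xs. length x = 9 \<and> equid (cells r) (cells x)"
  using assms
proof (induction ks xs rule: chained.induct)
  case (2 ks x xs)
  obtain k where k: "k \<in> set ks" "related k x \<or> related x k" using 2(2) by (auto simp: list_ex_iff)
  have l: "length k = 9" "length x = 9" "equid (cells r) (cells k)" using 2(2,3) k(1) by auto
  have "equid (cells k) (cells x)" using k(2) equid_related l(1,2) equid_sym by blast
  then have x: "equid (cells r) (cells x)" using equid_trans l(3) by blast
  have "\<forall>y\<in>set xs. length y = 9 \<and> equid (cells r) (cells y)"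
    by (rule 2(1)) (use 2(2,3) x l in auto)
  then show ?case using x l by simp
qed simp

lemma class_ok_D:
  assumes "class_ok c" "x \<in> set c"
  shows "equid (cells (hd c)) (cells x)"
proof (cases c)
  case (Cons r xs)
  then show ?thesis using assms chained_D[of "[r]" xs r] equid_refl by auto
qed (use assms in simp)

lemma classes_ok: "list_all class_ok (map (map shading_bits) classes)"
  by code_simp

lemma classes_cover: "covers 9 (concat (map (map shading_bits) classes))"
  by code_simp

lemma length_classes: "length classes = 106"
  by code_simp

lemma equid_class_rep:
  assumes "length bs = 9"
  shows "\<exists>r\<in>set (map (\<lambda>c. shading_bits (hd c)) classes). equid (cells r) (cells bs)"
proof -
  have "bs \<in> set (concat (map (map shading_bits) classes))" using covers_D[OF classes_cover assms] .
  then obtain c where c: "c \<in> set classes" "bs \<in> set (map shading_bits c)" by auto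
  then have ok: "class_ok (map shading_bits c)" using classes_ok by (auto simp: list_all_iff)
  then have "c \<noteq> []" by auto
  then have "hd (map shading_bits c) = shading_bits (hd c)" by (simp add: hd_map)
  then show ?thesis using class_ok_D[OF ok c(2)] c(1) by auto
qed

section \<open>The lower bound\<close>

fun all_perms :: "nat \<Rightarrow> nat list list" where
  "all_perms 0 = [[]]"
| "all_perms (Suc n) = concat (map (\<lambda>xs. map (\<lambda>x. child x xs) [1..<Suc (Suc n)]) (all_perms n))"

lemma all_perms: "set (all_perms n) = perms n \<and> distinct (all_perms n)"
proof (induction n)
  case 0
  then show ?case by (simp add: perms_0)
next
  case (Suc n)
  have "set (all_perms (Suc n)) = (\<Union>xs\<in>perms n. (\<lambda>x. child x xs) ` {1..Suc n})"
    using Suc by (simp del: upt_Suc add: atLeastLessThanSuc_atLeastAtMost)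
  also have "\<dots> = (\<lambda>(xs, x). child x xs) ` (SIGMA xs:perms n. {1..Suc n})"
    by force
  also have "\<dots> = perms (Suc n)" using bij_betw_imp_surj_on[OF bij_betw_child] .
  finally have s: "set (all_perms (Suc n)) = perms (Suc n)" .
  \<comment> \<open>Distinctness follows by counting: the list has n + 1 times as many members as
    its predecessor, which is just the number of permutations it contains.\<close>
  have "length (all_perms n) = fact n"
    using Suc distinct_card[of "all_perms n"] by (simp add: perms_def card_permutations_of_set)
  then have "length (all_perms (Suc n)) = fact (Suc n)"
    by (simp add: length_concat comp_def sum_list_triv)
  also have "\<dots> = card (set (all_perms (Suc n)))" unfolding s by (simp add: perms_def card_permutations_of_set)
  finally show ?case using s card_distinct[of "all_perms (Suc n)"] by simp
qed

text \<open>For each ascent, the codes 3x + y of the cells occupied by the other entries. This does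
  not involve the shading: an ascent is an occurrence if none of its listed cells is shaded.\<close>

definition ascent_cells :: "nat list \<Rightarrow> nat list list" where
  "ascent_cells xs = map (\<lambda>(i, j). map (\<lambda>l. 3 * mcell i j l + mcell (xs ! i) (xs ! j) (xs ! l))
       (filter (\<lambda>l. l \<noteq> i \<and> l \<noteq> j) [0..<length xs]))
     (filter (\<lambda>(i, j). i < j \<and> xs ! i < xs ! j) (List.product [0..<length xs] [0..<length xs]))"

definition count_cells :: "nat list list \<Rightarrow> bool list \<Rightarrow> nat" where
  "count_cells css bs = length (filter (list_all (\<lambda>c. \<not> bs ! c)) css)"

lemma count_cells: "count_cells (ascent_cells xs) bs = card (occs (cells bs) xs)"
proof -
  let ?n = "length xs"
  let ?ps = "List.product [0..<?n] [0..<?n]"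
  let ?P = "\<lambda>(i, j). i < j \<and> xs ! i < xs ! j"
  let ?f = "\<lambda>(i, j). map (\<lambda>l. 3 * mcell i j l + mcell (xs ! i) (xs ! j) (xs ! l))
       (filter (\<lambda>l. l \<noteq> i \<and> l \<noteq> j) [0..<?n])"
  let ?Q = "list_all (\<lambda>c. \<not> bs ! c)"
  have Q: "?Q (?f (i, j)) \<longleftrightarrow> (\<forall>l<?n. l \<noteq> i \<longrightarrow> l \<noteq> j \<longrightarrow> (mcell i j l, mcell (xs ! i) (xs ! j) (xs ! l)) \<notin> cells bs)" for i j
    by (auto simp: list_all_iff cells_iff mcell_le)
  have "count_cells (ascent_cells xs) bs = length (filter (\<lambda>p. ?P p \<and> ?Q (?f p)) ?ps)"
    unfolding count_cells_def ascent_cells_def by (simp add: filter_map comp_def conj_commute)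
  also have "\<dots> = card {p \<in> set ?ps. ?P p \<and> ?Q (?f p)}"
    using distinct_length_filter[of ?ps "\<lambda>p. ?P p \<and> ?Q (?f p)"] by (simp add: distinct_product Int_def conj_commute)
  also have "{p \<in> set ?ps. ?P p \<and> ?Q (?f p)} = occs (cells bs) xs"
  proof (rule set_eqI, clarify)
    fix i j
    show "(i, j) \<in> {p \<in> set ?ps. ?P p \<and> ?Q (?f p)} \<longleftrightarrow> (i, j) \<in> occs (cells bs) xs"
      unfolding mem_Collect_eq Q occs_def by auto
  qed
  finally show ?thesis .
qed

text \<open>Counts 0 to 6 are tabulated. For n = 4 there are at most 6 ascents and the table is
  complete; for n = 5 and 6 it is truncated, but different tables still imply different
  distributions.\<close>

definition tally :: "nat list \<Rightarrow> nat list" where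
  "tally ns = map (\<lambda>k. length (filter (\<lambda>m. m = k) ns)) [0..<7]"

definition histogram :: "nat list list list \<Rightarrow> bool list \<Rightarrow> nat list" where
  "histogram csss bs = tally (map (\<lambda>css. count_cells css bs) csss)"

lemma histogram:
  "histogram (map ascent_cells (all_perms n)) bs = map (\<lambda>k. card {xs \<in> perms n. card (occs (cells bs) xs) = k}) [0..<7]"
proof -
  have "length (filter (\<lambda>m. m = k) (map (\<lambda>css. count_cells css bs) (map ascent_cells (all_perms n)))) =
      card {xs \<in> perms n. card (occs (cells bs) xs) = k}" for k
    using all_perms[of n] distinct_length_filter[of "all_perms n" "\<lambda>xs. card (occs (cells bs) xs) = k"]
    by (simp add: filter_map comp_def count_cells Int_def conj_commute)
  then show ?thesis by (simp add: histogram_def tally_def)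
qed

lemma equid_histogram:
  "equid (cells bs) (cells cs) \<Longrightarrow> histogram (map ascent_cells (all_perms n)) bs = histogram (map ascent_cells (all_perms n)) cs"
  by (simp add: histogram equid_def)

definition reps :: "int list" where
  "reps = map hd (take 105 classes)"

text \<open>These pairs and those in \<open>pairs6\<close> are exempt from the comparison at n = 4
  and are separated at n = 5 and n = 6 respectively. They are oriented as in \<open>reps\<close>,
  because \<open>separated\<close> compares an entry only with later ones.\<close>

definition pairs5 :: "(int \<times> int) list" where
  "pairs5 =
    [(513, 528), (529, 545), (529, 769), (531, 562), (545, 769), (565, 781), (597, 789), (611, 675),
    (611, 689), (630, 683), (630, 693), (634, 636), (636, 679), (675, 689), (683, 693), (751, 766)]"

definition pairs6 :: "(int \<times> int) list" where
  "pairs6 =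
    [(634, 679), (673, 785)]"

fun separated :: "(int \<times> int) list \<Rightarrow> (int \<times> nat list) list \<Rightarrow> bool" where
  "separated E [] \<longleftrightarrow> True"
| "separated E ((k, h) # khs) \<longleftrightarrow> list_all (\<lambda>(l, h'). h \<noteq> h' \<or> (k, l) \<in> set E) khs \<and> separated E khs"

definition histograms :: "nat list list list \<Rightarrow> int list \<Rightarrow> (int \<times> nat list) list" where
  "histograms csss ks = map (\<lambda>k. (k, histogram csss (shading_bits k))) ks"

definition histograms_differ :: "nat list list list \<Rightarrow> int \<times> int \<Rightarrow> bool" where
  "histograms_differ csss = (\<lambda>(k, l). histogram csss (shading_bits k) \<noteq> histogram csss (shading_bits l))"

definition all_differ :: "nat list list list \<Rightarrow> (int \<times> int) list \<Rightarrow> bool" where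
  "all_differ csss ps = list_all (histograms_differ csss) ps"

lemma separated_4: "separated (pairs5 @ pairs6) (histograms (map ascent_cells (all_perms 4)) reps)"
  by code_simp

lemma separated_5: "all_differ (map ascent_cells (all_perms 5)) pairs5"
  by code_simp

lemma separated_6: "all_differ (map ascent_cells (all_perms 6)) pairs6"
  by code_simp

section \<open>Mesh patterns and shadings\<close>

text \<open>The classes of a kernel relation are the nonempty fibres of \<open>f\<close>, one for
  each value taken.\<close>

lemma card_quotient_kernel:
  assumes "\<And>p q. (p, q) \<in> r \<longleftrightarrow> p \<in> A \<and> q \<in> A \<and> f p = f q"
  shows "card (A // r) = card (f ` A)"
proof -
  have cls: "r `` {p} = {q \<in> A. f q = f p}" if "p \<in> A" for p
    using that assms by auto
  have "A // r = (\<lambda>c. {q \<in> A. f q = c}) ` (f ` A)"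
    unfolding quotient_def using cls by auto
  moreover have "inj_on (\<lambda>c. {q \<in> A. f q = c}) (f ` A)"
  proof (rule inj_onI)
    fix c c' assume "c \<in> f ` A" "{q \<in> A. f q = c} = {q \<in> A. f q = c'}"
    then obtain p where "p \<in> A" "f p = c" "p \<in> {q \<in> A. f q = c'}" by blast
    then show "c = c'" by simp
  qed
  ultimately show ?thesis by (simp add: card_image)
qed

definition distr :: "(nat \<times> nat) set \<Rightarrow> nat \<Rightarrow> nat \<Rightarrow> nat" where
  "distr R n k = card {xs \<in> perms n. card (occs R xs) = k}"

lemma equid_iff_distr: "equid R S \<longleftrightarrow> distr R = distr S"
  by (auto simp: equid_def distr_def fun_eq_iff)

lemma bij_betw_one_line: "bij_betw (\<lambda>\<sigma>. map \<sigma> [1..<Suc n]) {\<sigma>. \<sigma> permutes {1..n}} (perms n)"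
proof -
  let ?F = "\<lambda>\<sigma> :: nat \<Rightarrow> nat. map \<sigma> [1..<Suc n]"
  have set_upt: "set [1..<Suc n] = {1..n}" by auto
  have inj: "inj_on ?F {\<sigma>. \<sigma> permutes {1..n}}"
  proof (rule inj_onI, clarify, rule ext)
    fix \<sigma> \<tau> :: "nat \<Rightarrow> nat" and x
    assume "\<sigma> permutes {1..n}" "\<tau> permutes {1..n}" "?F \<sigma> = ?F \<tau>"
    then show "\<sigma> x = \<tau> x"
      by (cases "x \<in> {1..n}") (auto simp: permutes_not_in map_eq_conv simp del: upt_Suc)
  qed
  have sub: "?F ` {\<sigma>. \<sigma> permutes {1..n}} \<subseteq> perms n"
  proof clarify
    fix \<sigma> :: "nat \<Rightarrow> nat" assume s: "\<sigma> permutes {1..n}"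
    have "set (?F \<sigma>) = {1..n}" using permutes_image[OF s] unfolding set_map set_upt .
    moreover have "distinct (?F \<sigma>)" using permutes_inj_on[OF s] by (simp add: distinct_map del: upt_Suc)
    ultimately show "?F \<sigma> \<in> perms n" by (simp only: perms_iff)
  qed
  \<comment> \<open>Surjectivity by counting: both sides have n! elements.\<close>
  have "card {\<sigma>. \<sigma> permutes {1..n}} = fact n" by (simp add: card_permutations)
  also have "\<dots> = card (perms n)" by (simp add: perms_def card_permutations_of_set)
  finally have "card (?F ` {\<sigma>. \<sigma> permutes {1..n}}) = card (perms n)" using card_image[OF inj] by simp
  then have "?F ` {\<sigma>. \<sigma> permutes {1..n}} = perms n"
    using sub by (intro card_subset_eq) (simp_all add: perms_def)
  then show ?thesis using inj by (simp add: bij_betw_def)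
qed

lemma bij_betw_rev: "bij_betw rev (perms n) (perms n)"
  by (rule bij_betw_byWitness[where f' = rev]) (auto simp: perms_iff)

text \<open>Mirror image of a shading in the vertical axis, the effect of reversing a
  permutation.\<close>

definition flip :: "(nat \<times> nat) set \<Rightarrow> (nat \<times> nat) set" where
  "flip R = {(x, y). x \<le> 2 \<and> (2 - x, y) \<in> R}"

lemma grid_line_cell:
  assumes "x \<le> 2" "a < b" "1 \<le> l" "l \<le> n" "b \<le> n"
  shows "[0, a, b, n + 1] ! x < l \<and> l < [0, a, b, n + 1] ! (x + 1) \<longleftrightarrow> l \<noteq> a \<and> l \<noteq> b \<and> mcell a b l = x"
proof -
  consider "x = 0" | "x = 1" | "x = 2" using assms(1) by linarith
  then show ?thesis by cases (use assms in \<open>auto simp: mcell_def\<close>)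
qed

lemma mesh_occurrence_iff:
  assumes \<sigma>: "\<sigma> permutes {1..n}" and R: "snd p \<subseteq> {0, 1, 2} \<times> {0, 1, 2}"
  shows "mesh_occurrence n \<sigma> p (a, b) \<longleftrightarrow> 1 \<le> a \<and> a < b \<and> b \<le> n \<and> (\<sigma> a < \<sigma> b \<longleftrightarrow> fst p 1 < fst p 2) \<and>
    (\<forall>l\<in>{1..n}. l \<noteq> a \<longrightarrow> l \<noteq> b \<longrightarrow>
       (mcell a b l, mcell (min (\<sigma> a) (\<sigma> b)) (max (\<sigma> a) (\<sigma> b)) (\<sigma> l)) \<notin> snd p)"
proof (cases "1 \<le> a \<and> a < b \<and> b \<le> n")
  case True
  have in_range: "1 \<le> \<sigma> l \<and> \<sigma> l \<le> n" if "l \<in> {1..n}" for l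
    using permutes_in_image[OF \<sigma>, of l] that by simp
  have inj: "\<sigma> l = \<sigma> m \<longleftrightarrow> l = m" for l m using permutes_inj[OF \<sigma>] by (auto simp: inj_def)
  let ?u = "min (\<sigma> a) (\<sigma> b)" and ?v = "max (\<sigma> a) (\<sigma> b)"
  have uv: "?u < ?v" "?v \<le> n" using inj[of a b] in_range[of a] in_range[of b] True by auto
  \<comment> \<open>The inner horizontal lines are the values at \<open>a\<close> and
    \<open>b\<close>; so avoiding them means the same as avoiding these two positions.\<close>
  have ne: "\<sigma> l \<noteq> ?u \<and> \<sigma> l \<noteq> ?v \<longleftrightarrow> l \<noteq> a \<and> l \<noteq> b" for l using inj by (auto simp: min_def max_def)
  have c: "([0, a, b, n + 1] ! x < l \<and> l < [0, a, b, n + 1] ! (x + 1) \<and>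
      [0, ?u, ?v, n + 1] ! y < \<sigma> l \<and> \<sigma> l < [0, ?u, ?v, n + 1] ! (y + 1)) \<longleftrightarrow>
      l \<noteq> a \<and> l \<noteq> b \<and> (mcell a b l, mcell ?u ?v (\<sigma> l)) = (x, y)"
    if "(x, y) \<in> snd p" "l \<in> {1..n}" for x y l
  proof -
    have xy: "x \<le> 2" "y \<le> 2" using that(1) R by auto
    have "[0, a, b, n + 1] ! x < l \<and> l < [0, a, b, n + 1] ! (x + 1) \<longleftrightarrow> l \<noteq> a \<and> l \<noteq> b \<and> mcell a b l = x"
      by (rule grid_line_cell) (use xy that True in auto)
    moreover have "[0, ?u, ?v, n + 1] ! y < \<sigma> l \<and> \<sigma> l < [0, ?u, ?v, n + 1] ! (y + 1) \<longleftrightarrow>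
        \<sigma> l \<noteq> ?u \<and> \<sigma> l \<noteq> ?v \<and> mcell ?u ?v (\<sigma> l) = y"
      by (rule grid_line_cell) (use xy in_range[OF that(2)] uv in auto)
    ultimately show ?thesis using ne[of l] by auto
  qed
  have "(\<forall>(x, y)\<in>snd p. \<not> (\<exists>l\<in>{1..n}. [0, a, b, n + 1] ! x < l \<and> l < [0, a, b, n + 1] ! (x + 1) \<and>
      [0, ?u, ?v, n + 1] ! y < \<sigma> l \<and> \<sigma> l < [0, ?u, ?v, n + 1] ! (y + 1))) \<longleftrightarrow>
      (\<forall>(x, y)\<in>snd p. \<forall>l\<in>{1..n}. \<not> (l \<noteq> a \<and> l \<noteq> b \<and> (mcell a b l, mcell ?u ?v (\<sigma> l)) = (x, y)))"
  proof (rule ball_cong[OF refl])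
    fix z assume z: "z \<in> snd p"
    obtain x y where xy: "z = (x, y)" by (cases z)
    show "(case z of (x, y) \<Rightarrow> \<not> (\<exists>l\<in>{1..n}. [0, a, b, n + 1] ! x < l \<and> l < [0, a, b, n + 1] ! (x + 1) \<and>
        [0, ?u, ?v, n + 1] ! y < \<sigma> l \<and> \<sigma> l < [0, ?u, ?v, n + 1] ! (y + 1))) \<longleftrightarrow>
      (case z of (x, y) \<Rightarrow> \<forall>l\<in>{1..n}. \<not> (l \<noteq> a \<and> l \<noteq> b \<and> (mcell a b l, mcell ?u ?v (\<sigma> l)) = (x, y)))"
      unfolding xy case_prod_conv using c[OF z[unfolded xy]] by blast
  qed
  also have "\<dots> \<longleftrightarrow> (\<forall>l\<in>{1..n}. l \<noteq> a \<longrightarrow> l \<noteq> b \<longrightarrow> (mcell a b l, mcell ?u ?v (\<sigma> l)) \<notin> snd p)"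
    by blast
  finally show ?thesis using True unfolding mesh_occurrence_def Let_def by simp
qed (auto simp: mesh_occurrence_def)

lemma mesh_count_ascent:
  assumes \<sigma>: "\<sigma> permutes {1..n}" and R: "snd p \<subseteq> {0, 1, 2} \<times> {0, 1, 2}" and asc: "fst p 1 < fst p 2"
  shows "mesh_count n \<sigma> p = card (occs (snd p) (map \<sigma> [1..<Suc n]))"
proof -
  let ?xs = "map \<sigma> [1..<Suc n]"
  have nth: "?xs ! l = \<sigma> (Suc l)" if "l < n" for l using that by (simp del: upt_Suc)
  have len: "length ?xs = n" by simp
  have sh: "mcell (Suc a) (Suc b) (Suc l) = mcell a b l" for a b l by (simp add: mcell_def)
  have all: "(\<forall>l\<in>{1..n}. Q l) \<longleftrightarrow> (\<forall>l<n. Q (Suc l))" for Q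
  proof
    assume Q: "\<forall>l<n. Q (Suc l)"
    show "\<forall>l\<in>{1..n}. Q l"
    proof
      fix l assume "l \<in> {1..n}"
      then have "Suc (l - 1) = l" "l - 1 < n" by auto
      then show "Q l" using Q by metis
    qed
  qed auto
  have iff: "mesh_occurrence n \<sigma> p (Suc i, Suc j) \<longleftrightarrow> (i, j) \<in> occs (snd p) ?xs" for i j
  proof (cases "i < j \<and> j < n \<and> \<sigma> (Suc i) < \<sigma> (Suc j)")
    case True
    then show ?thesis
      unfolding mesh_occurrence_iff[OF \<sigma> R] occs_def len mem_Collect_eq case_prod_conv all
      using asc by (simp add: sh nth min_def max_def del: upt_Suc cong: imp_cong)
  next
    case False
    then show ?thesis
      unfolding mesh_occurrence_iff[OF \<sigma> R] occs_def len mem_Collect_eq case_prod_conv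
      using asc nth[of i] nth[of j] by (auto simp del: upt_Suc)
  qed
  have "{q. mesh_occurrence n \<sigma> p q} = (\<lambda>(i, j). (Suc i, Suc j)) ` occs (snd p) ?xs"
  proof (intro equalityI subsetI)
    fix q assume q: "q \<in> {q. mesh_occurrence n \<sigma> p q}"
    obtain a b where ab: "q = (a, b)" by (cases q)
    then have "1 \<le> a" "1 \<le> b" using q by (auto simp: mesh_occurrence_def)
    then have "q = (\<lambda>(i, j). (Suc i, Suc j)) (a - 1, b - 1)" "(a - 1, b - 1) \<in> occs (snd p) ?xs"
      using iff[of "a - 1" "b - 1"] q ab by auto
    then show "q \<in> (\<lambda>(i, j). (Suc i, Suc j)) ` occs (snd p) ?xs" by (rule image_eqI)
  qed (use iff in auto)
  then show ?thesis
    unfolding mesh_count_def by (simp add: card_image inj_on_def case_prod_unfold prod_eq_iff)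
qed

text \<open>Index \<open>i\<close> of the reversed list is position n - i. A descent at positions n
  - j and n - i becomes an ascent at \<open>i\<close>, \<open>j\<close>; columns are mirrored and
  rows stay.\<close>

lemma mesh_count_descent:
  assumes \<sigma>: "\<sigma> permutes {1..n}" and R: "snd p \<subseteq> {0, 1, 2} \<times> {0, 1, 2}" and desc: "\<not> fst p 1 < fst p 2"
  shows "mesh_count n \<sigma> p = card (occs (flip (snd p)) (rev (map \<sigma> [1..<Suc n])))"
proof -
  define xs where "xs = rev (map \<sigma> [1..<Suc n])"
  have nth: "xs ! l = \<sigma> (n - l)" if "l < n" for l using that by (simp add: xs_def rev_nth Suc_diff_Suc del: upt_Suc)
  have len: "length xs = n" by (simp add: xs_def)
  have inj: "\<sigma> l = \<sigma> m \<longleftrightarrow> l = m" for l m using permutes_inj[OF \<sigma>] by (auto simp: inj_def)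
  have all: "(\<forall>l\<in>{1..n}. Q l) \<longleftrightarrow> (\<forall>l<n. Q (n - l))" for Q
  proof
    assume Q: "\<forall>l<n. Q (n - l)"
    show "\<forall>l\<in>{1..n}. Q l"
    proof
      fix l assume l: "l \<in> {1..n}"
      then have "n - (n - l) = l" "n - l < n" by auto
      then show "Q l" using Q by metis
    qed
  qed auto
  have iff: "mesh_occurrence n \<sigma> p (n - j, n - i) \<longleftrightarrow> (i, j) \<in> occs (flip (snd p)) xs"
    if ij: "i < j" "j < n" for i j
  proof (cases "\<sigma> (n - i) < \<sigma> (n - j)")
    case True
    have col: "mcell (n - j) (n - i) (n - l) = 2 - mcell i j l" if "l < n" "l \<noteq> i" "l \<noteq> j" for l
      by (rule mcell_reverse) (use ij that in auto)
    have ne: "n - l \<noteq> n - i \<longleftrightarrow> l \<noteq> i" "n - l \<noteq> n - j \<longleftrightarrow> l \<noteq> j" if "l < n" for l using ij that by auto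
    have E: "(\<forall>l<n. n - l \<noteq> n - j \<longrightarrow> n - l \<noteq> n - i \<longrightarrow> (mcell (n - j) (n - i) (n - l), mcell (\<sigma> (n - i)) (\<sigma> (n - j)) (\<sigma> (n - l))) \<notin> snd p) \<longleftrightarrow>
        (\<forall>l<n. l \<noteq> i \<longrightarrow> l \<noteq> j \<longrightarrow> (mcell i j l, mcell (xs ! i) (xs ! j) (xs ! l)) \<notin> flip (snd p))"
    proof (rule all_cong1, rule imp_cong[OF refl])
      fix l assume l: "l < n"
      show "(n - l \<noteq> n - j \<longrightarrow> n - l \<noteq> n - i \<longrightarrow> (mcell (n - j) (n - i) (n - l), mcell (\<sigma> (n - i)) (\<sigma> (n - j)) (\<sigma> (n - l))) \<notin> snd p) \<longleftrightarrow>
        (l \<noteq> i \<longrightarrow> l \<noteq> j \<longrightarrow> (mcell i j l, mcell (xs ! i) (xs ! j) (xs ! l)) \<notin> flip (snd p))"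
      proof (cases "l = i \<or> l = j")
        case False
        have "xs ! i = \<sigma> (n - i)" "xs ! j = \<sigma> (n - j)" "xs ! l = \<sigma> (n - l)" using nth ij l by auto
        then show ?thesis using False col[OF l] ne[OF l] by (simp add: flip_def mcell_le)
      qed auto
    qed
    have mm: "min (\<sigma> (n - j)) (\<sigma> (n - i)) = \<sigma> (n - i)" "max (\<sigma> (n - j)) (\<sigma> (n - i)) = \<sigma> (n - j)"
      using True by auto
    have "xs ! i < xs ! j" using True nth ij by simp
    moreover have "1 \<le> n - j" "n - j < n - i" "n - i \<le> n" "\<not> \<sigma> (n - j) < \<sigma> (n - i)" using ij True by auto
    ultimately show ?thesis
      unfolding mesh_occurrence_iff[OF \<sigma> R] occs_def len mem_Collect_eq case_prod_conv all mm E
      using ij desc by blast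
  next
    case False
    then have "\<sigma> (n - j) < \<sigma> (n - i)" using inj[of "n - i" "n - j"] ij by auto
    moreover have "\<not> xs ! i < xs ! j" using False nth ij by simp
    ultimately show ?thesis
      unfolding mesh_occurrence_iff[OF \<sigma> R] occs_def using desc by simp
  qed
  have "{q. mesh_occurrence n \<sigma> p q} = (\<lambda>(i, j). (n - j, n - i)) ` occs (flip (snd p)) xs"
  proof (intro equalityI subsetI)
    fix q assume q: "q \<in> {q. mesh_occurrence n \<sigma> p q}"
    obtain a b where ab: "q = (a, b)" by (cases q)
    then have r: "1 \<le> a" "a < b" "b \<le> n" using q by (auto simp: mesh_occurrence_def)
    then have e: "q = (\<lambda>(i, j). (n - j, n - i)) (n - b, n - a)" using ab by auto
    moreover have "(n - b, n - a) \<in> occs (flip (snd p)) xs"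
      using iff[of "n - b" "n - a"] r q ab by auto
    ultimately show "q \<in> (\<lambda>(i, j). (n - j, n - i)) ` occs (flip (snd p)) xs" by (rule image_eqI)
  next
    fix q assume "q \<in> (\<lambda>(i, j). (n - j, n - i)) ` occs (flip (snd p)) xs"
    then obtain i j where "q = (n - j, n - i)" "(i, j) \<in> occs (flip (snd p)) xs" by auto
    moreover then have "i < j" "j < n" by (auto simp: occs_def len)
    ultimately show "q \<in> {q. mesh_occurrence n \<sigma> p q}" using iff by simp
  qed
  moreover have "inj_on (\<lambda>(i, j). (n - j, n - i)) (occs (flip (snd p)) xs)"
    by (auto simp: inj_on_def occs_def len)
  ultimately show ?thesis unfolding mesh_count_def xs_def[symmetric] by (simp add: card_image)
qed

definition ascent_shading :: "mesh_pattern \<Rightarrow> (nat \<times> nat) set" where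
  "ascent_shading p = (if fst p 1 < fst p 2 then snd p else flip (snd p))"

lemma mesh_distribution_eq_distr:
  assumes "p \<in> mesh_patterns2"
  shows "mesh_distribution n k p = distr (ascent_shading p) n k"
proof -
  have R: "snd p \<subseteq> {0, 1, 2} \<times> {0, 1, 2}" using assms by (auto simp: mesh_patterns2_def)
  obtain F where F: "bij_betw F {\<sigma>. \<sigma> permutes {1..n}} (perms n)"
    "\<And>\<sigma>. \<sigma> permutes {1..n} \<Longrightarrow> mesh_count n \<sigma> p = card (occs (ascent_shading p) (F \<sigma>))"
  proof (cases "fst p 1 < fst p 2")
    case True
    then have "ascent_shading p = snd p" by (simp add: ascent_shading_def)
    then show ?thesis
      by (intro that[OF bij_betw_one_line]) (simp add: mesh_count_ascent[OF _ R True] del: upt_Suc)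
  next
    case False
    then have "ascent_shading p = flip (snd p)" by (simp add: ascent_shading_def)
    then show ?thesis
      by (intro that[OF bij_betw_trans[OF bij_betw_one_line bij_betw_rev]])
         (simp add: mesh_count_descent[OF _ R False] del: upt_Suc)
  qed
  have img: "F ` {\<sigma>. \<sigma> permutes {1..n} \<and> mesh_count n \<sigma> p = k} = {xs \<in> perms n. card (occs (ascent_shading p) xs) = k}"
  proof (intro equalityI subsetI)
    fix xs assume xs: "xs \<in> {xs \<in> perms n. card (occs (ascent_shading p) xs) = k}"
    then have "xs \<in> F ` {\<sigma>. \<sigma> permutes {1..n}}" using bij_betw_imp_surj_on[OF F(1)] by simp
    then obtain \<sigma> where \<sigma>: "\<sigma> permutes {1..n}" "xs = F \<sigma>" by blast
    then have "mesh_count n \<sigma> p = k" using F(2)[OF \<sigma>(1)] xs by simp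
    with \<sigma> show "xs \<in> F ` {\<sigma>. \<sigma> permutes {1..n} \<and> mesh_count n \<sigma> p = k}" by blast
  next
    fix xs assume "xs \<in> F ` {\<sigma>. \<sigma> permutes {1..n} \<and> mesh_count n \<sigma> p = k}"
    then obtain \<sigma> where \<sigma>: "\<sigma> permutes {1..n}" "mesh_count n \<sigma> p = k" "xs = F \<sigma>" by blast
    then show "xs \<in> {xs \<in> perms n. card (occs (ascent_shading p) xs) = k}"
      using F(2)[OF \<sigma>(1)] bij_betwE[OF F(1)] by simp
  qed
  have inj: "inj_on F {\<sigma>. \<sigma> permutes {1..n} \<and> mesh_count n \<sigma> p = k}"
    by (rule inj_on_subset[OF bij_betw_imp_inj_on[OF F(1)]]) auto
  show ?thesis unfolding mesh_distribution_def distr_def using card_image[OF inj] img by simp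
qed

text \<open>The relation compares distributions, so its classes are counted by the distributions
  that occur. Every pattern 21 shares its distribution with a pattern 12, which leaves the shadings,
  that is, the words of nine bits.\<close>

lemma dist_classes_eq: "dist_classes = card ((\<lambda>bs. distr (cells bs)) ` {bs. length bs = 9})"
proof -
  let ?G = "Pow ({0, 1, 2} \<times> {0, 1, 2}) :: (nat \<times> nat) set set"
  have "dist_classes = card ((\<lambda>p. distr (ascent_shading p)) ` mesh_patterns2)"
    unfolding dist_classes_def
  proof (rule card_quotient_kernel)
    fix p q
    have "(\<forall>n k. mesh_distribution n k p = mesh_distribution n k q) \<longleftrightarrow>
        distr (ascent_shading p) = distr (ascent_shading q)" if "p \<in> mesh_patterns2" "q \<in> mesh_patterns2"
      unfolding mesh_distribution_eq_distr[OF that(1)] mesh_distribution_eq_distr[OF that(2)] fun_eq_iff ..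
    then show "(p, q) \<in> equidistribution \<longleftrightarrow> p \<in> mesh_patterns2 \<and> q \<in> mesh_patterns2 \<and>
        distr (ascent_shading p) = distr (ascent_shading q)"
      unfolding equidistribution_def mem_Collect_eq case_prod_conv by blast
  qed
  also have "(\<lambda>p. distr (ascent_shading p)) ` mesh_patterns2 = distr ` (ascent_shading ` mesh_patterns2)"
    by (simp add: image_image)
  \<comment> \<open>The patterns with the identity as underlying permutation already give every
    shading.\<close>
  also have "ascent_shading ` mesh_patterns2 = ?G"
  proof (intro equalityI subsetI)
    fix R assume "R \<in> ascent_shading ` mesh_patterns2"
    then obtain p where p: "R = ascent_shading p" "snd p \<subseteq> {0, 1, 2} \<times> {0, 1, 2}"
      by (auto simp: mesh_patterns2_def)
    have "flip (snd p) \<subseteq> {0, 1, 2} \<times> {0, 1, 2}"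
    proof clarify
      fix x y assume "(x, y) \<in> flip (snd p)"
      then have x: "x \<le> 2" and "(2 - x, y) \<in> snd p" by (simp_all add: flip_def)
      then have "y \<in> {0, 1, 2}" using p(2) by blast
      moreover have "x = 0 \<or> x = 1 \<or> x = 2" using x by linarith
      ultimately show "x \<in> {0, 1, 2} \<and> y \<in> {0, 1, 2}" by simp
    qed
    then show "R \<in> ?G" using p by (simp add: ascent_shading_def)
  next
    fix R assume "R \<in> ?G"
    then have "(id, R) \<in> mesh_patterns2" by (simp add: mesh_patterns2_def permutes_id)
    moreover have "ascent_shading (id, R) = R" by (simp add: ascent_shading_def)
    ultimately show "R \<in> ascent_shading ` mesh_patterns2" by (metis imageI)
  qed
  also have "?G = cells ` {bs. length bs = 9}"
  proof (intro equalityI subsetI)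
    fix R assume R: "R \<in> ?G"
    \<comment> \<open>Division with remainder by 3 inverts the code 3x + y of a cell.\<close>
    let ?bs = "map (\<lambda>k. (k div 3, k mod 3) \<in> R) [0..<9]"
    have iff: "(x, y) \<in> cells ?bs \<longleftrightarrow> (x, y) \<in> R" for x y
    proof (cases "x \<le> 2 \<and> y \<le> 2")
      case True
      then have "3 * x + y < 9" "(3 * x + y) div 3 = x" "(3 * x + y) mod 3 = y" by simp_all
      then show ?thesis using True by (simp add: cells_iff del: upt_Suc)
    next
      case False
      have "x \<in> {0, 1, 2} \<and> y \<in> {0, 1, 2}" if "(x, y) \<in> R" using R that by blast
      then have "(x, y) \<notin> R" using False by force
      then show ?thesis using False by (simp add: cells_iff)
    qed
    have "cells ?bs = R"
    proof (rule set_eqI)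
      fix z show "z \<in> cells ?bs \<longleftrightarrow> z \<in> R" using iff[of "fst z" "snd z"] by simp
    qed
    moreover have "length ?bs = 9" by simp
    ultimately show "R \<in> cells ` {bs. length bs = 9}" by blast
  next
    fix R assume "R \<in> cells ` {bs. length bs = 9}"
    then obtain bs where bs: "R = cells bs" by blast
    have "R \<subseteq> {0, 1, 2} \<times> {0, 1, 2}"
    proof clarify
      fix x y assume "(x, y) \<in> R"
      then have "x = 0 \<or> x = 1 \<or> x = 2" "y = 0 \<or> y = 1 \<or> y = 2" unfolding bs cells_iff by linarith+
      then show "x \<in> {0, 1, 2} \<and> y \<in> {0, 1, 2}" by blast
    qed
    then show "R \<in> ?G" by simp
  qed
  also have "distr ` (cells ` {bs. length bs = 9}) = (\<lambda>bs. distr (cells bs)) ` {bs. length bs = 9}"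
    by (simp add: image_image)
  finally show ?thesis .
qed

section \<open>The two bounds\<close>

lemma separated_imp_sorted_wrt:
  "separated E (map (\<lambda>k. (k, h k)) ks) \<Longrightarrow> sorted_wrt (\<lambda>k l. h k \<noteq> h l \<or> (k, l) \<in> set E) ks"
  by (induction ks) (auto simp: list_all_iff)

lemma sorted_wrt_neq_imp_distinct: "sorted_wrt (\<lambda>a b. f a \<noteq> f b) xs \<Longrightarrow> distinct (map f xs)"
  by (induction xs) auto

lemma length_reps: "length reps = 105"
  by (simp add: reps_def length_classes)

text \<open>Equal distributions would give equal tables for every length, but any two
  representatives have different tables for one of the lengths 4, 5 and 6.\<close>

lemma distinct_distr_reps: "distinct (map (\<lambda>k. distr (cells (shading_bits k))) reps)"
proof (rule sorted_wrt_neq_imp_distinct, rule sorted_wrt_mono_rel)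
  let ?h = "\<lambda>n k. histogram (map ascent_cells (all_perms n)) (shading_bits k)"
  show "sorted_wrt (\<lambda>k l. ?h 4 k \<noteq> ?h 4 l \<or> (k, l) \<in> set (pairs5 @ pairs6)) reps"
    by (rule separated_imp_sorted_wrt) (rule separated_4[unfolded histograms_def])
  fix k l assume kl: "?h 4 k \<noteq> ?h 4 l \<or> (k, l) \<in> set (pairs5 @ pairs6)"
  have "?h n k = ?h n l" if "distr (cells (shading_bits k)) = distr (cells (shading_bits l))" for n
    by (rule equid_histogram) (simp add: equid_iff_distr that)
  moreover have "?h 4 k \<noteq> ?h 4 l \<or> ?h 5 k \<noteq> ?h 5 l \<or> ?h 6 k \<noteq> ?h 6 l"
  proof -
    have 5: "?h 5 k \<noteq> ?h 5 l" if "(k, l) \<in> set pairs5"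
      using that separated_5 unfolding all_differ_def list_all_iff histograms_differ_def by blast
    have 6: "?h 6 k \<noteq> ?h 6 l" if "(k, l) \<in> set pairs6"
      using that separated_6 unfolding all_differ_def list_all_iff histograms_differ_def by blast
    show ?thesis using kl 5 6 unfolding set_append by blast
  qed
  ultimately show "distr (cells (shading_bits k)) \<noteq> distr (cells (shading_bits l))" by blast
qed

theorem theorem1p2:
  shows "105 \<le> dist_classes \<and> dist_classes \<le> 106"
proof
  let ?f = "\<lambda>bs. distr (cells bs)" and ?A = "{bs :: bool list. length bs = 9}"
  let ?r = "map (\<lambda>c. shading_bits (hd c)) classes"
  have "?f ` ?A \<subseteq> ?f ` set ?r"
  proof
    fix g assume "g \<in> ?f ` ?A"
    then obtain bs where "length bs = 9" "g = ?f bs" by auto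
    moreover then obtain r where "r \<in> set ?r" "?f r = ?f bs"
      using equid_class_rep[of bs] unfolding equid_iff_distr by blast
    ultimately show "g \<in> ?f ` set ?r" by (metis imageI)
  qed
  then have "card (?f ` ?A) \<le> card (?f ` set ?r)" by (intro card_mono) auto
  also have "\<dots> \<le> length ?r" using card_image_le[of "set ?r" ?f] card_length[of ?r] by simp
  finally show "dist_classes \<le> 106" by (simp add: dist_classes_eq length_classes)
  have "length (shading_bits k) = 9" if "k \<in> set reps" for k
  proof -
    have "k \<in> hd ` set (take 105 classes)" using that by (simp add: reps_def)
    then obtain c where "c \<in> set (take 105 classes)" and k: "k = hd c" by blast
    then have c: "c \<in> set classes" by (blast dest: in_set_takeD)
    then have "class_ok (map shading_bits c)" using classes_ok by (simp add: list_all_iff)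
    then show ?thesis unfolding k by (cases c) auto
  qed
  then have "set (map (\<lambda>k. ?f (shading_bits k)) reps) \<subseteq> ?f ` ?A" by auto
  moreover have "finite (?f ` ?A)"
    using finite_lists_length_eq[of "UNIV :: bool set" 9] by simp
  ultimately have "card (set (map (\<lambda>k. ?f (shading_bits k)) reps)) \<le> card (?f ` ?A)" by (intro card_mono)
  then show "105 \<le> dist_classes"
    using distinct_card[OF distinct_distr_reps] by (simp add: dist_classes_eq length_reps)
qed

end
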